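(* Let $r\ge1$ be an integer and let $m$ be an $L^{2r}(\mathbb{R})$ multiplier supported in $(-1/2,1/2]$. There is a constant $C_{2r}$ such that the following holds. Let $Z$ be a finite relatively prime set of integers contained in $(1,q(Z)]$. Then as long as $0<\varepsilon<r^{-1}q(Z)^{-2r}$, for all $f\in\ell^{2r}(\mathbb{Z})$, $$\Big\|\sum_{a/q\in\mathcal{R}(Z)}f_{a/q}\Big\|_{\ell^{2r}(\mathbb{Z})}\le C_{2r}\Big\|\Big(\sum_{a/q\in\mathcal{R}(Z)}|f_{a/q}|^2\Big)^{1/2}\Big\|_{\ell^{2r}(\mathbb{Z})}+C_{2r}\Big\|\Big(\sum_{q\in Z}\Big|\sum_{a/q\in\mathcal{R}(q)}f_{a/q}\Big|^{2r}\Big)^{1/2r}\Big\|_{\ell^{2r}(\mathbb{Z})},$$ where $C_{2r}$ is independent of $Z$, $\varepsilon$ and $f$.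
   Context: For $f\in\ell^1(\mathbb{Z})$ put $\widehat f(\xi)=\sum_{n\in\mathbb{Z}}f(n)e^{-2\pi i n\xi}$, a 1-periodic function. Let $\mathscr{F}$ be the Euclidean Fourier transform on $\mathbb{R}$. A bounded measurable function $m:\mathbb{R}\to\mathbb{C}$ is an $L^p(\mathbb{R})$ multiplier of norm $B_p$ if $Tf=\mathscr{F}^{-1}(m\cdot\mathscr{F}f)$ satisfies $\|Tf\|_{L^p}\le B_p\|f\|_{L^p}$ for all $f\in L^p(\mathbb{R})$. For a finite set $Z$ of positive integers, $\mathcal{R}(Z)=\{a/q: q\in Z,\ 1\le a\le q,\ \gcd(a,q)=1\}$ and $\mathcal{R}(q)=\mathcal{R}(\{q\})$. $Z$ is a relatively prime set if $\gcd(q,q')=1$ for all distinct $q,q'\in Z$. $q(Z)$ denotes a number with $Z\subset(1,q(Z)]$. Given $m$ and $\varepsilon$, the function $f_{a/q}$ on $\mathbb{Z}$ is defined for $f\in\ell^1(\mathbb{Z})$ by $$\widehat{f_{a/q}}(\xi)=\sum_{\ell\in\mathbb{Z}}m\big(\varepsilon^{-1}(\xi-\ell-a/q)\big)\,\widehat f(\xi);$$ for $f\in\ell^{2r}(\mathbb{Z})$ the operators $f\mapsto f_{a/q}$ are understood as the bounded extensions by density. *)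

theory Defs
  imports "HOL-Analysis.Analysis"
begin

text \<open>The spaces \<open>L\<^sup>p(M)\<close> for \<open>1 \<le> p < \<infinity>\<close>, used for \<open>M = lebesgue\<close> and, as \<open>\<ell>\<^sup>p(\<int>)\<close>, for
  \<open>M = count_space UNIV\<close>.  Since the Bochner integral of a non-integrable function is \<open>0\<close>,
  \<open>Lp_norm\<close> is meaningful only on members of \<open>Lp_space\<close>.\<close>

definition Lp_space :: "'a measure \<Rightarrow> real \<Rightarrow> ('a \<Rightarrow> 'b::real_normed_vector) set" where
  "Lp_space M p = {f \<in> borel_measurable M. integrable M (\<lambda>x. norm (f x) powr p)}"

definition Lp_norm :: "'a measure \<Rightarrow> real \<Rightarrow> ('a \<Rightarrow> 'b::real_normed_vector) \<Rightarrow> real" where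
  "Lp_norm M p f = (LINT x|M. norm (f x) powr p) powr (1 / p)"

definition Lp_tendsto ::
  "'a measure \<Rightarrow> real \<Rightarrow> (nat \<Rightarrow> 'a \<Rightarrow> 'b::real_normed_vector) \<Rightarrow> ('a \<Rightarrow> 'b) \<Rightarrow> bool" where
  "Lp_tendsto M p u g \<longleftrightarrow>
     (\<forall>k. (\<lambda>x. u k x - g x) \<in> Lp_space M p) \<and>
     (\<lambda>k. Lp_norm M p (\<lambda>x. u k x - g x)) \<longlonglongrightarrow> 0"

text \<open>\<open>g\<close> is the value at \<open>f \<in> L\<^sup>p(M)\<close> of the extension by density of the operator \<open>T\<close>, given on a
  class \<open>D\<close> that is dense in \<open>L\<^sup>p(M)\<close>: it is the \<open>L\<^sup>p\<close> limit of \<open>T u\<^sub>k\<close> for every sequence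
  \<open>u\<^sub>k \<in> D\<close> that converges to \<open>f\<close> in \<open>L\<^sup>p\<close>.\<close>

definition density_extension ::
  "'a measure \<Rightarrow> real \<Rightarrow> ('a \<Rightarrow> 'b::real_normed_vector) set \<Rightarrow>
    (('a \<Rightarrow> 'b) \<Rightarrow> ('a \<Rightarrow> 'b)) \<Rightarrow> ('a \<Rightarrow> 'b) \<Rightarrow> ('a \<Rightarrow> 'b) \<Rightarrow> bool" where
  "density_extension M p D T f g \<longleftrightarrow>
     g \<in> Lp_space M p \<and>
     (\<forall>u. (\<forall>k. u k \<in> D) \<and> Lp_tendsto M p u f \<longrightarrow> Lp_tendsto M p (\<lambda>k. T (u k)) g)"

definition fourier_R :: "(real \<Rightarrow> complex) \<Rightarrow> real \<Rightarrow> complex" where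
  "fourier_R f \<xi> = (LINT x|lebesgue. f x * cis (- 2 * pi * x * \<xi>))"

definition fourier_R_inv :: "(real \<Rightarrow> complex) \<Rightarrow> real \<Rightarrow> complex" where
  "fourier_R_inv g x = (LINT \<xi>|lebesgue. g \<xi> * cis (2 * pi * x * \<xi>))"

text \<open>On this class, which contains the Schwartz functions and is dense in \<open>L\<^sup>p\<close> for
  \<open>1 \<le> p < \<infinity>\<close>, both integrals in \<open>fourier_R_inv (m \<cdot> fourier_R f)\<close> converge absolutely
  for every bounded measurable \<open>m\<close>.\<close>

definition fourier_class :: "(real \<Rightarrow> complex) set" where
  "fourier_class = {f. integrable lebesgue f \<and> integrable lebesgue (fourier_R f)}"

definition multiplier_op :: "(real \<Rightarrow> complex) \<Rightarrow> (real \<Rightarrow> complex) \<Rightarrow> real \<Rightarrow> complex" where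
  "multiplier_op m f = fourier_R_inv (\<lambda>\<xi>. m \<xi> * fourier_R f \<xi>)"

definition Lp_multiplier_of_norm :: "real \<Rightarrow> (real \<Rightarrow> complex) \<Rightarrow> real \<Rightarrow> bool" where
  "Lp_multiplier_of_norm p m B \<longleftrightarrow>
     m \<in> borel_measurable lebesgue \<and> bounded (range m) \<and>
     (\<forall>f \<in> Lp_space lebesgue p. \<exists>g.
        density_extension lebesgue p fourier_class (multiplier_op m) f g \<and>
        Lp_norm lebesgue p g \<le> B * Lp_norm lebesgue p f)"

definition Lp_multiplier :: "real \<Rightarrow> (real \<Rightarrow> complex) \<Rightarrow> bool" where
  "Lp_multiplier p m \<longleftrightarrow> (\<exists>B. Lp_multiplier_of_norm p m B)"

abbreviation lp_space :: "real \<Rightarrow> (int \<Rightarrow> 'b::real_normed_vector) set" where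
  "lp_space p \<equiv> Lp_space (count_space UNIV) p"

abbreviation lp_norm :: "real \<Rightarrow> (int \<Rightarrow> 'b::real_normed_vector) \<Rightarrow> real" where
  "lp_norm p \<equiv> Lp_norm (count_space UNIV) p"

definition fourier_Z :: "(int \<Rightarrow> complex) \<Rightarrow> real \<Rightarrow> complex" where
  "fourier_Z f \<xi> = (\<Sum>\<^sub>\<infinity>n. f n * cis (- 2 * pi * of_int n * \<xi>))"

text \<open>For \<open>f \<in> \<ell>\<^sup>1(\<int>)\<close>, the sequence whose Fourier series is
  \<open>\<Sum>\<^sub>l m (\<epsilon>\<^sup>-\<^sup>1 (\<xi> - l - \<alpha>)) \<cdot> fourier_Z f \<xi>\<close>, written as the Fourier coefficients of this
  1-periodic function; it is square summable but need not be summable.\<close>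

definition freq_piece_l1 ::
  "(real \<Rightarrow> complex) \<Rightarrow> real \<Rightarrow> real \<Rightarrow> (int \<Rightarrow> complex) \<Rightarrow> int \<Rightarrow> complex" where
  "freq_piece_l1 m \<epsilon> \<alpha> f n =
     (LINT \<xi>:{0..<1}|lebesgue.
        (\<Sum>\<^sub>\<infinity>l::int. m (inverse \<epsilon> * (\<xi> - of_int l - \<alpha>))) * fourier_Z f \<xi>
          * cis (2 * pi * of_int n * \<xi>))"

definition freq_piece ::
  "real \<Rightarrow> (real \<Rightarrow> complex) \<Rightarrow> real \<Rightarrow> real \<Rightarrow> (int \<Rightarrow> complex) \<Rightarrow> int \<Rightarrow> complex" where
  "freq_piece p m \<epsilon> \<alpha> f =
     (THE g. density_extension (count_space UNIV) p (lp_space 1) (freq_piece_l1 m \<epsilon> \<alpha>) f g)"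

definition reduced_fractions :: "nat set \<Rightarrow> real set" where
  "reduced_fractions Z =
     {real a / real q | a q. q \<in> Z \<and> 1 \<le> a \<and> a \<le> q \<and> coprime a q}"

end

theory Submission
  imports Defs "HOL-Probability.Probability"
begin

text \<open>Write \<open>F\<^sub>q\<close> for the sum of the \<open>f\<^sub>a\<^sub>/\<^sub>q\<close> with denominator \<open>q\<close> and \<open>H\<close> for the sum of all \<open>F\<^sub>q\<close>.
  The piece \<open>f\<^sub>a\<^sub>/\<^sub>q\<close> has its spectrum within \<open>\<epsilon>/2\<close> of \<open>a/q\<close>, so a product of \<open>2r\<close> pieces or their
  conjugates has its spectrum within \<open>r\<epsilon>\<close> of a rational number.  When a single factor (or a product
  \<open>f\<^sub>a\<^sub>/\<^sub>q cnj f\<^sub>b\<^sub>/\<^sub>q\<close> with \<open>a \<noteq> b\<close>) has denominator \<open>q\<close> and the other denominators are coprime to \<open>q\<close>,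
  this rational number is not an integer; its distance to the integers is at least
  \<open>q(Z)\<^sup>-\<^sup>2\<^sup>r > r\<epsilon>\<close>, and therefore the product sums to zero.  Hence, up to terms of higher order
  in \<open>F\<^sub>q\<close>, \<open>F\<^sub>q\<close> is orthogonal to \<open>H\<^sup>r\<^sup>-\<^sup>1 cnj H\<^sup>r\<close>, which gives
  \<open>\<parallel>H\<parallel>\<^sub>2\<^sub>r \<lesssim> \<parallel>(\<Sum>\<bar>F\<^sub>q\<bar>\<^sup>2)\<^sup>1\<^sup>/\<^sup>2\<parallel>\<^sub>2\<^sub>r\<close> by absorption; in the same way \<open>\<bar>F\<^sub>q\<bar>\<^sup>2\<close> may be replaced by
  \<open>\<Sum>\<bar>f\<^sub>a\<^sub>/\<^sub>q\<bar>\<^sup>2\<close> up to \<open>\<Sum>\<bar>F\<^sub>q\<bar>\<^sup>2\<^sup>r\<close>.  That the pieces are well defined on \<open>\<ell>\<^sup>2\<^sup>r\<close> is the transference of the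
  multiplier \<open>m\<close> from \<open>\<real>\<close> to \<open>\<int>\<close>, obtained by testing \<open>m\<close> on \<open>\<Sum>k. c\<^sub>k \<phi> (x - \<epsilon>k)\<close> for a kernel \<open>\<phi>\<close>
  whose Fourier transform is \<open>1\<close> on the support of \<open>m\<close>.\<close>


section \<open>Absorption inequalities\<close>

text \<open>The constant may depend on \<open>r\<close> but not on \<open>Z\<close>. The triangle
  inequality over \<open>Z\<close> is therefore allowed only for qualitative facts: integrability,
  and errors that vanish in a limit. In the estimates, replacing \<open>H\<close> by
  \<open>H - F q\<close> leaves terms that contain \<open>F q\<close> at least twice; summed over
  \<open>q\<close> they are bounded by the square function times a power of |H|^2 plus the square
  function, and a Young-type splitting returns half of the left side. The same step for |F_q|^2
  leaves its square, which the square function of the pieces does not control; this is the origin of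
  the second term of the theorem. Vanishing needs summable products, but a piece of a summable
  sequence need not be summable itself. This is why spectra are handled by duality, and why a
  general f is reached from its finite truncations through l^(2r) convergence. Transference serves
  the existence of the pieces and their approximation, so its bound may depend on \<epsilon> in any
  way, and the final constant is built from \<open>r\<close> alone.\<close>

lemma integrable_count_bound:
  fixes f :: "'a \<Rightarrow> 'b::{banach,second_countable_topology}"
  assumes "integrable (count_space UNIV) V" and "\<And>n. norm (f n) \<le> V n"
  shows "integrable (count_space UNIV) f"
  by (rule Bochner_Integration.integrable_bound[OF assms(1)]) (auto simp: AE_count_space intro: order_trans[OF assms(2) abs_ge_self])

text \<open>Split at \<open>y \<le> \<eta> * x\<close>: in the first case the left side is at most
  \<open>c * \<eta> * 2 ^ (r - 1) * x ^ r\<close>, in the other \<open>x\<close> is bounded by a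
  multiple of \<open>y\<close>. The coefficient 1/2 is what allows absorption later.\<close>

lemma absorbing_constant:
  fixes c :: real
  assumes "r \<ge> 1" "c \<ge> 0"
  shows "\<exists>C\<ge>0. \<forall>x y. 0 \<le> x \<longrightarrow> 0 \<le> y \<longrightarrow> c * y * (x + y) ^ (r - 1) \<le> x ^ r / 2 + C * y ^ r"
proof -
  define X where "X = c * 2 ^ (r - 1)"
  \<comment> \<open>Small enough that \<open>c * \<eta> * 2 ^ (r - 1) \<le> 1 / 2\<close>, and at
    most 1 so that \<open>x + y \<le> 2 * x\<close> in the first case.\<close>
  define \<eta> where "\<eta> = 1 / (1 + 2 * X)"
  have X: "0 \<le> X" using assms by (simp add: X_def)
  then have \<eta>: "0 < \<eta>" "\<eta> \<le> 1" "c * \<eta> * 2 ^ (r - 1) \<le> 1 / 2"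
  proof -
    show "0 < \<eta>" "\<eta> \<le> 1" using X by (auto simp: \<eta>_def)
    have "c * \<eta> * 2 ^ (r - 1) = X / (1 + 2 * X)" by (simp add: \<eta>_def X_def)
    also have "\<dots> \<le> 1 / 2" using X by (simp add: field_simps)
    finally show "c * \<eta> * 2 ^ (r - 1) \<le> 1 / 2" .
  qed
  have red: "z * z ^ (r - 1) = z ^ r" for z :: real
    using assms(1) by (simp flip: power_Suc)
  have "c * y * (x + y) ^ (r - 1) \<le> x ^ r / 2 + c * (1 / \<eta> + 1) ^ (r - 1) * y ^ r"
    if xy: "0 \<le> x" "0 \<le> y" for x y
  proof (cases "y \<le> \<eta> * x")
    case True
    then have "x + y \<le> 2 * x" using \<eta> xy mult_right_mono[of \<eta> 1 x] by linarith
    then have "(x + y) ^ (r - 1) \<le> (2 * x) ^ (r - 1)"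
      using xy by (intro power_mono) auto
    then have "c * y * (x + y) ^ (r - 1) \<le> c * (\<eta> * x) * (2 * x) ^ (r - 1)"
      using True xy assms \<eta> by (intro mult_mono mult_left_mono) auto
    also have "\<dots> = (c * \<eta> * 2 ^ (r - 1)) * x ^ r"
      by (simp add: power_mult_distrib flip: red)
    also have "\<dots> \<le> 1 / 2 * x ^ r" using \<eta> xy by (intro mult_right_mono) auto
    also have "\<dots> \<le> x ^ r / 2 + c * (1 / \<eta> + 1) ^ (r - 1) * y ^ r"
      using xy assms \<eta> by simp
    finally show ?thesis .
  next
    case False
    then have "x \<le> y / \<eta>" using \<eta> by (simp add: field_simps)
    then have "(x + y) ^ (r - 1) \<le> ((1 / \<eta> + 1) * y) ^ (r - 1)"
      using xy by (intro power_mono) (auto simp: algebra_simps)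
    then have "c * y * (x + y) ^ (r - 1) \<le> c * y * ((1 / \<eta> + 1) * y) ^ (r - 1)"
      using xy assms by (intro mult_left_mono) auto
    also have "\<dots> = c * (1 / \<eta> + 1) ^ (r - 1) * y ^ r"
      by (simp add: power_mult_distrib flip: red)
    also have "\<dots> \<le> x ^ r / 2 + c * (1 / \<eta> + 1) ^ (r - 1) * y ^ r"
      using xy by simp
    finally show ?thesis .
  qed
  moreover have "0 \<le> c * (1 / \<eta> + 1) ^ (r - 1)" using assms \<eta> by simp
  ultimately show ?thesis by blast
qed

lemma norm_power_diff_le:
  fixes x y :: "'a::real_normed_field"
  assumes "norm x \<le> T" "norm y \<le> T"
  shows "norm (x ^ n - y ^ n) \<le> real n * T ^ (n - 1) * norm (x - y)"
proof -
  have T: "0 \<le> T" using assms(1) norm_ge_zero order_trans by blast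
  have "norm (\<Sum>i<n. y ^ (n - Suc i) * x ^ i) \<le> (\<Sum>i<n. T ^ (n - 1))"
  proof (rule sum_norm_le)
    fix i assume "i \<in> {..<n}"
    then have "n - 1 = (n - Suc i) + i" by simp
    then have "T ^ (n - 1) = T ^ (n - Suc i) * T ^ i" by (metis power_add)
    then show "norm (y ^ (n - Suc i) * x ^ i) \<le> T ^ (n - 1)"
      using assms T by (auto simp: norm_mult norm_power intro!: mult_mono power_mono)
  qed
  then have "norm ((x - y) * (\<Sum>i<n. y ^ (n - Suc i) * x ^ i)) \<le> norm (x - y) * (real n * T ^ (n - 1))"
    by (simp add: norm_mult mult_left_mono)
  then show ?thesis unfolding power_diff_sumr2 by (simp only: mult_ac)
qed

text \<open>The product \<open>z ^ (r - 1) * cnj (z ^ r)\<close> has \<open>2 * r - 1\<close>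
  factors; changing \<open>x\<close> to \<open>y\<close> in one factor at a time leaves one
  difference against \<open>2 * r - 2\<close> factors bounded by \<open>T\<close>.\<close>

lemma norm_power_cnj_power_diff_le:
  fixes x y :: complex
  assumes "norm x \<le> T" "norm y \<le> T" "r \<ge> 1"
  shows "norm (x ^ (r - 1) * cnj (x ^ r) - y ^ (r - 1) * cnj (y ^ r))
    \<le> (2 * real r - 1) * T ^ (2 * r - 2) * norm (x - y)"
proof -
  have T: "0 \<le> T" using assms(1) norm_ge_zero order_trans by blast
  have "x ^ (r - 1) * cnj (x ^ r) - y ^ (r - 1) * cnj (y ^ r)
      = (x ^ (r - 1) - y ^ (r - 1)) * cnj (x ^ r) + y ^ (r - 1) * cnj (x ^ r - y ^ r)"
    by (simp add: algebra_simps)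
  also have "norm \<dots> \<le> (real (r - 1) * T ^ (r - 1 - 1) * norm (x - y)) * T ^ r
      + T ^ (r - 1) * (real r * T ^ (r - 1) * norm (x - y))"
    unfolding norm_mult complex_mod_cnj
    apply (rule order_trans[OF norm_triangle_ineq], unfold norm_mult complex_mod_cnj)
    apply (intro add_mono mult_mono norm_power_diff_le assms)
    using assms T by (auto simp: norm_power intro!: power_mono mult_nonneg_nonneg)
  also have "\<dots> = (2 * real r - 1) * T ^ (2 * r - 2) * norm (x - y)"
  \<comment> \<open>For \<open>r = 1\<close> the exponent \<open>r - 1 - 1\<close> is truncated, but
    its coefficient \<open>real (r - 1)\<close> is 0.\<close>
  proof (cases "r = 1")
    case False
    define k where "k = r - 2"
    have k: "r = Suc (Suc k)" using False assms(3) by (simp add: k_def)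
    have "2 * r - 2 = Suc (Suc (k + k))" by (simp add: k)
    then have e: "T ^ (2 * r - 2) = T * (T * (T ^ k * T ^ k))" by (simp add: power_add)
    show ?thesis unfolding e by (simp add: k algebra_simps)
  qed simp
  finally show ?thesis .
qed

text \<open>The terms of \<open>\<bar>H\<bar>\<^sup>2\<^sup>r = \<Sum>q. F\<^sub>q H\<^sup>r\<^sup>-\<^sup>1 cnj H\<^sup>r\<close> that contain \<open>F\<^sub>q\<close> only once integrate to zero.\<close>

lemma superorthogonal_square_function:
  fixes F :: "'i \<Rightarrow> 'a \<Rightarrow> complex" and Z :: "'i set"
  defines "H \<equiv> \<lambda>n. \<Sum>q\<in>Z. F q n"
  assumes Z: "finite Z" and r: "r \<ge> 1"
    and V: "integrable (count_space UNIV) (\<lambda>n. (\<Sum>q\<in>Z. norm (F q n)) ^ (2 * r))"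
    and van: "\<And>q. q \<in> Z \<Longrightarrow>
      (LINT n|count_space UNIV. F q n * ((H n - F q n) ^ (r - 1) * cnj ((H n - F q n) ^ r))) = 0"
    and C: "\<And>x y. 0 \<le> x \<Longrightarrow> 0 \<le> y \<Longrightarrow>
      (2 * real r - 1) * 2 ^ (r - 1) * y * (x + y) ^ (r - 1) \<le> x ^ r / 2 + C * y ^ r"
  shows "(LINT n|count_space UNIV. norm (H n) ^ (2 * r))
    \<le> 2 * C * (LINT n|count_space UNIV. (\<Sum>q\<in>Z. (norm (F q n))\<^sup>2) ^ r)"
proof -
  \<comment> \<open>Majorant for integrability only; estimating by it would cost a factor that grows
    with \<open>Z\<close>.\<close>
  define V where "V n = (\<Sum>q\<in>Z. norm (F q n))" for n
  define A where "A n = (\<Sum>q\<in>Z. (norm (F q n))\<^sup>2)" for n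
  let ?a = "\<lambda>q n. F q n * ((H n) ^ (r - 1) * cnj ((H n) ^ r))"
  let ?b = "\<lambda>q n. F q n * ((H n - F q n) ^ (r - 1) * cnj ((H n - F q n) ^ r))"
  let ?M = "count_space (UNIV :: 'a set)"
  have V0: "0 \<le> V n" for n by (simp add: V_def sum_nonneg)
  have A0: "0 \<le> A n" for n by (simp add: A_def sum_nonneg)
  have FV: "norm (F q n) \<le> V n" if "q \<in> Z" for q n
    unfolding V_def using Z that by (intro member_le_sum) auto
  have HV: "norm (H n) \<le> V n" for n
    unfolding V_def H_def by (rule norm_sum)
  have KV: "norm (H n - F q n) \<le> V n" if "q \<in> Z" for q n
  proof -
    have "H n - F q n = (\<Sum>q'\<in>Z - {q}. F q' n)"
      unfolding H_def using Z that by (simp add: sum_diff1)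
    also have "norm \<dots> \<le> (\<Sum>q'\<in>Z - {q}. norm (F q' n))" by (rule norm_sum)
    also have "\<dots> \<le> V n" unfolding V_def using Z by (intro sum_mono2) auto
    finally show ?thesis .
  qed
  have AV: "A n \<le> (V n)\<^sup>2" for n
  proof -
    have "A n \<le> (\<Sum>q\<in>Z. norm (F q n) * V n)"
      unfolding A_def power2_eq_square by (intro sum_mono mult_left_mono FV) auto
    also have "\<dots> = V n * V n" by (simp add: V_def sum_distrib_right)
    finally show ?thesis by (simp add: power2_eq_square)
  qed
  have e: "V n * (V n ^ (r - 1) * V n ^ r) = V n ^ (2 * r)" for n
    using r by (simp add: mult_2 power_add flip: power_Suc mult.assoc)
  have bnd: "norm (F q n * (z ^ (r - 1) * cnj (z ^ r))) \<le> V n ^ (2 * r)"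
    if "q \<in> Z" "norm z \<le> V n" for q n z
    unfolding e[symmetric] norm_mult complex_mod_cnj norm_power
    by (intro mult_mono power_mono FV that norm_ge_zero V0 zero_le_power mult_nonneg_nonneg)
  have iV: "integrable ?M (\<lambda>n. V n ^ (2 * r))" using V by (simp add: V_def)
  have i1: "integrable ?M (\<lambda>n. ?a q n)" if "q \<in> Z" for q
    by (rule integrable_count_bound[OF iV]) (rule bnd[OF that HV])
  have i2: "integrable ?M (\<lambda>n. ?b q n)"
    if "q \<in> Z" for q
    by (rule integrable_count_bound[OF iV]) (rule bnd[OF that KV[OF that]])
  have iH: "integrable ?M (\<lambda>n. norm (H n) ^ (2 * r))"
    by (rule integrable_count_bound[OF iV]) (auto intro: power_mono HV)
  have iA: "integrable ?M (\<lambda>n. A n ^ r)"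
    by (rule integrable_count_bound[OF iV]) (auto simp: A0 power_mult intro!: power_mono AV)
  let ?D = "\<lambda>q n. ?a q n
      - ?b q n"
  have Hexp: "complex_of_real (norm (H n) ^ (2 * r)) = (\<Sum>q\<in>Z. ?a q n)" for n
  proof -
    have gen: "H n * w = (\<Sum>q\<in>Z. F q n * w)" for w by (simp add: H_def sum_distrib_right)
    have "complex_of_real (norm (H n) ^ (2 * r)) = complex_of_real ((norm (H n))\<^sup>2) ^ r"
      by (simp add: power_mult)
    also have "\<dots> = (H n * cnj (H n)) ^ r" by (simp only: complex_norm_square)
    also have "\<dots> = H n ^ r * cnj (H n ^ r)" by (simp add: power_mult_distrib)
    also have "\<dots> = (H n * H n ^ (r - 1)) * cnj (H n ^ r)"
      using r by (simp flip: power_Suc)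
    also have "\<dots> = H n * (H n ^ (r - 1) * cnj (H n ^ r))" by (rule mult.assoc)
    also have "\<dots> = (\<Sum>q\<in>Z. F q n * (H n ^ (r - 1) * cnj (H n ^ r)))" by (rule gen)
    finally show ?thesis .
  qed
  \<comment> \<open>\<open>?D q n\<close> is \<open>F q n\<close> times a difference that is itself
    of order \<open>F q n\<close>, hence quadratic. The sum over \<open>q\<close> then produces
    \<open>A n\<close> without counting \<open>Z\<close>; \<open>T\<close> dominates both
    \<open>H n\<close> and every \<open>H n - F q n\<close>.\<close>
  have ptw: "norm (\<Sum>q\<in>Z. ?D q n) \<le> norm (H n) ^ (2 * r) / 2 + C * A n ^ r" for n
  proof -
    define T where "T = norm (H n) + sqrt (A n)"
    have T0: "0 \<le> T" by (simp add: T_def A0)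
    have FA: "norm (F q n) \<le> sqrt (A n)" if "q \<in> Z" for q
      unfolding A_def using that Z
      by (intro real_le_rsqrt member_le_sum) auto
    have "norm (?D q n) \<le> (2 * real r - 1) * T ^ (2 * r - 2) * (norm (F q n))\<^sup>2" if "q \<in> Z" for q
    proof -
      have "?D q n = F q n * ((H n) ^ (r - 1) * cnj ((H n) ^ r) - (H n - F q n) ^ (r - 1) * cnj ((H n - F q n) ^ r))"
        by (simp only: right_diff_distrib)
      also have "norm \<dots> \<le> norm (F q n) * ((2 * real r - 1) * T ^ (2 * r - 2) * norm (H n - (H n - F q n)))"
        unfolding norm_mult[of "F q n"]
        apply (intro mult_left_mono norm_power_cnj_power_diff_le r norm_ge_zero)
        subgoal using A0 by (simp add: T_def)
        subgoal using FA[OF that] norm_triangle_ineq4[of "H n" "F q n"] by (simp add: T_def)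
        done
      finally show ?thesis by (simp add: power2_eq_square mult_ac)
    qed
    then have "norm (\<Sum>q\<in>Z. ?D q n) \<le> (\<Sum>q\<in>Z. (2 * real r - 1) * T ^ (2 * r - 2) * (norm (F q n))\<^sup>2)"
      by (intro sum_norm_le) auto
    also have "\<dots> = (2 * real r - 1) * A n * (T\<^sup>2) ^ (r - 1)"
    proof -
      have "2 * r - 2 = 2 * (r - 1)" by simp
      then show ?thesis
        unfolding sum_distrib_left[symmetric] A_def[symmetric] power_mult[symmetric]
        by (simp only: mult_ac)
    qed
    \<comment> \<open>This bound for the square of \<open>T\<close> is the source of the factor
      \<open>2 ^ (r - 1)\<close> in the hypothesis on \<open>C\<close>.\<close>
    also have "\<dots> \<le> (2 * real r - 1) * A n * (2 * ((norm (H n))\<^sup>2 + A n)) ^ (r - 1)"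
    proof (intro mult_left_mono power_mono)
      have "T\<^sup>2 \<le> 2 * ((norm (H n))\<^sup>2 + (sqrt (A n))\<^sup>2)"
        unfolding T_def using sum_squares_bound[of "norm (H n)" "sqrt (A n)"]
        by (simp add: power2_sum)
      then show "T\<^sup>2 \<le> 2 * ((norm (H n))\<^sup>2 + A n)" using A0[of n] by simp
    qed (use r A0 in auto)
    also have "\<dots> = (2 * real r - 1) * 2 ^ (r - 1) * A n * ((norm (H n))\<^sup>2 + A n) ^ (r - 1)"
      by (simp only: power_mult_distrib mult_ac)
    also have "\<dots> \<le> ((norm (H n))\<^sup>2) ^ r / 2 + C * A n ^ r"
      by (intro C A0) auto
    finally show ?thesis by (simp add: power_mult)
  qed
  have iD: "integrable ?M (\<lambda>n. \<Sum>q\<in>Z. ?D q n)"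
    by (intro Bochner_Integration.integrable_sum Bochner_Integration.integrable_diff i1 i2)
  have "complex_of_real (LINT n|?M. norm (H n) ^ (2 * r)) = (LINT n|?M. complex_of_real (norm (H n) ^ (2 * r)))"
    by (rule integral_complex_of_real[symmetric])
  also have "\<dots> = (\<Sum>q\<in>Z. LINT n|?M. ?a q n)"
    unfolding Hexp by (rule Bochner_Integration.integral_sum) (rule i1)
  \<comment> \<open>By the vanishing hypothesis \<open>?b q\<close> is subtracted free of
    charge.\<close>
  also have "\<dots> = (\<Sum>q\<in>Z. LINT n|?M. ?D q n)"
  proof (rule sum.cong)
    fix q assume q: "q \<in> Z"
    show "(LINT n|?M. ?a q n) = (LINT n|?M. ?D q n)"
      unfolding Bochner_Integration.integral_diff[OF i1[OF q] i2[OF q]] van[OF q] by (rule diff_zero[symmetric])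
  qed (rule refl)
  also have "\<dots> = (LINT n|?M. (\<Sum>q\<in>Z. ?D q n))"
    by (rule Bochner_Integration.integral_sum[symmetric]) (intro Bochner_Integration.integrable_diff i1 i2)
  finally have "norm (complex_of_real (LINT n|?M. norm (H n) ^ (2 * r))) = norm (LINT n|?M. (\<Sum>q\<in>Z. ?D q n))"
    by simp
  then have "(LINT n|?M. norm (H n) ^ (2 * r)) \<le> norm (LINT n|?M. (\<Sum>q\<in>Z. ?D q n))"
    by simp
  also have "\<dots> \<le> (LINT n|?M. norm (\<Sum>q\<in>Z. ?D q n))"
    by (rule integral_norm_bound)
  also have "\<dots> \<le> (LINT n|?M. norm (H n) ^ (2 * r) / 2 + C * A n ^ r)"
    using iH iA iD by (intro integral_mono ptw) auto
  also have "\<dots> = (LINT n|?M. norm (H n) ^ (2 * r)) / 2 + C * (LINT n|?M. A n ^ r)"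
    using iH iA by simp
  \<comment> \<open>The term with factor 1/2 moves to the left, which doubles
    \<open>C\<close>.\<close>
  finally show ?thesis by (simp add: A_def)
qed

lemma power_add_le_2:
  fixes x y :: real
  assumes "0 \<le> x" "0 \<le> y"
  shows "(x + y) ^ r \<le> 2 ^ r * (x ^ r + y ^ r)"
proof -
  have "(x + y) ^ r \<le> (2 * max x y) ^ r" using assms by (intro power_mono) auto
  also have "\<dots> = 2 ^ r * max x y ^ r" by (rule power_mult_distrib)
  also have "max x y ^ r \<le> x ^ r + y ^ r" using assms by (auto simp: max_def)
  finally show ?thesis by simp
qed

text \<open>Meant for \<open>G q\<close> = |F_q|^2 and \<open>s q\<close> = the sum of |f_(a/q)|^2
  over the fractions with denominator \<open>q\<close>: the difference is the off-diagonal part,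
  which integrates to 0 against powers of the other \<open>G\<close>. Passing from
  \<open>A n\<close> to \<open>A n - G q n\<close> produces the square of \<open>G q n\<close>; one
  of its two factors is traded for an l^r norm over \<open>q\<close>, whence the last term.\<close>

lemma superorthogonal_squares:
  fixes G s :: "'i \<Rightarrow> 'a \<Rightarrow> real" and Z :: "'i set"
  defines "A \<equiv> \<lambda>n. \<Sum>q\<in>Z. G q n" and "S \<equiv> \<lambda>n. \<Sum>q\<in>Z. s q n"
  assumes Z: "finite Z" and r: "r \<ge> 1"
    and G0: "\<And>q n. q \<in> Z \<Longrightarrow> 0 \<le> G q n" and s0: "\<And>q n. q \<in> Z \<Longrightarrow> 0 \<le> s q n"
    and iA: "integrable (count_space UNIV) (\<lambda>n. A n ^ r)"
    and iS: "integrable (count_space UNIV) (\<lambda>n. S n ^ r)"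
    and van: "\<And>q. q \<in> Z \<Longrightarrow>
      (LINT n|count_space UNIV. (G q n - s q n) * (A n - G q n) ^ (r - 1)) = 0"
    and C0: "0 \<le> C"
    and C: "\<And>x y. 0 \<le> x \<Longrightarrow> 0 \<le> y \<Longrightarrow>
      real r * y * (x + y) ^ (r - 1) \<le> x ^ r / 2 + C * y ^ r"
  shows "(LINT n|count_space UNIV. A n ^ r)
    \<le> 2 * C * 2 ^ r * ((LINT n|count_space UNIV. S n ^ r) + (LINT n|count_space UNIV. (\<Sum>q\<in>Z. G q n ^ r)))"
proof -
  let ?M = "count_space (UNIV :: 'a set)"
  let ?b = "\<lambda>q n. (G q n - s q n) * (A n - G q n) ^ (r - 1)"
  have A0: "0 \<le> A n" for n unfolding A_def by (intro sum_nonneg G0)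
  have S0: "0 \<le> S n" for n unfolding S_def by (intro sum_nonneg s0)
  have GA: "G q n \<le> A n" if "q \<in> Z" for q n
    unfolding A_def using Z that G0 by (intro member_le_sum) auto
  have sS: "s q n \<le> S n" if "q \<in> Z" for q n
    unfolding S_def using Z that s0 by (intro member_le_sum) auto
  have red: "z * z ^ (r - 1) = z ^ r" for z :: real
    using r by (simp flip: power_Suc)
  define X where "X n = (\<Sum>q\<in>Z. G q n ^ r)" for n
  have X0: "0 \<le> X n" for n unfolding X_def by (intro sum_nonneg zero_le_power G0)
  have iX: "integrable ?M X"
    unfolding X_def
  proof (rule Bochner_Integration.integrable_sum)
    fix q assume q: "q \<in> Z"
    show "integrable ?M (\<lambda>n. G q n ^ r)"
      by (rule integrable_count_bound[OF iA]) (use q G0 GA in \<open>auto intro!: power_mono\<close>)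
  qed
  \<comment> \<open>Dominates every \<open>G q n\<close>, so that the sum of
    \<open>G q n * M n\<close> is \<open>A n * M n\<close> with no loss in the size of
    \<open>Z\<close>, while its \<open>r\<close>-th power is just \<open>X n\<close>.\<close>
  define M where "M n = root r (X n)" for n
  have M0: "0 \<le> M n" for n unfolding M_def using X0 by (simp add: real_root_ge_zero)
  have Mr: "M n ^ r = X n" for n unfolding M_def using X0 r by (simp add: real_root_pow_pos2)
  have GM: "G q n \<le> M n" if "q \<in> Z" for q n
  proof -
    have "G q n ^ r \<le> X n"
      unfolding X_def using Z that G0 by (intro member_le_sum) auto
    then have "G q n ^ r \<le> M n ^ r" by (simp add: Mr)
    then show ?thesis using M0 r G0[OF that] by (simp add: power_mono_iff)
  qed
  have iV: "integrable ?M (\<lambda>n. 2 ^ r * (A n ^ r + S n ^ r))" using iA iS by simp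
  have i1: "integrable ?M (\<lambda>n. G q n * A n ^ (r - 1))" if "q \<in> Z" for q
  proof (rule integrable_count_bound[OF iA])
    show "norm (G q n * A n ^ (r - 1)) \<le> A n ^ r" for n
      unfolding red[symmetric] using that G0 GA A0 by (auto simp: abs_mult intro!: mult_right_mono)
  qed
  have i2: "integrable ?M (\<lambda>n. ?b q n)" if q: "q \<in> Z" for q
  proof (rule integrable_count_bound[OF iV])
    fix n
    have "norm (?b q n) = \<bar>G q n - s q n\<bar> * \<bar>A n - G q n\<bar> ^ (r - 1)"
      by (simp add: abs_mult power_abs)
    also have "\<dots> \<le> (A n + S n) * (A n + S n) ^ (r - 1)"
    proof (intro mult_mono power_mono)
      show "\<bar>G q n - s q n\<bar> \<le> A n + S n" "\<bar>A n - G q n\<bar> \<le> A n + S n"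
        using G0[OF q, of n] s0[OF q, of n] GA[OF q, of n] sS[OF q, of n] A0[of n] S0[of n] by linarith+
    qed (use A0 S0 in \<open>auto simp: add_nonneg_nonneg\<close>)
    also have "\<dots> \<le> 2 ^ r * (A n ^ r + S n ^ r)" unfolding red by (intro power_add_le_2 A0 S0)
    finally show "norm (?b q n) \<le> 2 ^ r * (A n ^ r + S n ^ r)" .
  qed
  let ?D = "\<lambda>q n. G q n * A n ^ (r - 1) - ?b q n"
  have ptw: "(\<Sum>q\<in>Z. ?D q n) \<le> A n ^ r / 2 + C * 2 ^ r * (S n ^ r + X n)" for n
  proof -
    have "?D q n \<le> real (r - 1) * A n ^ (r - 1 - 1) * (G q n * M n) + s q n * A n ^ (r - 1)" if q: "q \<in> Z" for q
    proof -
      have "?D q n = G q n * (A n ^ (r - 1) - (A n - G q n) ^ (r - 1)) + s q n * (A n - G q n) ^ (r - 1)"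
        by (simp only: left_diff_distrib right_diff_distrib)
      also have "\<dots> \<le> G q n * (real (r - 1) * A n ^ (r - 1 - 1) * G q n) + s q n * A n ^ (r - 1)"
      proof (intro add_mono mult_left_mono G0 s0 q power_mono)
        have "norm (A n ^ (r - 1) - (A n - G q n) ^ (r - 1)) \<le> real (r - 1) * A n ^ (r - 1 - 1) * norm (A n - (A n - G q n))"
          using G0[OF q, of n] GA[OF q, of n] by (intro norm_power_diff_le) auto
        then show "A n ^ (r - 1) - (A n - G q n) ^ (r - 1) \<le> real (r - 1) * A n ^ (r - 1 - 1) * G q n"
          using G0[OF q, of n] by simp
      qed (use G0[OF q] GA[OF q] in auto)
      also have "G q n * (real (r - 1) * A n ^ (r - 1 - 1) * G q n) = real (r - 1) * A n ^ (r - 1 - 1) * (G q n * G q n)"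
        by (simp only: mult_ac)
      also have "\<dots> \<le> real (r - 1) * A n ^ (r - 1 - 1) * (G q n * M n)"
        using q A0 by (intro mult_left_mono GM G0) auto
      finally show ?thesis by simp
    qed
    then have "(\<Sum>q\<in>Z. ?D q n) \<le> (\<Sum>q\<in>Z. real (r - 1) * A n ^ (r - 1 - 1) * (G q n * M n) + s q n * A n ^ (r - 1))"
      by (rule sum_mono)
    also have "\<dots> = real (r - 1) * A n ^ (r - 1 - 1) * (A n * M n) + S n * A n ^ (r - 1)"
      unfolding sum.distrib sum_distrib_left[symmetric] sum_distrib_right[symmetric]
      by (simp only: A_def S_def)
    also have "real (r - 1) * A n ^ (r - 1 - 1) * (A n * M n) = real (r - 1) * (M n * A n ^ (r - 1))"
    proof (cases "r = 1")
      case False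
      define k where "k = r - 2"
      have "r = Suc (Suc k)" using False r by (simp add: k_def)
      then show ?thesis by simp
    qed simp
    \<comment> \<open>Both coefficients are raised to \<open>r\<close>, so that the two terms merge
      and the absorption hypothesis applies with \<open>y = S n + M n\<close>.\<close>
    also have "\<dots> + S n * A n ^ (r - 1) \<le> real r * (M n * A n ^ (r - 1)) + real r * (S n * A n ^ (r - 1))"
    proof (rule add_mono)
      show "real (r - 1) * (M n * A n ^ (r - 1)) \<le> real r * (M n * A n ^ (r - 1))"
        using M0 A0 by (intro mult_right_mono) auto
      show "S n * A n ^ (r - 1) \<le> real r * (S n * A n ^ (r - 1))"
        using mult_right_mono[of 1 "real r" "S n * A n ^ (r - 1)"] r S0[of n] A0[of n] by simp
    qed
    also have "\<dots> = real r * (S n + M n) * A n ^ (r - 1)" by (simp add: algebra_simps)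
    also have "\<dots> \<le> real r * (S n + M n) * (A n + (S n + M n)) ^ (r - 1)"
      using A0[of n] S0[of n] M0[of n] by (intro mult_left_mono power_mono) auto
    also have "\<dots> \<le> A n ^ r / 2 + C * (S n + M n) ^ r"
      using A0[of n] S0[of n] M0[of n] by (intro C) auto
    also have "\<dots> \<le> A n ^ r / 2 + C * (2 ^ r * (S n ^ r + M n ^ r))"
      by (intro add_left_mono mult_left_mono C0 power_add_le_2 S0 M0)
    finally show ?thesis by (simp only: Mr mult.assoc)
  qed
  have Aexp: "A n ^ r = (\<Sum>q\<in>Z. G q n * A n ^ (r - 1))" for n
    by (simp add: A_def sum_distrib_right flip: red)
  have "(LINT n|?M. A n ^ r) = (\<Sum>q\<in>Z. LINT n|?M. G q n * A n ^ (r - 1))"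
    unfolding Aexp by (rule Bochner_Integration.integral_sum) (rule i1)
  also have "\<dots> = (\<Sum>q\<in>Z. LINT n|?M. ?D q n)"
  proof (rule sum.cong)
    fix q assume q: "q \<in> Z"
    show "(LINT n|?M. G q n * A n ^ (r - 1)) = (LINT n|?M. ?D q n)"
      unfolding Bochner_Integration.integral_diff[OF i1[OF q] i2[OF q]] van[OF q] by (rule diff_zero[symmetric])
  qed (rule refl)
  also have "\<dots> = (LINT n|?M. (\<Sum>q\<in>Z. ?D q n))"
    by (rule Bochner_Integration.integral_sum[symmetric]) (intro Bochner_Integration.integrable_diff i1 i2)
  also have "\<dots> \<le> (LINT n|?M. A n ^ r / 2 + C * 2 ^ r * (S n ^ r + X n))"
  proof (rule integral_mono)
    show "integrable ?M (\<lambda>n. \<Sum>q\<in>Z. ?D q n)"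
      by (intro Bochner_Integration.integrable_sum Bochner_Integration.integrable_diff i1 i2)
  qed (use iA iS iX ptw in auto)
  also have "\<dots> = (LINT n|?M. A n ^ r) / 2 + C * 2 ^ r * ((LINT n|?M. S n ^ r) + (LINT n|?M. X n))"
    using iA iS iX by simp
  finally show ?thesis by (simp add: X_def)
qed


section \<open>Spectra of bounded sequences\<close>

abbreviation e_char :: "int \<Rightarrow> real \<Rightarrow> complex" where
  "e_char n \<xi> \<equiv> cis (2 * pi * of_int n * \<xi>)"

text \<open>Spectral support in dual form: \<open>\<Sum>n. w n * g n\<close> is controlled by the supremum over \<open>E\<close> of the
  trigonometric polynomial with coefficients \<open>w\<close>.  Products need no convolution in this form.\<close>

definition spectrum_bound :: "real set \<Rightarrow> (int \<Rightarrow> complex) \<Rightarrow> real \<Rightarrow> bool" where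
  "spectrum_bound E g B \<longleftrightarrow> (\<forall>A w M. finite A \<longrightarrow> 0 \<le> M \<longrightarrow>
     (\<forall>\<xi>\<in>E. norm (\<Sum>n\<in>A. w n * e_char n \<xi>) \<le> M) \<longrightarrow>
     norm (\<Sum>n\<in>A. w n * g n) \<le> B * M)"

definition spectrum_in :: "real set \<Rightarrow> (int \<Rightarrow> complex) \<Rightarrow> bool" where
  "spectrum_in E g \<longleftrightarrow> (\<exists>B\<ge>0. spectrum_bound E g B)"

lemma spectrum_boundD:
  assumes "spectrum_bound E g B" "finite A" "0 \<le> M"
    and "\<And>\<xi>. \<xi> \<in> E \<Longrightarrow> norm (\<Sum>n\<in>A. w n * e_char n \<xi>) \<le> M"
  shows "norm (\<Sum>n\<in>A. w n * g n) \<le> B * M"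
  using assms unfolding spectrum_bound_def by simp

lemma spectrum_inI:
  assumes "0 \<le> B" and "\<And>A w M. finite A \<Longrightarrow> 0 \<le> M \<Longrightarrow>
     (\<And>\<xi>. \<xi> \<in> E \<Longrightarrow> norm (\<Sum>n\<in>A. w n * e_char n \<xi>) \<le> M) \<Longrightarrow>
     norm (\<Sum>n\<in>A. w n * g n) \<le> B * M"
  shows "spectrum_in E g"
  unfolding spectrum_in_def spectrum_bound_def
  using assms(1) by (intro exI[of _ B] conjI allI impI assms(2)) auto

lemma spectrum_in_mono:
  assumes "spectrum_in E g" "E \<subseteq> E'"
  shows "spectrum_in E' g"
proof -
  obtain B where B: "0 \<le> B" "spectrum_bound E g B"
    using assms(1) unfolding spectrum_in_def by auto
  show ?thesis
    by (rule spectrum_inI[OF B(1)], rule spectrum_boundD[OF B(2)]) (use assms(2) in auto)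
qed

text \<open>Multiplying the coefficients \<open>w\<close> by \<open>e_char n y\<close> translates
  the trigonometric polynomial by \<open>y\<close>. For each fixed \<open>y\<close> the bound for
  \<open>g\<close> applies, and its outcome is the hypothesis of the bound for \<open>h\<close>; the
  constants multiply.\<close>

lemma spectrum_in_mult:
  assumes g: "spectrum_in E g" and h: "spectrum_in E' h"
    and sub: "\<And>x y. x \<in> E \<Longrightarrow> y \<in> E' \<Longrightarrow> x + y \<in> E''"
  shows "spectrum_in E'' (\<lambda>n. g n * h n)"
proof -
  obtain B where B: "0 \<le> B" "spectrum_bound E g B"
    using g unfolding spectrum_in_def by auto
  obtain B' where B': "0 \<le> B'" "spectrum_bound E' h B'"
    using h unfolding spectrum_in_def by auto
  show ?thesis
  proof (rule spectrum_inI[of "B' * B"])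
    fix A :: "int set" and w and M :: real
    assume A: "finite A" "0 \<le> M"
      and w: "\<And>\<xi>. \<xi> \<in> E'' \<Longrightarrow> norm (\<Sum>n\<in>A. w n * e_char n \<xi>) \<le> M"
    have "norm (\<Sum>n\<in>A. (w n * g n) * h n) \<le> B' * (B * M)"
    proof (rule spectrum_boundD[OF B'(2)])
      fix y assume y: "y \<in> E'"
      have "norm (\<Sum>n\<in>A. (w n * e_char n y) * g n) \<le> B * M"
      proof (rule spectrum_boundD[OF B(2) A])
        fix x assume x: "x \<in> E"
        have "(\<Sum>n\<in>A. (w n * e_char n y) * e_char n x)
            = (\<Sum>n\<in>A. w n * e_char n (x + y))"
          by (simp add: mult.assoc cis_mult distrib_left add.commute)
        then show "norm (\<Sum>n\<in>A. (w n * e_char n y) * e_char n x) \<le> M"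
          using w[OF sub[OF x y]] by simp
      qed
      then show "norm (\<Sum>n\<in>A. (w n * g n) * e_char n y) \<le> B * M"
        by (simp only: mult_ac)
    qed (use A B in auto)
    then show "norm (\<Sum>n\<in>A. w n * (g n * h n)) \<le> B' * B * M" by (simp only: mult.assoc)
  qed (use B B' in simp)
qed

text \<open>Conjugating the whole sum moves the conjugation onto the coefficients and turns the
  character at \<open>x\<close> into the one at \<open>- x\<close>.\<close>

lemma spectrum_in_cnj:
  assumes g: "spectrum_in E g" and sub: "\<And>x. x \<in> E \<Longrightarrow> - x \<in> E'"
  shows "spectrum_in E' (\<lambda>n. cnj (g n))"
proof -
  obtain B where B: "0 \<le> B" "spectrum_bound E g B"
    using g unfolding spectrum_in_def by auto
  have nc: "norm (\<Sum>n\<in>A. w n * cnj (v n)) = norm (\<Sum>n\<in>A. cnj (w n) * v n)" for A :: "int set" and w v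
  proof -
    have "(\<Sum>n\<in>A. w n * cnj (v n)) = cnj (\<Sum>n\<in>A. cnj (w n) * v n)" by simp
    then show ?thesis by (simp only: complex_mod_cnj)
  qed
  show ?thesis
  proof (rule spectrum_inI[OF B(1)], unfold nc, rule spectrum_boundD[OF B(2)])
    fix A :: "int set" and w and M x :: real
    assume w: "\<And>\<xi>. \<xi> \<in> E' \<Longrightarrow> norm (\<Sum>n\<in>A. w n * e_char n \<xi>) \<le> M" and x: "x \<in> E"
    show "norm (\<Sum>n\<in>A. cnj (w n) * e_char n x) \<le> M"
      using w[OF sub[OF x]] nc[of w "\<lambda>n. e_char n x" A] by (simp add: cis_cnj)
  qed
qed

lemma spectrum_in_0: "spectrum_in E (\<lambda>n. 0)"
  by (rule spectrum_inI[of 0]) auto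

lemma spectrum_in_add:
  assumes g: "spectrum_in E g" and h: "spectrum_in E h"
  shows "spectrum_in E (\<lambda>n. g n + h n)"
proof -
  obtain B where B: "0 \<le> B" "spectrum_bound E g B"
    using g unfolding spectrum_in_def by auto
  obtain B' where B': "0 \<le> B'" "spectrum_bound E h B'"
    using h unfolding spectrum_in_def by auto
  show ?thesis
  proof (rule spectrum_inI[of "B + B'"])
    fix A :: "int set" and w and M :: real
    assume A: "finite A" "0 \<le> M"
      and w: "\<And>\<xi>. \<xi> \<in> E \<Longrightarrow> norm (\<Sum>n\<in>A. w n * e_char n \<xi>) \<le> M"
    show "norm (\<Sum>n\<in>A. w n * (g n + h n)) \<le> (B + B') * M"
      unfolding distrib_left distrib_right sum.distrib
      by (rule norm_triangle_mono) (auto intro: spectrum_boundD[OF B(2)] spectrum_boundD[OF B'(2)] A w)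
  qed (use B B' in simp)
qed

lemma spectrum_in_sum:
  assumes "\<And>i. i \<in> I \<Longrightarrow> spectrum_in E (g i)"
  shows "spectrum_in E (\<lambda>n. \<Sum>i\<in>I. g i n)"
  using assms
proof (induction I rule: infinite_finite_induct)
  case (insert i I)
  then show ?case using spectrum_in_add[of E "g i"] by simp
qed (auto simp: spectrum_in_0)

lemma spectrum_in_1: "0 \<in> E \<Longrightarrow> spectrum_in E (\<lambda>n. 1)"
  by (rule spectrum_inI[of 1]) (auto dest: meta_spec[of _ 0])

text \<open>The geometric sum is at most 2 / |z - 1|, and |z - 1| = 2 |sin (pi t)| for the offset
  \<open>t\<close> from the nearest integer. That integer forces
  \<open>\<delta> \<le> 1 / 2\<close>, which gives the positivity and the monotonicity of the
  sine.\<close>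

lemma norm_sum_cis_le:
  assumes "0 < \<delta>" "\<And>k::int. \<delta> \<le> \<bar>\<xi> - of_int k\<bar>"
  shows "norm (\<Sum>k<N. cis (2 * pi * real k * \<xi>)) \<le> 1 / sin (pi * \<delta>)" and "0 < sin (pi * \<delta>)"
proof -
  define j where "j = round \<xi>"
  define t where "t = \<xi> - of_int j"
  have t: "\<delta> \<le> \<bar>t\<bar>" "\<bar>t\<bar> \<le> 1 / 2"
    using assms(2)[of j] of_int_round_abs_le[of \<xi>] by (auto simp: t_def j_def abs_minus_commute)
  then have d: "\<delta> \<le> 1 / 2" by simp
  show s: "0 < sin (pi * \<delta>)" using assms(1) d by (intro sin_gt_zero) (auto simp: pi_gt_zero)
  have "sin (pi * \<delta>) \<le> sin (pi * \<bar>t\<bar>)"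
  proof (rule sin_monotone_2pi_le)
    have "0 \<le> pi * \<delta>" using assms(1) by simp
    then show "- (pi / 2) \<le> pi * \<delta>" using pi_gt_zero by linarith
    show "pi * \<delta> \<le> pi * \<bar>t\<bar>" using t by (intro mult_left_mono) auto
    show "pi * \<bar>t\<bar> \<le> pi / 2" using mult_left_mono[OF t(2), of pi] by simp
  qed
  also have "\<dots> \<le> \<bar>sin (pi * t)\<bar>" by (cases "t \<ge> 0") auto
  finally have st: "sin (pi * \<delta>) \<le> \<bar>sin (pi * t)\<bar>" .
  define z where "z = cis (2 * pi * \<xi>)"
  have zt: "z = cis (2 * pi * t)"
  proof -
    have "2 * pi * \<xi> = 2 * pi * t + 2 * pi * of_int j" by (simp add: t_def algebra_simps)
    then have "z = cis (2 * pi * t) * cis (2 * pi * of_int j)" by (simp only: z_def cis_mult)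
    moreover have "cis (2 * pi * of_int j) = 1" by (rule cis_multiple_2pi) simp
    ultimately show ?thesis by simp
  qed
  have "(norm (z - 1))\<^sup>2 = (2 * sin (pi * t))\<^sup>2"
  proof -
    have "(norm (z - 1))\<^sup>2 = (cos (2 * (pi * t)) - 1)\<^sup>2 + (sin (2 * (pi * t)))\<^sup>2"
      by (simp add: zt cmod_power2 mult.assoc)
    also have "\<dots> = 4 * (sin (pi * t))\<^sup>2 * ((sin (pi * t))\<^sup>2 + (cos (pi * t))\<^sup>2)"
      unfolding cos_double_sin sin_double by algebra
    finally show ?thesis by (simp add: power_mult_distrib)
  qed
  then have nz: "norm (z - 1) = 2 * \<bar>sin (pi * t)\<bar>"
    using arg_cong[of _ _ sqrt] by (metis real_sqrt_abs abs_mult abs_numeral abs_norm_cancel)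
  have "(z - 1) * (\<Sum>k<N. z ^ k) = z ^ N - 1"
    by (simp add: power_diff_1_eq)
  then have "norm (z - 1) * norm (\<Sum>k<N. z ^ k) = norm (z ^ N - 1)"
    by (simp flip: norm_mult)
  also have "\<dots> \<le> 2" using norm_triangle_ineq4[of "z ^ N" 1] by (simp add: norm_power z_def)
  finally have "\<bar>sin (pi * t)\<bar> * norm (\<Sum>k<N. z ^ k) \<le> 1" by (simp add: nz)
  then have "sin (pi * \<delta>) * norm (\<Sum>k<N. z ^ k) \<le> 1"
    using mult_right_mono[OF st norm_ge_zero[of "\<Sum>k<N. z ^ k"]] by linarith
  moreover have "(\<Sum>k<N. z ^ k) = (\<Sum>k<N. cis (2 * pi * real k * \<xi>))"
    by (intro sum.cong refl) (simp add: z_def Complex.DeMoivre mult_ac)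
  ultimately show "norm (\<Sum>k<N. cis (2 * pi * real k * \<xi>)) \<le> 1 / sin (pi * \<delta>)"
    using s by (simp add: field_simps)
qed

text \<open>Equals max 0 (N - |n|), the unnormalised Fejer weight. As a count of pairs, its
  exponential sum is at once the squared modulus of a Dirichlet sum; of its value, bounds from both
  sides and the support suffice.\<close>

definition fejer_count :: "nat \<Rightarrow> int \<Rightarrow> nat" where
  "fejer_count N n = card {p \<in> {..<N} \<times> {..<N}. int (fst p) - int (snd p) = n}"

lemma sum_fejer_count:
  fixes h :: "int \<Rightarrow> complex"
  shows "(\<Sum>j<N. \<Sum>k<N. h (int j - int k)) = (\<Sum>n\<in>{- int N..int N}. of_nat (fejer_count N n) * h n)"
proof -
  have "(\<Sum>j<N. \<Sum>k<N. h (int j - int k)) = (\<Sum>p\<in>{..<N} \<times> {..<N}. h (int (fst p) - int (snd p)))"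
    by (simp add: sum.cartesian_product case_prod_beta)
  also have "\<dots> = (\<Sum>n\<in>{- int N..int N}. \<Sum>p\<in>{p \<in> {..<N} \<times> {..<N}. int (fst p) - int (snd p) = n}. h (int (fst p) - int (snd p)))"
    by (rule sum.group[symmetric]) auto
  also have "\<dots> = (\<Sum>n\<in>{- int N..int N}. of_nat (fejer_count N n) * h n)"
    by (intro sum.cong refl) (simp add: fejer_count_def)
  finally show ?thesis .
qed

lemma fejer_count_le: "fejer_count N n \<le> N"
proof -
  have "fejer_count N n \<le> card {..<N}"
    unfolding fejer_count_def by (rule card_inj_on_le[of fst]) (auto simp: inj_on_def)
  then show ?thesis by simp
qed

lemma fejer_count_ge: "real N - \<bar>real_of_int n\<bar> \<le> real (fejer_count N n)"
proof -
  define f where "f k = (if n \<ge> 0 then (k + nat n, k) else (k, k + nat (- n)))" for k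
  have "card {..<N - nat \<bar>n\<bar>} \<le> fejer_count N n"
    unfolding fejer_count_def by (rule card_inj_on_le[of f]) (auto simp: inj_on_def f_def split: if_splits)
  then show ?thesis by simp
qed

lemma fejer_count_eq_0: "n \<notin> {- int N..int N} \<Longrightarrow> fejer_count N n = 0"
  by (auto simp: fejer_count_def card_eq_0_iff)

text \<open>The Fejer means of \<open>g\<close> tend to its sum, while the Fejer kernel tends to \<open>0\<close> uniformly away from
  the integers.\<close>

lemma sum_eq_0_if_spectrum_away_from_int:
  assumes sp: "spectrum_in E g" and i: "integrable (count_space UNIV) g"
    and \<delta>: "0 < \<delta>" "\<And>\<xi> k. \<xi> \<in> E \<Longrightarrow> \<delta> \<le> \<bar>\<xi> - of_int k\<bar>"
  shows "(LINT n|count_space UNIV. g n) = 0"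
proof -
  let ?M = "count_space (UNIV :: int set)"
  define w where "w N n = real (fejer_count N n) / real N" for N n
  obtain B where B: "0 \<le> B" "spectrum_bound E g B"
    using sp unfolding spectrum_in_def by auto
  have lim: "(\<lambda>N. LINT n|?M. w N n *\<^sub>R g n) \<longlonglongrightarrow> (LINT n|?M. g n)"
  proof (rule integral_dominated_convergence[where w = "\<lambda>n. norm (g n)"])
    show "integrable ?M (\<lambda>n. norm (g n))" using i by simp
    show "AE n in ?M. (\<lambda>N. w N n *\<^sub>R g n) \<longlonglongrightarrow> g n"
    proof (intro AE_I2)
      fix n :: int
      have "(\<lambda>N. w N n) \<longlonglongrightarrow> 1"
      proof (rule tendsto_sandwich)
        show "\<forall>\<^sub>F N in sequentially. 1 - \<bar>real_of_int n\<bar> / real N \<le> w N n"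
          using eventually_gt_at_top[of 0]
        proof eventually_elim
          case (elim N)
          then have "1 - \<bar>real_of_int n\<bar> / real N = (real N - \<bar>real_of_int n\<bar>) / real N"
            by (simp add: diff_divide_distrib)
          then show ?case using fejer_count_ge[of N n] by (simp add: w_def divide_right_mono)
        qed
        show "\<forall>\<^sub>F N in sequentially. w N n \<le> 1"
          using fejer_count_le by (auto simp: w_def divide_le_eq_1 intro!: always_eventually)
        show "(\<lambda>N. 1 - \<bar>real_of_int n\<bar> / real N) \<longlonglongrightarrow> 1"
          using tendsto_diff[OF tendsto_const lim_const_over_n[of "\<bar>real_of_int n\<bar>"], of 1] by simp
      qed simp
      from tendsto_scaleR[OF this tendsto_const[of "g n"]]
      show "(\<lambda>N. w N n *\<^sub>R g n) \<longlonglongrightarrow> g n" by simp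
    qed
    show "AE n in ?M. norm (w N n *\<^sub>R g n) \<le> norm (g n)" for N
    proof (intro AE_I2)
      fix n :: int
      have "w N n \<le> 1" using fejer_count_le by (auto simp: w_def divide_le_eq_1)
      then show "norm (w N n *\<^sub>R g n) \<le> norm (g n)"
        using mult_right_mono[of "w N n" 1 "norm (g n)"] by (simp add: w_def)
    qed
  qed auto
  have bound: "norm (LINT n|?M. w N n *\<^sub>R g n) \<le> B * ((1 / sin (pi * \<delta>))\<^sup>2 / real N)" if "N > 0" for N
  proof -
    have "(LINT n|?M. w N n *\<^sub>R g n) = (\<Sum>n\<in>{- int N..int N}. w N n *\<^sub>R g n)"
    proof -
      have "(LINT n|?M. w N n *\<^sub>R g n) = (\<Sum>n | n \<in> UNIV \<and> w N n *\<^sub>R g n \<noteq> 0. w N n *\<^sub>R g n)"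
      proof (rule lebesgue_integral_count_space_finite_support)
        have "{n \<in> UNIV. w N n *\<^sub>R g n \<noteq> 0} \<subseteq> {- int N..int N}"
          using fejer_count_eq_0 by (force simp: w_def)
        then show "finite {n \<in> UNIV. w N n *\<^sub>R g n \<noteq> 0}" using finite_subset by blast
      qed
      also have "\<dots> = (\<Sum>n\<in>{- int N..int N}. w N n *\<^sub>R g n)"
        using fejer_count_eq_0 by (intro sum.mono_neutral_left) (force simp: w_def)+
      finally show ?thesis .
    qed
    also have "\<dots> = (\<Sum>n\<in>{- int N..int N}. (complex_of_real (w N n)) * g n)"
      by (simp add: scaleR_conv_of_real)
    also have "norm \<dots> \<le> B * ((1 / sin (pi * \<delta>))\<^sup>2 / real N)"
    proof (rule spectrum_boundD[OF B(2)])
      fix \<xi> assume \<xi>: "\<xi> \<in> E"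
      let ?D = "\<Sum>k<N. cis (2 * pi * real k * \<xi>)"
      have "(\<Sum>n\<in>{- int N..int N}. (complex_of_real (w N n)) * e_char n \<xi>)
          = (\<Sum>n\<in>{- int N..int N}. of_nat (fejer_count N n) * e_char n \<xi>) / of_nat N"
        by (simp add: w_def sum_divide_distrib)
      also have "\<dots> = (\<Sum>j<N. \<Sum>k<N. e_char (int j - int k) \<xi>) / of_nat N"
        unfolding sum_fejer_count[of "\<lambda>n. e_char n \<xi>" N] ..
      also have "(\<Sum>j<N. \<Sum>k<N. e_char (int j - int k) \<xi>) = ?D * cnj ?D"
        by (simp add: sum_product cis_cnj cis_mult algebra_simps)
      finally have "norm (\<Sum>n\<in>{- int N..int N}. (complex_of_real (w N n)) * e_char n \<xi>)
          = (norm ?D)\<^sup>2 / real N"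
        by (simp only: norm_divide norm_mult complex_mod_cnj power2_eq_square norm_of_nat)
      also have "\<dots> \<le> (1 / sin (pi * \<delta>))\<^sup>2 / real N"
        using norm_sum_cis_le(1)[OF \<delta>(1) \<delta>(2)[OF \<xi>]] by (intro divide_right_mono power_mono) auto
      finally show "norm (\<Sum>n\<in>{- int N..int N}. (complex_of_real (w N n)) * e_char n \<xi>)
          \<le> (1 / sin (pi * \<delta>))\<^sup>2 / real N" .
    qed auto
    finally show ?thesis .
  qed
  have "(\<lambda>N. LINT n|?M. w N n *\<^sub>R g n) \<longlonglongrightarrow> 0"
  proof (rule Lim_null_comparison)
    show "\<forall>\<^sub>F N in sequentially. norm (LINT n|?M. w N n *\<^sub>R g n) \<le> B * ((1 / sin (pi * \<delta>))\<^sup>2 / real N)"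
      using eventually_gt_at_top[of 0] by eventually_elim (rule bound)
    show "(\<lambda>N. B * ((1 / sin (pi * \<delta>))\<^sup>2 / real N)) \<longlonglongrightarrow> 0"
      using tendsto_mult[OF tendsto_const lim_const_over_n[of "(1 / sin (pi * \<delta>))\<^sup>2"], of B] by simp
  qed
  with lim show ?thesis using LIMSEQ_unique by blast
qed


section \<open>A band-limited kernel\<close>

lemma integrable_inverse_1_plus_square_lborel: "integrable lborel (\<lambda>x::real. 1 / (1 + x\<^sup>2))"
  using integrable_inverse_1_plus_square by (simp add: set_integrable_def inverse_eq_divide)

lemma fourier_R_lborel:
  assumes [measurable]: "f \<in> borel_measurable borel"
  shows "fourier_R f \<xi> = (LINT x|lborel. f x * cis (- 2 * pi * x * \<xi>))"
  unfolding fourier_R_def by (subst integral_completion) (auto simp: cis_conv_exp)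

text \<open>The characteristic function of the standard normal law, with the normalisation
  \<open>1 / sqrt (2 * pi)\<close> removed.\<close>

lemma gaussian_fourier:
  "(LINT x|lborel. complex_of_real (exp (- x\<^sup>2 / 2)) * cis (t * x))
     = complex_of_real (sqrt (2 * pi) * exp (- t\<^sup>2 / 2))"
proof -
  have "char std_normal_distribution t = (LINT x|lborel. std_normal_density x *\<^sub>R cis (t * x))"
    unfolding char_def by (subst integral_density) (auto simp: cis_conv_exp)
  also have "\<dots> = (LINT x|lborel. complex_of_real (1 / sqrt (2 * pi)) * (complex_of_real (exp (- x\<^sup>2 / 2)) * cis (t * x)))"
    by (simp add: std_normal_density_def scaleR_conv_of_real mult.assoc)
  finally have "complex_of_real (exp (- t\<^sup>2 / 2))
      = complex_of_real (1 / sqrt (2 * pi)) * (LINT x|lborel. complex_of_real (exp (- x\<^sup>2 / 2)) * cis (t * x))"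
    by (simp add: char_std_normal_distribution)
  then show ?thesis by (simp add: field_simps)
qed

lemma integrable_gaussian: "integrable lborel (\<lambda>x::real. exp (- x\<^sup>2 / 2))"
proof -
  have "integrable lborel (\<lambda>x. sqrt (2 * pi) * std_normal_density x)" by simp
  then show ?thesis by (simp add: std_normal_density_def)
qed

lemma scaled_gaussian_fourier:
  assumes "\<delta> > 0"
  shows "(LINT x|lborel. complex_of_real (exp (- (\<delta> * x)\<^sup>2 / 2)) * cis (t * x))
     = complex_of_real (sqrt (2 * pi) / \<delta> * exp (- (t / \<delta>)\<^sup>2 / 2))"
proof -
  have "(LINT x|lborel. complex_of_real (exp (- x\<^sup>2 / 2)) * cis ((t / \<delta>) * x))
      = \<delta> *\<^sub>R (LINT x|lborel. complex_of_real (exp (- (\<delta> * x)\<^sup>2 / 2)) * cis (t * x))"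
    using assms by (subst lborel_integral_real_affine[where c = \<delta> and t = 0]) auto
  then show ?thesis unfolding gaussian_fourier using assms
    by (simp add: scaleR_conv_of_real field_simps)
qed

text \<open>The Gaussian means of the inverse Fourier integral are averages of \<open>\<tau>\<close> over
  shrinking normal distributions.\<close>

lemma fourier_inversion:
  fixes \<tau> :: "real \<Rightarrow> complex"
  defines "\<phi> \<equiv> \<lambda>x. LINT \<eta>|lborel. \<tau> \<eta> * cis (- 2 * pi * \<eta> * x)"
  assumes cont: "continuous_on UNIV \<tau>" and bdd: "\<And>\<eta>. norm (\<tau> \<eta>) \<le> K"
    and i\<tau>: "integrable lborel \<tau>" and i\<phi>: "integrable lborel \<phi>"
  shows "(LINT x|lborel. \<phi> x * cis (2 * pi * x * \<xi>)) = \<tau> \<xi>"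
proof -
  define \<delta> where "\<delta> k = inverse (real (Suc k))" for k
  have \<delta>0: "\<delta> k > 0" for k by (simp add: \<delta>_def)
  have \<delta>lim: "\<delta> \<longlonglongrightarrow> 0" unfolding \<delta>_def[abs_def] by (rule LIMSEQ_inverse_real_of_nat)
  let ?t = "\<lambda>k u. \<tau> (\<xi> + \<delta> k / (2 * pi) * u)"
  let ?e = "\<lambda>x. \<phi> x * cis (2 * pi * x * \<xi>)"
  let ?G = "\<lambda>k x. complex_of_real (exp (- (\<delta> k * x)\<^sup>2 / 2))"
  have [measurable]: "\<tau> \<in> borel_measurable borel" using cont by (rule borel_measurable_continuous_onI)
  have [measurable]: "cis \<in> borel_measurable borel"
    by (intro borel_measurable_continuous_onI continuous_intros)
  have [measurable]: "\<phi> \<in> borel_measurable borel" using i\<phi> by simp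
  define J where "J k = (LINT x|lborel. ?G k x * ?e x)" for k
  have L1: "J \<longlonglongrightarrow> (LINT x|lborel. ?e x)"
    unfolding J_def
  proof (rule integral_dominated_convergence[where w = "\<lambda>x. norm (\<phi> x)"])
    show "AE x in lborel. (\<lambda>k. ?G k x * ?e x)
        \<longlonglongrightarrow> ?e x"
    proof (intro AE_I2)
      fix x
      have "(\<lambda>k. ?G k x) \<longlonglongrightarrow> complex_of_real (exp (- (0 * x)\<^sup>2 / 2))"
        by (intro tendsto_intros \<delta>lim) auto
      from tendsto_mult[OF this tendsto_const[of "?e x"]]
      show "(\<lambda>k. ?G k x * ?e x)
        \<longlonglongrightarrow> ?e x" by simp
    qed
    show "AE x in lborel. norm (?G k x * ?e x) \<le> norm (\<phi> x)" for k
      by (auto simp: norm_mult intro!: AE_I2 mult_left_le_one_le)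
  qed (use i\<phi> in auto)
  have L2: "J k = (LINT u|lborel. std_normal_density u *\<^sub>R ?t k u)" for k
  proof -
    let ?F = "\<lambda>x \<eta>. (?G k x * cis (2 * pi * x * \<xi>)) * (\<tau> \<eta> * cis (- 2 * pi * \<eta> * x))"
    have iG: "integrable lborel (\<lambda>x. exp (- (\<delta> k * x)\<^sup>2 / 2))"
      using lborel_integrable_real_affine[OF integrable_gaussian, of "\<delta> k" 0] \<delta>0[of k] by simp
    \<comment> \<open>The Gaussian makes the double integrand absolutely integrable; without it the
      modulus would be constant in \<open>x\<close>.\<close>
    have iF: "integrable (lborel \<Otimes>\<^sub>M lborel) (case_prod ?F)"
    proof (rule lborel_pair.Fubini_integrable)
      show "integrable lborel (\<lambda>x. LINT \<eta>|lborel. norm (case_prod ?F (x, \<eta>)))"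
        using iG by (simp add: norm_mult)
      show "AE x in lborel. integrable lborel (\<lambda>\<eta>. case_prod ?F (x, \<eta>))"
      proof (intro AE_I2)
        fix x
        have "integrable lborel (\<lambda>\<eta>. \<tau> \<eta> * cis (- 2 * pi * \<eta> * x))"
          by (rule Bochner_Integration.integrable_bound[OF i\<tau>]) (auto simp: norm_mult)
        then show "integrable lborel (\<lambda>\<eta>. case_prod ?F (x, \<eta>))" by simp
      qed
    qed measurable
    have "J k = (LINT x|lborel. (LINT \<eta>|lborel. ?F x \<eta>))"
      unfolding J_def \<phi>_def integral_mult_right_zero by (simp only: mult_ac)
    also have "\<dots> = (LINT \<eta>|lborel. (LINT x|lborel. ?F x \<eta>))"
      by (rule lborel_pair.Fubini_integral[OF iF, symmetric])
    also have "\<dots> = (LINT \<eta>|lborel. \<tau> \<eta> * complex_of_real (sqrt (2 * pi) / \<delta> k * exp (- ((2 * pi * (\<xi> - \<eta>)) / \<delta> k)\<^sup>2 / 2)))"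
    proof (rule Bochner_Integration.integral_cong)
      fix \<eta>
      have "(LINT x|lborel. ?F x \<eta>) = (LINT x|lborel. \<tau> \<eta> * (?G k x * cis (2 * pi * (\<xi> - \<eta>) * x)))"
      proof (rule Bochner_Integration.integral_cong)
        fix x
        have e: "cis (2 * pi * x * \<xi>) * cis (- 2 * pi * \<eta> * x) = cis (2 * pi * (\<xi> - \<eta>) * x)"
          by (simp add: cis_mult algebra_simps)
        show "?F x \<eta> = \<tau> \<eta> * (?G k x * cis (2 * pi * (\<xi> - \<eta>) * x))"
          unfolding e[symmetric] by (simp only: mult_ac)
      qed simp
      also have "\<dots> = \<tau> \<eta> * (LINT x|lborel. ?G k x * cis (2 * pi * (\<xi> - \<eta>) * x))"
        by (rule integral_mult_right_zero)
      finally show "(LINT x|lborel. ?F x \<eta>) = \<tau> \<eta> * complex_of_real (sqrt (2 * pi) / \<delta> k * exp (- ((2 * pi * (\<xi> - \<eta>)) / \<delta> k)\<^sup>2 / 2))"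
        unfolding scaled_gaussian_fourier[OF \<delta>0] .
    qed simp
    \<comment> \<open>The substitution \<eta> = \<xi> + \<delta> u / (2 pi) turns the Gaussian
      concentrated at \<xi> into the standard normal density in \<open>u\<close>, and moves the
      shrinking width into the argument of \<open>\<tau>\<close>.\<close>
    also have "\<dots> = (\<delta> k / (2 * pi)) *\<^sub>R (LINT u|lborel. ?t k u *
        complex_of_real (sqrt (2 * pi) / \<delta> k * exp (- ((2 * pi * (\<xi> - (\<xi> + \<delta> k / (2 * pi) * u))) / \<delta> k)\<^sup>2 / 2)))"
      using \<delta>0[of k] by (subst lborel_integral_real_affine[where c = "\<delta> k / (2 * pi)" and t = \<xi>]) auto
    also have "\<dots> = (LINT u|lborel. (\<delta> k / (2 * pi)) *\<^sub>R (?t k u *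
        complex_of_real (sqrt (2 * pi) / \<delta> k * exp (- ((2 * pi * (\<xi> - (\<xi> + \<delta> k / (2 * pi) * u))) / \<delta> k)\<^sup>2 / 2))))"
      by simp
    also have "\<dots> = (LINT u|lborel. std_normal_density u *\<^sub>R ?t k u)"
    proof (rule Bochner_Integration.integral_cong)
      fix u
      have a: "2 * pi * (\<xi> - (\<xi> + \<delta> k / (2 * pi) * u)) / \<delta> k = - u"
        using \<delta>0[of k] by (simp add: field_simps)
      have "sqrt (2 * pi) * sqrt (2 * pi) = 2 * pi" by simp
      then have b: "\<delta> k / (2 * pi) * (sqrt (2 * pi) / \<delta> k) = 1 / sqrt (2 * pi)"
        using \<delta>0[of k] by (simp add: field_simps)
      show "(\<delta> k / (2 * pi)) *\<^sub>R (?t k u *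
          complex_of_real (sqrt (2 * pi) / \<delta> k * exp (- ((2 * pi * (\<xi> - (\<xi> + \<delta> k / (2 * pi) * u))) / \<delta> k)\<^sup>2 / 2)))
        = std_normal_density u *\<^sub>R ?t k u"
        unfolding a std_normal_density_def b[symmetric] scaleR_conv_of_real of_real_mult power2_minus
        by (simp only: mult_ac)
    qed simp
    finally show ?thesis .
  qed
  have L3: "(\<lambda>k. LINT u|lborel. std_normal_density u *\<^sub>R ?t k u)
      \<longlonglongrightarrow> (LINT u|lborel. std_normal_density u *\<^sub>R \<tau> \<xi>)"
  proof (rule integral_dominated_convergence[where w = "\<lambda>u. std_normal_density u * K"])
    show "AE u in lborel. (\<lambda>k. std_normal_density u *\<^sub>R ?t k u) \<longlonglongrightarrow> std_normal_density u *\<^sub>R \<tau> \<xi>"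
    proof (intro AE_I2 tendsto_scaleR tendsto_const)
      fix u
      have "(\<lambda>k. \<xi> + \<delta> k / (2 * pi) * u) \<longlonglongrightarrow> \<xi> + 0 / (2 * pi) * u"
        by (intro tendsto_intros \<delta>lim) auto
      then have "(\<lambda>k. \<xi> + \<delta> k / (2 * pi) * u) \<longlonglongrightarrow> \<xi>" by simp
      with cont show "(\<lambda>k. ?t k u) \<longlonglongrightarrow> \<tau> \<xi>"
        by (rule continuous_on_tendsto_compose) auto
    qed
    show "AE u in lborel. norm (std_normal_density u *\<^sub>R ?t k u) \<le> std_normal_density u * K" for k
      using bdd by (auto simp: std_normal_density_def intro!: AE_I2 divide_right_mono)
  qed auto
  have "(LINT u|lborel. std_normal_density u *\<^sub>R \<tau> \<xi>) = \<tau> \<xi>" by simp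
  with L3 have "J \<longlonglongrightarrow> \<tau> \<xi>" by (simp add: L2[abs_def])
  with L1 show ?thesis by (rule LIMSEQ_unique)
qed


section \<open>The tent function and its Fourier transform\<close>

definition tent :: "real \<Rightarrow> real" where "tent \<xi> = max 0 (1 - \<bar>\<xi>\<bar>)"

text \<open>This is the function (sin (pi x) / (pi x))^2. The integral form suits changes of
  variables, and beyond that only its decay is used.\<close>

definition fejer_kernel :: "real \<Rightarrow> complex" where
  "fejer_kernel x = (LINT \<eta>|lborel. complex_of_real (tent \<eta>) * cis (- 2 * pi * \<eta> * x))"

lemma continuous_on_tent: "continuous_on A tent"
  unfolding tent_def[abs_def] by (intro continuous_intros)

lemma tent_le_indicator: "tent \<xi> \<le> indicator {-1..1} \<xi>"
  by (auto simp: tent_def indicator_def)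

lemma tent_nonneg: "0 \<le> tent \<xi>" and tent_le_1: "tent \<xi> \<le> 1"
  by (auto simp: tent_def)

lemma borel_measurable_tent [measurable]: "tent \<in> borel_measurable borel"
  by (rule borel_measurable_continuous_onI[OF continuous_on_tent])

lemma borel_measurable_cis [measurable]: "cis \<in> borel_measurable borel"
  by (intro borel_measurable_continuous_onI continuous_intros)

lemma integrable_tent: "integrable lborel tent"
proof (rule Bochner_Integration.integrable_bound)
  show "integrable lborel (indicator {-1..1} :: real \<Rightarrow> real)" by simp
  show "AE x in lborel. norm (tent x) \<le> norm (indicator {-1..1} x :: real)"
    using tent_le_indicator tent_nonneg by auto
qed simp

lemma integrable_tent_cis:
  "integrable lborel (\<lambda>\<eta>. complex_of_real (tent \<eta>) * cis (- 2 * pi * \<eta> * x))"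
  by (rule Bochner_Integration.integrable_bound[OF integrable_tent]) (auto simp: norm_mult)

lemma norm_fejer_kernel_le_2: "norm (fejer_kernel x) \<le> 2"
proof -
  have "norm (fejer_kernel x) \<le> (LINT \<eta>|lborel. norm (complex_of_real (tent \<eta>) * cis (- 2 * pi * \<eta> * x)))"
    unfolding fejer_kernel_def by (rule integral_norm_bound)
  also have "\<dots> \<le> (LINT \<eta>::real|lborel. indicator {-1..1} \<eta>)"
  proof (rule integral_mono)
    show "integrable lborel (\<lambda>\<eta>. norm (complex_of_real (tent \<eta>) * cis (- 2 * pi * \<eta> * x)))"
      using integrable_tent_cis by (rule integrable_norm)
    show "norm (complex_of_real (tent \<eta>) * cis (- 2 * pi * \<eta> * x)) \<le> indicator {-1..1} \<eta>" for \<eta>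
      using tent_le_indicator[of \<eta>] tent_nonneg[of \<eta>] by (simp add: norm_mult)
  qed simp
  finally show ?thesis by simp
qed

text \<open>Explicit integration on both halves gives
  \<open>(exp a + exp (- a) - 2) / a\<^sup>2\<close> with a = -2 pi i x: the boundary terms 1/a at
  the origin cancel, and the remaining numerator has modulus at most 4.\<close>

lemma norm_fejer_kernel_le:
  assumes "x \<noteq> 0"
  shows "norm (fejer_kernel x) \<le> 1 / x\<^sup>2"
proof -
  define a where "a = - (2 * pi * x) * \<i>"
  have a: "a \<noteq> 0" using assms by (simp add: a_def)
  let ?h = "\<lambda>\<eta>. complex_of_real (tent \<eta>) * cis (- 2 * pi * \<eta> * x)"
  have h: "?h \<eta> = complex_of_real (tent \<eta>) * exp (a * of_real \<eta>)" for \<eta>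
    by (simp add: cis_conv_exp a_def mult_ac)
  \<comment> \<open>Complex primitives of \<open>(1 - z) * exp (a * z)\<close> and, in the next
    line, of \<open>(1 + z) * exp (a * z)\<close>, found by parts.\<close>
  let ?G1 = "\<lambda>z. (1 - z) * exp (a * z) / a + exp (a * z) / a\<^sup>2"
  let ?G2 = "\<lambda>z. (1 + z) * exp (a * z) / a - exp (a * z) / a\<^sup>2"
  let ?I1 = "?G1 (of_real 1) - ?G1 (of_real 0)"
  let ?I2 = "?G2 (of_real 0) - ?G2 (of_real (-1))"
  have d1: "((\<lambda>\<eta>. ?G1 (of_real \<eta>)) has_vector_derivative ((1 - of_real \<eta>) * exp (a * of_real \<eta>))) (at \<eta> within S)" for \<eta> S
    by (rule has_vector_derivative_real_field)
      (auto intro!: derivative_eq_intros simp: a power2_eq_square field_simps)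
  have d2: "((\<lambda>\<eta>. ?G2 (of_real \<eta>)) has_vector_derivative ((1 + of_real \<eta>) * exp (a * of_real \<eta>))) (at \<eta> within S)" for \<eta> S
    by (rule has_vector_derivative_real_field)
      (auto intro!: derivative_eq_intros simp: a power2_eq_square field_simps)
  have i1: "(?h has_integral ?I1) {0..1}"
  proof (rule has_integral_eq)
    show "((\<lambda>\<eta>. (1 - of_real \<eta>) * exp (a * of_real \<eta>)) has_integral ?I1) {0..1}"
      by (rule fundamental_theorem_of_calculus[where f = "\<lambda>\<eta>. ?G1 (of_real \<eta>)"]) (use d1 in auto)
  qed (unfold h, auto simp: tent_def)
  have i2: "(?h has_integral ?I2) {-1..0}"
  proof (rule has_integral_eq)
    show "((\<lambda>\<eta>. (1 + of_real \<eta>) * exp (a * of_real \<eta>)) has_integral ?I2) {-1..0}"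
      by (rule fundamental_theorem_of_calculus[where f = "\<lambda>\<eta>. ?G2 (of_real \<eta>)"]) (use d2 in auto)
  qed (unfold h, auto simp: tent_def)
  have "(?h has_integral ?I2 + ?I1) {-1..1}"
    by (rule has_integral_combine[OF _ _ i2 i1]) auto
  then have "(?h has_integral ?I2 + ?I1) UNIV"
    by (rule has_integral_on_superset) (auto simp: tent_def)
  moreover have "(?h has_integral fejer_kernel x) UNIV"
    unfolding fejer_kernel_def by (rule has_integral_integral_lborel[OF integrable_tent_cis])
  ultimately have "fejer_kernel x = ?I2 + ?I1"
    by (rule has_integral_unique[symmetric])
  also have "\<dots> = (exp a + exp (- a) - 2) / a\<^sup>2"
    using a by (simp add: field_simps)
  also have "norm \<dots> = norm (exp a + exp (- a) - 2) / (2 * pi * x)\<^sup>2"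
    by (simp add: norm_divide norm_power norm_mult a_def power_mult_distrib)
  also have "\<dots> \<le> 4 / (2 * pi * x)\<^sup>2"
  proof (rule divide_right_mono)
    have "norm (exp a) = 1" "norm (exp (- a)) = 1" by (simp_all add: a_def)
    then show "norm (exp a + exp (- a) - 2) \<le> 4"
      using norm_triangle_ineq4[of "exp a + exp (- a)" 2] norm_triangle_ineq[of "exp a" "exp (- a)"] by simp
  qed simp
  also have "\<dots> = (1 / pi\<^sup>2) * (1 / x\<^sup>2)" using assms by (simp add: power_mult_distrib)
  also have "\<dots> \<le> 1 * (1 / x\<^sup>2)"
  proof (rule mult_right_mono)
    have "1 \<le> pi\<^sup>2" using pi_gt3 by (simp add: one_le_power)
    then show "1 / pi\<^sup>2 \<le> 1" by simp
  qed simp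
  finally show ?thesis by simp
qed

text \<open>Adds the uniform bound 2 and the bound 1 for x^2 times the kernel, which gives the
  3.\<close>

lemma norm_fejer_kernel_decay: "norm (fejer_kernel x) \<le> 3 / (1 + x\<^sup>2)"
proof -
  have "x\<^sup>2 * norm (fejer_kernel x) \<le> 1"
    using norm_fejer_kernel_le[of x] by (cases "x = 0") (auto simp: field_simps)
  then have "(1 + x\<^sup>2) * norm (fejer_kernel x) \<le> 3"
    using norm_fejer_kernel_le_2[of x] by (simp add: distrib_right)
  moreover have "0 < 1 + x\<^sup>2" by (simp add: add_pos_nonneg)
  ultimately show ?thesis by (simp add: field_simps)
qed

text \<open>A de la Vallee Poussin kernel: \<open>2 * tent (\<xi> / 2) - tent \<xi>\<close> is 1 on
  [-1, 1] and 0 outside [-2, 2]. The transforms of both tents decay like x^-2, so the kernel is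
  integrable and the inversion formula identifies its transform.\<close>

lemma band_limited_kernel:
  obtains \<phi> :: "real \<Rightarrow> complex" and C where
    "\<phi> \<in> borel_measurable borel" "\<And>x. norm (\<phi> x) \<le> C / (1 + x\<^sup>2)"
    "\<And>\<xi>. \<bar>\<xi>\<bar> \<le> 1 \<Longrightarrow> fourier_R \<phi> \<xi> = 1" "integrable lebesgue (fourier_R \<phi>)"
proof -
  define \<tau> where "\<tau> \<xi> = complex_of_real (2 * tent (\<xi> / 2) - tent \<xi>)" for \<xi>
  define \<phi> where "\<phi> x = (LINT \<eta>|lborel. \<tau> \<eta> * cis (- 2 * pi * \<eta> * x))" for x
  have tcont: "continuous_on UNIV \<tau>"
    unfolding \<tau>_def
    by (intro continuous_intros continuous_on_compose2[OF continuous_on_tent[of UNIV]] continuous_on_tent) auto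
  have [measurable]: "\<tau> \<in> borel_measurable borel"
    by (rule borel_measurable_continuous_onI[OF tcont])
  have i2: "integrable lborel (\<lambda>\<eta>. complex_of_real (tent (\<eta> / 2)) * cis (- 2 * pi * \<eta> * x))" for x
    using lborel_integrable_real_affine[OF integrable_tent_cis[of "2 * x"], of "1 / 2" 0]
    by (simp add: mult_ac)
  have "integrable lborel (\<lambda>\<eta>. tent (\<eta> / 2))"
    using lborel_integrable_real_affine[OF integrable_tent, of "1 / 2" 0] by simp
  then have i\<tau>: "integrable lborel \<tau>"
    unfolding \<tau>_def using integrable_tent by simp
  have \<phi>: "\<phi> x = 4 * fejer_kernel (2 * x) - fejer_kernel x" for x
  proof -
    have "(LINT \<eta>|lborel. complex_of_real (tent (\<eta> / 2)) * cis (- 2 * pi * \<eta> * x)) = 2 * fejer_kernel (2 * x)"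
      unfolding fejer_kernel_def
      by (subst lborel_integral_real_affine[where c = 2 and t = 0]) (auto simp: scaleR_conv_of_real mult_ac)
    moreover have "\<phi> x = (LINT \<eta>|lborel. 2 * (complex_of_real (tent (\<eta> / 2)) * cis (- 2 * pi * \<eta> * x))
        - complex_of_real (tent \<eta>) * cis (- 2 * pi * \<eta> * x))"
      unfolding \<phi>_def \<tau>_def by (simp add: left_diff_distrib mult.assoc)
    moreover have "\<dots> = 2 * (LINT \<eta>|lborel. complex_of_real (tent (\<eta> / 2)) * cis (- 2 * pi * \<eta> * x)) - fejer_kernel x"
      using i2[of x] integrable_tent_cis[of x] unfolding fejer_kernel_def
      by (subst Bochner_Integration.integral_diff) auto
    ultimately show ?thesis by simp
  qed
  \<comment> \<open>The 4 is the coefficient 2 times the dilation factor 2, and 4 * 3 + 3 =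
    15.\<close>
  have bound: "norm (\<phi> x) \<le> 15 / (1 + x\<^sup>2)" for x
  proof -
    have "norm (\<phi> x) \<le> 4 * norm (fejer_kernel (2 * x)) + norm (fejer_kernel x)"
      unfolding \<phi> using norm_triangle_ineq4[of "4 * fejer_kernel (2 * x)"] by (simp add: norm_mult)
    also have "\<dots> \<le> 4 * (3 / (1 + (2 * x)\<^sup>2)) + 3 / (1 + x\<^sup>2)"
      by (intro add_mono mult_left_mono norm_fejer_kernel_decay) simp
    also have "3 / (1 + (2 * x)\<^sup>2) \<le> 3 / (1 + x\<^sup>2)"
      by (intro divide_left_mono mult_pos_pos add_pos_nonneg) (auto simp: power_mult_distrib)
    finally show ?thesis by simp
  qed
  have [measurable]: "\<phi> \<in> borel_measurable borel"
    unfolding \<phi>_def by measurable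
  have i\<phi>: "integrable lborel \<phi>"
  proof (rule Bochner_Integration.integrable_bound)
    show "integrable lborel (\<lambda>x::real. 15 * (1 / (1 + x\<^sup>2)))"
      using integrable_inverse_1_plus_square_lborel by (rule integrable_mult_right)
    show "AE x in lborel. norm (\<phi> x) \<le> norm (15 * (1 / (1 + x\<^sup>2)))"
      using bound by (auto simp: abs_of_nonneg)
  qed simp
  have tb: "norm (\<tau> \<eta>) \<le> 3" for \<eta>
    using tent_nonneg[of "\<eta> / 2"] tent_le_1[of "\<eta> / 2"] tent_nonneg[of \<eta>] tent_le_1[of \<eta>]
    by (simp add: \<tau>_def del: of_real_diff)
  \<comment> \<open>Both \<open>\<phi>\<close> and \<open>fourier_R\<close> carry the negative
    exponent, so inversion is read at \<open>- \<xi>\<close>; the evenness of \<open>\<tau>\<close>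
    then removes the sign.\<close>
  have "(LINT x|lborel. \<phi> x * cis (2 * pi * x * (- \<xi>))) = \<tau> (- \<xi>)" for \<xi>
    using fourier_inversion[OF tcont tb i\<tau>] i\<phi> unfolding \<phi>_def by blast
  then have F: "fourier_R \<phi> = \<tau>"
    by (auto simp: fourier_R_lborel \<tau>_def tent_def)
  show thesis
  proof (rule that)
    show "\<And>\<xi>. \<bar>\<xi>\<bar> \<le> 1 \<Longrightarrow> fourier_R \<phi> \<xi> = 1"
      unfolding F by (auto simp: \<tau>_def tent_def)
    show "integrable lebesgue (fourier_R \<phi>)" unfolding F using i\<tau> by (simp add: integrable_completion)
  qed (use bound in auto)
qed


section \<open>Transference from the line to the integers\<close>

text \<open>Since \<open>m\<close> is only Lebesgue measurable, Fubini will be applied with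
  \<open>lebesgue\<close> as one factor.\<close>

lemma sigma_finite_lebesgue: "sigma_finite_measure (lebesgue :: 'a::euclidean_space measure)"
proof -
  obtain A :: "'a set set" where A: "countable A" "A \<subseteq> sets lborel" "\<Union>A = space lborel" "\<forall>a\<in>A. emeasure lborel a \<noteq> \<infinity>"
    using lborel.sigma_finite_countable by blast
  show ?thesis
  proof
    show "\<exists>A. countable A \<and> A \<subseteq> sets lebesgue \<and> \<Union>A = space (lebesgue :: 'a measure) \<and> (\<forall>a\<in>A. emeasure (lebesgue :: 'a measure) a \<noteq> \<infinity>)"
      using A by (intro exI[of _ A]) (auto simp: emeasure_completion subset_iff)
  qed
qed

interpretation lebesgue: sigma_finite_measure "lebesgue :: 'a::euclidean_space measure"
  by (rule sigma_finite_lebesgue)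

interpretation lborel_lebesgue: pair_sigma_finite "lborel :: 'a::euclidean_space measure" "lebesgue :: 'b::euclidean_space measure"
  ..

text \<open>Convexity of the power as a tangent line inequality, by induction and without
  derivatives. It is the pointwise form of the Jensen inequality that follows.\<close>

lemma power_tangent_le:
  fixes x a :: real
  assumes "0 \<le> x" "0 \<le> a"
  shows "a ^ p + real p * a ^ (p - 1) * (x - a) \<le> x ^ p"
proof (induction p)
  case (Suc p)
  have 1: "x * (a ^ p + real p * a ^ (p - 1) * (x - a)) \<le> x * x ^ p"
    using Suc assms by (intro mult_left_mono) auto
  have 2: "0 \<le> real p * a ^ (p - 1) * (x - a)\<^sup>2" using assms by simp
  have 3: "real p * a ^ p = real p * a ^ (p - 1) * a"
    by (cases p) auto
  have "a ^ Suc p + real (Suc p) * a ^ p * (x - a)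
      = x * a ^ p + real p * a ^ p * (x - a)" by (simp add: algebra_simps)
  also have "\<dots> = x * (a ^ p + real p * a ^ (p - 1) * (x - a)) - real p * a ^ (p - 1) * (x - a)\<^sup>2"
    unfolding 3 power2_eq_square by (simp add: algebra_simps)
  finally show ?case using 1 2 by simp
qed simp

text \<open>Jensen for the measure with density \<open>w\<close>: the tangent inequality at the
  weighted mean of \<open>h\<close> is integrated, and the linear term cancels. Clearing the
  normalisation keeps the inequality meaningful for total mass 0.\<close>

lemma weighted_power_mean:
  fixes w h :: "'a \<Rightarrow> real"
  assumes w: "integrable M w" and wh: "integrable M (\<lambda>x. w x * h x)" and whp: "integrable M (\<lambda>x. w x * h x ^ p)"
    and w0: "\<And>x. 0 \<le> w x" and h0: "\<And>x. 0 \<le> h x" and p: "p \<ge> 1"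
  shows "(LINT x|M. w x * h x) ^ p \<le> (LINT x|M. w x) ^ (p - 1) * (LINT x|M. w x * h x ^ p)"
proof -
  define W I where "W = (LINT x|M. w x)" and "I = (LINT x|M. w x * h x)"
  have W0: "0 \<le> W" and I0: "0 \<le> I" and R0: "0 \<le> (LINT x|M. w x * h x ^ p)"
    using w0 h0 by (auto simp: W_def I_def intro!: Bochner_Integration.integral_nonneg)
  show ?thesis
  proof (cases "W = 0")
    case True
    then have "AE x in M. w x = 0"
      using integral_nonneg_eq_0_iff_AE[OF w] w0 by (simp add: W_def)
    then have "I = (LINT x|M. 0)"
      unfolding I_def using w wh by (intro integral_cong_AE) auto
    then have "I ^ p = 0" using p by simp
    then have 0: "(LINT x|M. w x * h x) ^ p = 0" by (simp only: I_def)
    have "0 \<le> (LINT x|M. w x) ^ (p - 1) * (LINT x|M. w x * h x ^ p)"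
      using R0 W0 by (simp add: W_def)
    then show ?thesis unfolding 0 .
  next
    case False
    then have W: "0 < W" using W0 by simp
    define a where "a = I / W"
    have a0: "0 \<le> a" using I0 W by (simp add: a_def)
    have "(LINT x|M. (a ^ p - real p * a ^ (p - 1) * a) * w x + real p * a ^ (p - 1) * (w x * h x)) \<le> (LINT x|M. w x * h x ^ p)"
    proof (rule integral_mono)
      fix x
      have "w x * (a ^ p + real p * a ^ (p - 1) * (h x - a)) \<le> w x * h x ^ p"
        using w0 by (intro mult_left_mono power_tangent_le h0 a0)
      then show "(a ^ p - real p * a ^ (p - 1) * a) * w x + real p * a ^ (p - 1) * (w x * h x) \<le> w x * h x ^ p"
        by (simp add: algebra_simps)
    qed (use w wh whp in auto)
    also have "(LINT x|M. (a ^ p - real p * a ^ (p - 1) * a) * w x + real p * a ^ (p - 1) * (w x * h x))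
        = (a ^ p - real p * a ^ (p - 1) * a) * W + real p * a ^ (p - 1) * I"
      using w wh by (simp add: W_def I_def)
    also have "\<dots> = a ^ p * W" using W by (simp add: a_def field_simps)
    finally have "W ^ (p - 1) * (a ^ p * W) \<le> W ^ (p - 1) * (LINT x|M. w x * h x ^ p)"
      using W by (intro mult_left_mono) auto
    moreover have "W ^ (p - 1) * (a ^ p * W) = I ^ p"
    proof -
      have "W ^ (p - 1) * (a ^ p * W) = (W * W ^ (p - 1)) * a ^ p" by (simp only: mult_ac)
      also have "W * W ^ (p - 1) = W ^ p" using p by (simp flip: power_Suc)
      finally show ?thesis using W by (simp add: a_def flip: power_mult_distrib)
    qed
    ultimately show ?thesis by (simp add: W_def I_def)
  qed
qed

lemma weighted_power_mean_sum:
  fixes w h :: "'a \<Rightarrow> real"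
  assumes "finite A" and w0: "\<And>x. 0 \<le> w x" and h0: "\<And>x. 0 \<le> h x" and p: "p \<ge> 1"
  shows "(\<Sum>x\<in>A. w x * h x) ^ p \<le> (\<Sum>x\<in>A. w x) ^ (p - 1) * (\<Sum>x\<in>A. w x * h x ^ p)"
  using weighted_power_mean[OF _ _ _ w0 h0 p, of "count_space A"] assms
  by (simp add: integrable_count_space lebesgue_integral_count_space_finite)

text \<open>After recentring at the floor of x / \<epsilon> the terms are compared with 1 / (1 +
  j^2). The comparison costs 3 / \<epsilon>^2, which is harmless since \<open>D\<close> may depend
  on \<epsilon>; what matters is uniformity in \<open>x\<close> and \<open>K\<close>.\<close>

lemma lattice_sum_bound:
  fixes \<epsilon> :: real
  assumes "0 < \<epsilon>" "\<epsilon> \<le> 1"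
  obtains D where "0 \<le> D" "\<And>x K. finite K \<Longrightarrow> (\<Sum>k\<in>K. 1 / (1 + (x - \<epsilon> * real_of_int k)\<^sup>2)) \<le> D"
proof -
  define b where "b j = 1 / (1 + (real_of_int j)\<^sup>2)" for j
  obtain S where S: "\<And>K. finite K \<Longrightarrow> sum b K \<le> S"
  proof -
    define c where "c i = 1 / (1 + (real i)\<^sup>2)" for i
    have "summable c"
    proof (rule summable_comparison_test')
      show "summable (\<lambda>i. inverse (real i ^ 2))" by (rule inverse_power_summable) simp
      show "norm (c i) \<le> inverse (real i ^ 2)" if "1 \<le> i" for i
        using that by (auto simp: c_def inverse_eq_divide intro!: divide_left_mono mult_pos_pos add_pos_nonneg)
    qed
    have c0: "0 \<le> c i" for i by (simp add: c_def)
    have "sum b K \<le> 2 * suminf c" if K: "finite K" for K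
    proof -
      \<comment> \<open>The two halves overlap at 0, which only enlarges a sum of nonnegative
        terms.\<close>
      have "sum b K \<le> sum b (K \<inter> {0..}) + sum b (K \<inter> {..0})"
      proof -
        have "sum b K = sum b ((K \<inter> {0..}) \<union> (K \<inter> {..0}))" by (rule sum.cong) auto
        also have "\<dots> = sum b (K \<inter> {0..}) + sum b (K \<inter> {..0}) - sum b ((K \<inter> {0..}) \<inter> (K \<inter> {..0}))"
          using K by (intro sum_Un) auto
        also have "\<dots> \<le> sum b (K \<inter> {0..}) + sum b (K \<inter> {..0})"
          by (simp add: b_def sum_nonneg)
        finally show ?thesis .
      qed
      also have "sum b (K \<inter> {0..}) = sum c (nat ` (K \<inter> {0..}))"
        by (subst sum.reindex) (auto simp: inj_on_def b_def c_def)
      also have "\<dots> \<le> suminf c" using K by (intro sum_le_suminf \<open>summable c\<close> c0) auto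
      also have "sum b (K \<inter> {..0}) = sum c ((\<lambda>k. nat (- k)) ` (K \<inter> {..0}))"
        by (subst sum.reindex) (auto simp: inj_on_def b_def c_def)
      also have "\<dots> \<le> suminf c" using K by (intro sum_le_suminf \<open>summable c\<close> c0) auto
      finally show ?thesis by simp
    qed
    then show thesis using that by blast
  qed
  show thesis
  proof (rule that)
    show "0 \<le> 3 / \<epsilon>\<^sup>2 * S" using S[of "{}"] by simp
    fix x :: real and K :: "int set" assume K: "finite K"
    define k0 where "k0 = \<lfloor>x / \<epsilon>\<rfloor>"
    define \<theta> where "\<theta> = x / \<epsilon> - of_int k0"
    have \<theta>: "0 \<le> \<theta>" "\<theta> < 1" unfolding \<theta>_def k0_def by linarith+
    have "1 / (1 + (x - \<epsilon> * real_of_int k)\<^sup>2) \<le> 3 / \<epsilon>\<^sup>2 * b (k - k0)" for k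
    proof -
      define t where "t = \<theta> - of_int (k - k0)"
      have xt: "x - \<epsilon> * real_of_int k = \<epsilon> * t"
        using assms by (simp add: t_def \<theta>_def field_simps)
      have "of_int (k - k0) = \<theta> - t" by (simp add: t_def)
      then have "(of_int (k - k0))\<^sup>2 = (\<theta> - t)\<^sup>2" by (rule arg_cong)
      also have "\<dots> \<le> 2 * \<theta>\<^sup>2 + 2 * t\<^sup>2"
        using zero_le_power2[of "\<theta> + t"] by (simp add: power2_eq_square algebra_simps)
      also have "\<dots> \<le> 2 * 1 + 2 * t\<^sup>2" using \<theta> power_le_one[of \<theta> 2] by simp
      finally have j: "1 + (of_int (k - k0))\<^sup>2 \<le> 3 * (1 + t\<^sup>2)"
        using zero_le_power2[of t] unfolding distrib_left by (simp only: mult_1_right)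
      have "\<epsilon>\<^sup>2 * (1 + (of_int (k - k0))\<^sup>2) \<le> \<epsilon>\<^sup>2 * (3 * (1 + t\<^sup>2))"
        using j by (intro mult_left_mono) auto
      also have "\<dots> \<le> 3 * (1 + (\<epsilon> * t)\<^sup>2)"
        using assms power_le_one[of \<epsilon> 2] by (simp add: power_mult_distrib algebra_simps)
      finally have "\<epsilon>\<^sup>2 * (1 + (of_int (k - k0))\<^sup>2) \<le> 3 * (1 + (\<epsilon> * t)\<^sup>2)" .
      moreover have "0 < 1 + (\<epsilon> * t)\<^sup>2" "0 < \<epsilon>\<^sup>2 * (1 + (real_of_int (k - k0))\<^sup>2)"
        using assms by (auto intro!: mult_pos_pos add_pos_nonneg)
      ultimately show ?thesis unfolding xt b_def by (simp add: field_simps)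
    qed
    then have "(\<Sum>k\<in>K. 1 / (1 + (x - \<epsilon> * real_of_int k)\<^sup>2)) \<le> (\<Sum>k\<in>K. 3 / \<epsilon>\<^sup>2 * b (k - k0))"
      by (rule sum_mono)
    also have "\<dots> = 3 / \<epsilon>\<^sup>2 * sum b ((\<lambda>k. k - k0) ` K)"
      by (subst sum.reindex) (auto simp: inj_on_def sum_distrib_left)
    also have "\<dots> \<le> 3 / \<epsilon>\<^sup>2 * S" using K by (intro mult_left_mono S) auto
    finally show "(\<Sum>k\<in>K. 1 / (1 + (x - \<epsilon> * real_of_int k)\<^sup>2)) \<le> 3 / \<epsilon>\<^sup>2 * S" .
  qed
qed

lemma fourier_R_shift:
  assumes [measurable]: "\<phi> \<in> borel_measurable borel"
  shows "fourier_R (\<lambda>x. \<phi> (x - a)) \<xi> = cis (- 2 * pi * a * \<xi>) * fourier_R \<phi> \<xi>"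
proof -
  have "fourier_R (\<lambda>x. \<phi> (x - a)) \<xi> = (LINT x|lborel. \<phi> (x - a) * cis (- 2 * pi * x * \<xi>))"
    by (rule fourier_R_lborel) measurable
  also have "\<dots> = (LINT x|lborel. \<phi> x * cis (- 2 * pi * (a + x) * \<xi>))"
    by (subst lborel_integral_real_affine[where c = 1 and t = a]) auto
  also have "\<dots> = (LINT x|lborel. cis (- 2 * pi * a * \<xi>) * (\<phi> x * cis (- 2 * pi * x * \<xi>)))"
  proof (intro Bochner_Integration.integral_cong refl)
    fix x
    have "cis (- 2 * pi * (a + x) * \<xi>) = cis (- 2 * pi * a * \<xi>) * cis (- 2 * pi * x * \<xi>)"
      unfolding cis_mult by (simp add: algebra_simps)
    then show "\<phi> x * cis (- 2 * pi * (a + x) * \<xi>) = cis (- 2 * pi * a * \<xi>) * (\<phi> x * cis (- 2 * pi * x * \<xi>))"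
      by (simp only: mult_ac)
  qed
  finally show ?thesis by (simp add: fourier_R_lborel)
qed


section \<open>Lebesgue spaces with a natural exponent\<close>

lemma norm_powr_real: "p > 0 \<Longrightarrow> norm x powr real p = norm x ^ p" for p :: nat
  by (cases "norm x = 0") (auto simp: powr_realpow)

lemma Lp_space_nat:
  "p > 0 \<Longrightarrow> Lp_space M (real p) = {f \<in> borel_measurable M. integrable M (\<lambda>x. norm (f x) ^ p)}" for p :: nat
  by (simp add: Lp_space_def norm_powr_real)

lemma Lp_norm_nat: "p > 0 \<Longrightarrow> Lp_norm M (real p) f = (LINT x|M. norm (f x) ^ p) powr (1 / real p)" for p :: nat
  by (simp add: Lp_norm_def norm_powr_real)

lemma Lp_norm_nat_power: "p > 0 \<Longrightarrow> Lp_norm M (real p) f ^ p = (LINT x|M. norm (f x) ^ p)" for p :: nat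
  using norm_powr_real[of p "Lp_norm M (real p) f"] by (simp add: Lp_norm_nat powr_powr)

lemma Lp_norm_nonneg: "0 \<le> Lp_norm M p f"
  by (simp add: Lp_norm_def)

text \<open>The constant sequence \<open>F\<close> is admissible in
  \<open>density_extension\<close>, so the extension \<open>g\<close> at \<open>F\<close> agrees
  with \<open>multiplier_op m F\<close> almost everywhere and its norm bound carries over. The
  absolute value appears because \<open>B\<close> carries no sign assumption.\<close>

lemma multiplier_op_bound:
  fixes p :: nat
  assumes B: "Lp_multiplier_of_norm (real p) m B" and p: "p > 0"
    and F: "F \<in> fourier_class" "F \<in> Lp_space lebesgue (real p)"
  shows "integrable lebesgue (\<lambda>x. norm (multiplier_op m F x) ^ p)"
    and "(LINT x|lebesgue. norm (multiplier_op m F x) ^ p) \<le> \<bar>B\<bar> ^ p * (LINT x|lebesgue. norm (F x) ^ p)"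
proof -
  let ?T = "multiplier_op m F"
  obtain g where g: "density_extension lebesgue (real p) fourier_class (multiplier_op m) F g"
    "Lp_norm lebesgue (real p) g \<le> B * Lp_norm lebesgue (real p) F"
    using B F(2) unfolding Lp_multiplier_of_norm_def by blast
  have "Lp_tendsto lebesgue (real p) (\<lambda>_. F) F"
    unfolding Lp_tendsto_def using p by (simp add: Lp_space_nat Lp_norm_def zero_power)
  then have T: "Lp_tendsto lebesgue (real p) (\<lambda>_. ?T) g"
    using g(1)[unfolded density_extension_def, THEN conjunct2, THEN spec[of _ "\<lambda>_. F"]] F(1) by simp
  have gL: "g \<in> Lp_space lebesgue (real p)" using g(1) by (simp add: density_extension_def)
  have d: "(\<lambda>x. ?T x - g x) \<in> Lp_space lebesgue (real p)" and "Lp_norm lebesgue (real p) (\<lambda>x. ?T x - g x) = 0"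
    using T unfolding Lp_tendsto_def by (auto simp: LIMSEQ_const_iff)
  then have "(LINT x|lebesgue. norm (?T x - g x) ^ p) = 0"
    using Lp_norm_nat_power[OF p, of lebesgue "\<lambda>x. ?T x - g x"] p by (simp add: zero_power)
  then have "AE x in lebesgue. norm (?T x - g x) ^ p = 0"
    using d p by (subst (asm) integral_nonneg_eq_0_iff_AE) (auto simp: Lp_space_nat)
  then have ae: "AE x in lebesgue. norm (?T x) ^ p = norm (g x) ^ p"
    by eventually_elim (use p in simp)
  have gm: "g \<in> borel_measurable lebesgue" using gL by (simp add: Lp_space_def)
  have "(\<lambda>x. (?T x - g x) + g x) \<in> borel_measurable lebesgue"
    using d gm by (intro borel_measurable_add) (auto simp: Lp_space_def)
  then have Tm: "?T \<in> borel_measurable lebesgue" by simp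
  have ig: "integrable lebesgue (\<lambda>x. norm (g x) ^ p)" using gL p by (simp add: Lp_space_nat)
  show "integrable lebesgue (\<lambda>x. norm (?T x) ^ p)"
    using ig by (rule integrable_cong_AE_imp) (use Tm ae in auto)
  have "(LINT x|lebesgue. norm (?T x) ^ p) = (LINT x|lebesgue. norm (g x) ^ p)"
    by (rule integral_cong_AE) (use Tm gm ae in auto)
  also have "\<dots> = Lp_norm lebesgue (real p) g ^ p" by (simp add: Lp_norm_nat_power p)
  also have "\<dots> \<le> (\<bar>B\<bar> * Lp_norm lebesgue (real p) F) ^ p"
  proof (rule power_mono)
    show "Lp_norm lebesgue (real p) g \<le> \<bar>B\<bar> * Lp_norm lebesgue (real p) F"
      using g(2) mult_right_mono[OF abs_ge_self[of B] Lp_norm_nonneg[of lebesgue "real p" F]] by linarith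
  qed (rule Lp_norm_nonneg)
  also have "\<dots> = \<bar>B\<bar> ^ p * (LINT x|lebesgue. norm (F x) ^ p)"
    by (simp add: power_mult_distrib Lp_norm_nat_power p)
  finally show "(LINT x|lebesgue. norm (?T x) ^ p) \<le> \<bar>B\<bar> ^ p * (LINT x|lebesgue. norm (F x) ^ p)" .
qed

text \<open>De Leeuw--Magyar--Stein--Wainger transference: the values at \<open>\<epsilon>\<int>\<close> of \<open>T\<^sub>m\<close> applied to
  \<open>\<Sum>k. c\<^sub>k \<phi> (x - \<epsilon>k)\<close> do not see the kernel \<open>\<phi>\<close>, whose Fourier transform is \<open>1\<close> on the support of \<open>m\<close>.\<close>

lemma transference_finite:
  fixes p :: nat and m :: "real \<Rightarrow> complex"
  assumes "Lp_multiplier (real p) m" and p: "p > 0" and supp: "{x. m x \<noteq> 0} \<subseteq> {-1/2<..1/2}"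
    and \<epsilon>: "0 < \<epsilon>" "\<epsilon> \<le> 1"
  obtains A where "0 \<le> A" "\<And>K c N. finite K \<Longrightarrow> finite N \<Longrightarrow>
    (\<Sum>n\<in>N. norm (LINT \<xi>|lebesgue. m \<xi> * (\<Sum>k\<in>K. c k * cis (- 2 * pi * (\<epsilon> * real_of_int k) * \<xi>))
        * cis (2 * pi * (\<epsilon> * real_of_int n) * \<xi>)) ^ p)
      \<le> A * (\<Sum>k\<in>K. norm (c k) ^ p)"
proof -
  obtain B where B: "Lp_multiplier_of_norm (real p) m B" using assms(1) by (auto simp: Lp_multiplier_def)
  have [measurable]: "m \<in> borel_measurable lebesgue" using B by (simp add: Lp_multiplier_of_norm_def)
  obtain Mb where Mb: "\<And>\<xi>. norm (m \<xi>) \<le> Mb"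
    using B by (auto simp: Lp_multiplier_of_norm_def bounded_iff)
  obtain \<phi> C where [measurable]: "\<phi> \<in> borel_measurable borel" and \<phi>: "\<And>x. norm (\<phi> x) \<le> C / (1 + x\<^sup>2)"
    "\<And>\<xi>. \<bar>\<xi>\<bar> \<le> 1 \<Longrightarrow> fourier_R \<phi> \<xi> = 1" "integrable lebesgue (fourier_R \<phi>)"
    by (rule band_limited_kernel, rule that)
  let ?\<phi> = "\<lambda>k x. \<phi> (x - \<epsilon> * real_of_int k)"
  have supp1: "\<bar>\<xi>\<bar> \<le> 1" if "m \<xi> \<noteq> 0" for \<xi>
    using subsetD[OF supp, of \<xi>] that by (auto simp: abs_le_iff)
  have C0: "0 \<le> C" using order_trans[OF norm_ge_zero \<phi>(1)[of 0]] by simp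
  obtain D0 where D0: "0 \<le> D0" "\<And>x K. finite K \<Longrightarrow> (\<Sum>k\<in>K. 1 / (1 + (x - \<epsilon> * real_of_int k)\<^sup>2)) \<le> D0"
    using lattice_sum_bound[OF \<epsilon>] by blast
  define D where "D = C * D0"
  have D: "0 \<le> D" using C0 D0 by (simp add: D_def)
  have DK: "(\<Sum>k\<in>K. norm (?\<phi> k x)) \<le> D" if "finite K" for x K
  proof -
    have "(\<Sum>k\<in>K. norm (?\<phi> k x)) \<le> (\<Sum>k\<in>K. C * (1 / (1 + (x - \<epsilon> * real_of_int k)\<^sup>2)))"
      using \<phi>(1) by (intro sum_mono) simp
    also have "\<dots> \<le> D" unfolding D_def sum_distrib_left[symmetric]
      using C0 D0(2)[OF that] by (intro mult_left_mono) auto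
    finally show ?thesis .
  qed
  have \<phi>C: "norm (\<phi> x) \<le> C" for x
  proof -
    have "C / (1 + x\<^sup>2) \<le> C / 1" using C0 by (intro divide_left_mono) (auto intro: add_pos_nonneg)
    then show ?thesis using \<phi>(1)[of x] by simp
  qed
  have i\<phi>: "integrable lborel \<phi>"
  proof (rule Bochner_Integration.integrable_bound)
    show "integrable lborel (\<lambda>x::real. C * (1 / (1 + x\<^sup>2)))"
      using integrable_inverse_1_plus_square_lborel by (rule integrable_mult_right)
    show "AE x in lborel. norm (\<phi> x) \<le> norm (C * (1 / (1 + x\<^sup>2)))"
      using \<phi>(1) C0 by (auto simp: abs_of_nonneg)
  qed simp
  define L where "L = (LINT x|lborel. norm (\<phi> x))"
  have L: "0 \<le> L" by (simp add: L_def)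
  have i\<phi>s: "integrable lborel (\<lambda>x. \<phi> (x - a))" for a
    using lborel_integrable_real_affine[OF i\<phi>, of 1 "- a"] by simp
  have L_shift: "(LINT x|lborel. norm (\<phi> (x - a))) = L" for a
    unfolding L_def by (subst (2) lborel_integral_real_affine[where c = 1 and t = "- a"]) auto
  have L_refl: "(LINT x|lborel. w (a - x)) = (LINT x|lborel. w x)" for w :: "real \<Rightarrow> real" and a
    by (subst (2) lborel_integral_real_affine[where c = "- 1" and t = a]) auto
  have int_refl: "integrable lborel (\<lambda>x. w (a - x))" if "integrable lborel w" for w :: "real \<Rightarrow> real" and a
    using lborel_integrable_real_affine[OF that, of "- 1" a] by simp
  have main: "(\<Sum>n\<in>N. norm (LINT \<xi>|lebesgue. m \<xi> * (\<Sum>k\<in>K. c k * cis (- 2 * pi * (\<epsilon> * real_of_int k) * \<xi>))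
        * cis (2 * pi * (\<epsilon> * real_of_int n) * \<xi>)) ^ p)
      \<le> (L ^ (p - 1) * D * \<bar>B\<bar> ^ p * D ^ (p - 1) * L) * (\<Sum>k\<in>K. norm (c k) ^ p)"
    if K: "finite K" and N: "finite N" for K c N
  proof -
    define F where "F x = (\<Sum>k\<in>K. c k * ?\<phi> k x)" for x
    define P where "P \<xi> = (\<Sum>k\<in>K. c k * cis (- 2 * pi * (\<epsilon> * real_of_int k) * \<xi>))" for \<xi>
    define g where "g x = (LINT \<xi>|lebesgue. m \<xi> * P \<xi> * cis (2 * pi * x * \<xi>))" for x
    \<comment> \<open>Jensen majorant of |F|^p: the weights |\<phi> (x - \<epsilon> k)| have total
      mass at most \<open>D\<close> over \<open>k\<close> for each \<open>x\<close>, and mass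
      \<open>L\<close> over \<open>x\<close> for each \<open>k\<close>.\<close>
    define U where "U x = D ^ (p - 1) * (\<Sum>k\<in>K. norm (?\<phi> k x) * norm (c k) ^ p)" for x
    have [measurable]: "F \<in> borel_measurable borel" unfolding F_def by measurable
    have [measurable]: "P \<in> borel_measurable borel" unfolding P_def by measurable
    have FU: "norm (F x) ^ p \<le> U x" for x
    proof -
      have "norm (F x) \<le> (\<Sum>k\<in>K. norm (?\<phi> k x) * norm (c k))"
        unfolding F_def by (rule order_trans[OF norm_sum]) (simp add: norm_mult mult.commute)
      then have "norm (F x) ^ p \<le> (\<Sum>k\<in>K. norm (?\<phi> k x) * norm (c k)) ^ p"
        by (rule power_mono) simp
      also have "\<dots> \<le> (\<Sum>k\<in>K. norm (?\<phi> k x)) ^ (p - 1) * (\<Sum>k\<in>K. norm (?\<phi> k x) * norm (c k) ^ p)"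
        using p by (intro weighted_power_mean_sum K) auto
      also have "\<dots> \<le> U x"
        unfolding U_def using DK[OF K] by (intro mult_right_mono power_mono) (auto intro: sum_nonneg)
      finally show ?thesis .
    qed
    have iU: "integrable lborel U"
      unfolding U_def using i\<phi>s by (intro integrable_mult_right Bochner_Integration.integrable_sum integrable_mult_left integrable_norm)
    have IU: "(LINT x|lborel. U x) = D ^ (p - 1) * L * (\<Sum>k\<in>K. norm (c k) ^ p)"
    proof -
      have "(LINT x|lborel. U x) = D ^ (p - 1) * (\<Sum>k\<in>K. LINT x|lborel. norm (?\<phi> k x) * norm (c k) ^ p)"
        unfolding U_def integral_mult_right_zero
        using i\<phi>s by (subst Bochner_Integration.integral_sum) (auto intro!: integrable_mult_left integrable_norm)
      also have "\<dots> = D ^ (p - 1) * L * (\<Sum>k\<in>K. norm (c k) ^ p)"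
        by (simp add: L_shift sum_distrib_left mult.assoc)
      finally show ?thesis .
    qed
    have iFp: "integrable lborel (\<lambda>x. norm (F x) ^ p)"
      by (rule Bochner_Integration.integrable_bound[OF iU]) (auto intro: order_trans[OF FU abs_ge_self])
    have IFp: "(LINT x|lborel. norm (F x) ^ p) \<le> D ^ (p - 1) * L * (\<Sum>k\<in>K. norm (c k) ^ p)"
      unfolding IU[symmetric] by (rule integral_mono[OF iFp iU FU])
    have iF: "integrable lborel F"
      unfolding F_def using i\<phi>s by (intro Bochner_Integration.integrable_sum integrable_mult_right)
    have FF0: "fourier_R F \<xi> = P \<xi> * fourier_R \<phi> \<xi>" for \<xi>
    proof -
      have i: "integrable lborel (\<lambda>x. c k * ?\<phi> k x * cis (- 2 * pi * x * \<xi>))" for k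
        by (rule Bochner_Integration.integrable_bound[OF integrable_mult_right[OF i\<phi>s, of "c k" "\<epsilon> * real_of_int k"]]) (auto simp: norm_mult)
      have "fourier_R F \<xi> = (LINT x|lborel. (\<Sum>k\<in>K. c k * ?\<phi> k x * cis (- 2 * pi * x * \<xi>)))"
        by (simp add: fourier_R_lborel) (simp add: F_def sum_distrib_right)
      also have "\<dots> = (\<Sum>k\<in>K. LINT x|lborel. c k * ?\<phi> k x * cis (- 2 * pi * x * \<xi>))"
        using i by (rule Bochner_Integration.integral_sum)
      also have "\<dots> = (\<Sum>k\<in>K. c k * fourier_R (\<lambda>x. ?\<phi> k x) \<xi>)"
        by (simp add: fourier_R_lborel mult.assoc)
      also have "\<dots> = P \<xi> * fourier_R \<phi> \<xi>"
        unfolding P_def by (subst fourier_R_shift) (auto simp: sum_distrib_right mult.assoc)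
      finally show ?thesis .
    qed
    have FF: "fourier_R F = (\<lambda>\<xi>. P \<xi> * fourier_R \<phi> \<xi>)" by (rule ext) (rule FF0)
    define PB where "PB = (\<Sum>k\<in>K. norm (c k))"
    have PB: "norm (P \<xi>) \<le> PB" for \<xi>
      unfolding P_def PB_def by (rule order_trans[OF norm_sum]) (simp add: norm_mult)
    have PB0: "0 \<le> PB" by (simp add: PB_def sum_nonneg)
    have Fcl: "F \<in> fourier_class"
    proof -
      have "integrable lebesgue (\<lambda>\<xi>. P \<xi> * fourier_R \<phi> \<xi>)"
      proof (rule Bochner_Integration.integrable_bound)
        show "integrable lebesgue (\<lambda>\<xi>. PB * norm (fourier_R \<phi> \<xi>))"
          using \<phi>(3) by (intro integrable_mult_right integrable_norm)
        show "(\<lambda>\<xi>. P \<xi> * fourier_R \<phi> \<xi>) \<in> borel_measurable lebesgue"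
          using borel_measurable_integrable[OF \<phi>(3)]
          by (intro borel_measurable_times) (auto intro: measurable_completion)
        show "AE \<xi> in lebesgue. norm (P \<xi> * fourier_R \<phi> \<xi>) \<le> norm (PB * norm (fourier_R \<phi> \<xi>))"
          using PB PB0 by (auto simp: norm_mult intro!: AE_I2 mult_right_mono)
      qed
      then show ?thesis using iF by (simp add: fourier_class_def FF integrable_completion)
    qed
    have FLp: "F \<in> Lp_space lebesgue (real p)"
      using iFp p by (simp add: Lp_space_nat integrable_completion measurable_completion)
    \<comment> \<open>Where \<open>m\<close> is nonzero, the support condition makes
      \<open>fourier_R \<phi>\<close> equal to 1, so the kernel disappears from the
      integral.\<close>
    have Tg: "multiplier_op m F = g"
    proof
      fix x
      have "m \<xi> * fourier_R F \<xi> = m \<xi> * P \<xi>" for \<xi>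
        using \<phi>(2)[of \<xi>] supp1[of \<xi>] by (cases "m \<xi> = 0") (auto simp: FF)
      then show "multiplier_op m F x = g x"
        by (simp only: multiplier_op_def fourier_R_inv_def g_def)
    qed
    have i\<Psi>: "integrable lebesgue (\<lambda>\<xi>. m \<xi> * P \<xi>)"
    proof (rule Bochner_Integration.integrable_bound)
      show "integrable lebesgue (\<lambda>\<xi>. Mb * PB * indicator {-1/2..1/2::real} \<xi>)"
        by (intro integrable_mult_right) simp
      show "AE \<xi> in lebesgue. norm (m \<xi> * P \<xi>) \<le> norm (Mb * PB * indicator {-1/2..1/2} \<xi> :: real)"
      proof (intro AE_I2)
        fix \<xi>
        have "0 \<le> Mb" using Mb[of 0] norm_ge_zero order_trans by blast
        moreover have "norm (m \<xi> * P \<xi>) \<le> Mb * PB"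
          unfolding norm_mult using Mb PB \<open>0 \<le> Mb\<close> by (intro mult_mono) auto
        moreover have "m \<xi> = 0" if "\<xi> \<notin> {-1/2..1/2}" using supp that by auto
        ultimately show "norm (m \<xi> * P \<xi>) \<le> norm (Mb * PB * indicator {-1/2..1/2} \<xi> :: real)"
          using PB0 by (auto simp: indicator_def)
      qed
      show "(\<lambda>\<xi>. m \<xi> * P \<xi>) \<in> borel_measurable lebesgue"
        by (intro borel_measurable_times) (auto intro: measurable_completion)
    qed
    have [measurable]: "P \<in> borel_measurable lebesgue" by (auto intro: measurable_completion)
    have [measurable]: "(\<lambda>x. x) \<in> borel_measurable (lebesgue :: real measure)" by (auto intro: measurable_completion)
    have gm [measurable]: "g \<in> borel_measurable borel"
      unfolding g_def by measurable
    define G where "G = (LINT \<xi>|lebesgue. norm (m \<xi> * P \<xi>))"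
    have gG: "norm (g x) \<le> G" for x
      unfolding g_def G_def by (rule order_trans[OF integral_norm_bound]) (simp add: norm_mult)
    have ig: "integrable lborel (\<lambda>x. norm (g x) ^ p)"
      using multiplier_op_bound(1)[OF B p Fcl FLp] unfolding Tg by (simp add: integrable_completion)
    have Ig: "(LINT x|lborel. norm (g x) ^ p) \<le> \<bar>B\<bar> ^ p * (LINT x|lborel. norm (F x) ^ p)"
      using multiplier_op_bound(2)[OF B p Fcl FLp] unfolding Tg by (simp add: integral_completion)
    \<comment> \<open>Convolution with \<open>\<phi>\<close> reproduces \<open>g\<close>, whose
      frequencies lie in the support of \<open>m\<close>. Values of \<open>g\<close> at lattice
      points thereby become averages over the line, which \<open>multiplier_op_bound\<close>
      controls.\<close>
    have rep: "g x = (LINT y|lborel. \<phi> y * g (x - y))" for x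
    proof -
      let ?H = "\<lambda>y \<xi>. \<phi> y * (m \<xi> * P \<xi> * cis (2 * pi * (x - y) * \<xi>))"
      have iH: "integrable (lborel \<Otimes>\<^sub>M lebesgue) (case_prod ?H)"
      proof (rule lborel_lebesgue.Fubini_integrable)
        show "case_prod ?H \<in> borel_measurable (lborel \<Otimes>\<^sub>M lebesgue)" by measurable
        show "integrable lborel (\<lambda>y. LINT \<xi>|lebesgue. norm (case_prod ?H (y, \<xi>)))"
          using i\<phi> by (simp add: norm_mult)
        show "AE y in lborel. integrable lebesgue (\<lambda>\<xi>. case_prod ?H (y, \<xi>))"
        proof (intro AE_I2)
          fix y
          have "integrable lebesgue (\<lambda>\<xi>. m \<xi> * P \<xi> * cis (2 * pi * (x - y) * \<xi>))"
            by (rule Bochner_Integration.integrable_bound[OF i\<Psi>]) (auto simp: norm_mult)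
          then show "integrable lebesgue (\<lambda>\<xi>. case_prod ?H (y, \<xi>))" by simp
        qed
      qed
      have "(LINT y|lborel. \<phi> y * g (x - y)) = (LINT y|lborel. LINT \<xi>|lebesgue. ?H y \<xi>)"
        unfolding g_def integral_mult_right_zero ..
      also have "\<dots> = (LINT \<xi>|lebesgue. LINT y|lborel. ?H y \<xi>)"
        by (rule lborel_lebesgue.Fubini_integral[OF iH, symmetric])
      also have "\<dots> = (LINT \<xi>|lebesgue. m \<xi> * P \<xi> * cis (2 * pi * x * \<xi>))"
      proof (rule Bochner_Integration.integral_cong)
        fix \<xi>
        have "(LINT y|lborel. ?H y \<xi>) = (LINT y|lborel. (m \<xi> * P \<xi> * cis (2 * pi * x * \<xi>)) * (\<phi> y * cis (- 2 * pi * y * \<xi>)))"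
        proof (rule Bochner_Integration.integral_cong)
          fix y
          have e: "cis (2 * pi * (x - y) * \<xi>) = cis (2 * pi * x * \<xi>) * cis (- 2 * pi * y * \<xi>)"
            unfolding cis_mult by (simp add: algebra_simps)
          show "?H y \<xi> = (m \<xi> * P \<xi> * cis (2 * pi * x * \<xi>)) * (\<phi> y * cis (- 2 * pi * y * \<xi>))"
            unfolding e by (simp only: mult_ac)
        qed simp
        also have "\<dots> = (m \<xi> * P \<xi> * cis (2 * pi * x * \<xi>)) * fourier_R \<phi> \<xi>"
          unfolding integral_mult_right_zero by (simp add: fourier_R_lborel)
        also have "\<dots> = m \<xi> * P \<xi> * cis (2 * pi * x * \<xi>)"
          using \<phi>(2)[of \<xi>] supp1[of \<xi>] by (cases "m \<xi> = 0") auto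
        finally show "(LINT y|lborel. ?H y \<xi>) = m \<xi> * P \<xi> * cis (2 * pi * x * \<xi>)" .
      qed simp
      finally show ?thesis by (simp add: g_def)
    qed
    have pt: "norm (g x) ^ p \<le> L ^ (p - 1) * (LINT y|lborel. norm (\<phi> (x - y)) * norm (g y) ^ p)" for x
    proof -
      have i1: "integrable lborel (\<lambda>y. norm (\<phi> y) * norm (g (x - y)))"
        by (rule Bochner_Integration.integrable_bound[OF integrable_mult_left[OF integrable_norm[OF i\<phi>], of G]])
          (auto intro!: AE_I2 mult_left_mono order_trans[OF gG] simp: abs_mult)
      have i2: "integrable lborel (\<lambda>y. norm (\<phi> y) * norm (g (x - y)) ^ p)"
        by (rule Bochner_Integration.integrable_bound[OF integrable_mult_left[OF integrable_norm[OF i\<phi>], of "G ^ p"]])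
          (auto intro!: AE_I2 mult_left_mono order_trans[OF power_mono[OF gG]] simp: abs_mult)
      have "norm (g x) \<le> (LINT y|lborel. norm (\<phi> y) * norm (g (x - y)))"
        by (subst rep, rule order_trans[OF integral_norm_bound]) (simp add: norm_mult)
      then have "norm (g x) ^ p \<le> (LINT y|lborel. norm (\<phi> y) * norm (g (x - y))) ^ p"
        by (rule power_mono) simp
      also have "\<dots> \<le> L ^ (p - 1) * (LINT y|lborel. norm (\<phi> y) * norm (g (x - y)) ^ p)"
        unfolding L_def using p i1 i2 i\<phi> by (intro weighted_power_mean) auto
      also have "(LINT y|lborel. norm (\<phi> y) * norm (g (x - y)) ^ p) = (LINT y|lborel. norm (\<phi> (x - y)) * norm (g y) ^ p)"
        using L_refl[of "\<lambda>y. norm (\<phi> (x - y)) * norm (g y) ^ p" x] by simp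
      finally show ?thesis .
    qed
    have i3: "integrable lborel (\<lambda>y. norm (\<phi> (x - y)) * norm (g y) ^ p)" for x
      by (rule Bochner_Integration.integrable_bound[OF integrable_mult_right[OF ig, of C]])
        (use C0 \<phi>C in \<open>auto intro!: AE_I2 mult_right_mono simp: abs_mult\<close>)
    let ?e = "\<lambda>n. \<epsilon> * real_of_int n"
    \<comment> \<open>Sampling: the sum over the lattice falls on the kernel, where it is at most
      \<open>D\<close> uniformly in \<open>y\<close>.\<close>
    have "(\<Sum>n\<in>N. norm (g (?e n)) ^ p) \<le> (\<Sum>n\<in>N. L ^ (p - 1) * (LINT y|lborel. norm (\<phi> (?e n - y)) * norm (g y) ^ p))"
      by (intro sum_mono pt)
    also have "\<dots> = L ^ (p - 1) * (LINT y|lborel. (\<Sum>n\<in>N. norm (\<phi> (?e n - y)) * norm (g y) ^ p))"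
      using i3 by (simp add: sum_distrib_left)
    also have "\<dots> = L ^ (p - 1) * (LINT y|lborel. (\<Sum>n\<in>N. norm (\<phi> (?e n - y))) * norm (g y) ^ p)"
      by (simp add: sum_distrib_right)
    also have "\<dots> \<le> L ^ (p - 1) * (LINT y|lborel. D * norm (g y) ^ p)"
    proof (intro mult_left_mono integral_mono)
      fix y
      have "(\<Sum>n\<in>N. norm (\<phi> (?e n - y))) \<le> D"
      proof -
        have "(\<Sum>n\<in>N. norm (\<phi> (?e n - y))) \<le> (\<Sum>n\<in>N. C * (1 / (1 + (y - ?e n)\<^sup>2)))"
          using \<phi>(1)[of "?e n - y" for n] by (intro sum_mono) (simp add: power2_commute)
        also have "\<dots> \<le> D" unfolding D_def sum_distrib_left[symmetric]
          using C0 D0(2)[OF N] by (intro mult_left_mono) auto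
        finally show ?thesis .
      qed
      then show "(\<Sum>n\<in>N. norm (\<phi> (?e n - y))) * norm (g y) ^ p \<le> D * norm (g y) ^ p"
        by (intro mult_right_mono) auto
    qed (use L ig i3 in \<open>auto simp: sum_distrib_right\<close>)
    also have "\<dots> = L ^ (p - 1) * D * (LINT y|lborel. norm (g y) ^ p)" by simp
    also have "\<dots> \<le> L ^ (p - 1) * D * (\<bar>B\<bar> ^ p * (D ^ (p - 1) * L * (\<Sum>k\<in>K. norm (c k) ^ p)))"
      using L D by (intro mult_left_mono order_trans[OF Ig] IFp) auto
    finally show ?thesis by (simp add: g_def P_def mult_ac)
  qed
  show thesis
    by (rule that[OF _ main]) (use L D in auto)
qed


section \<open>Extension by density\<close>

abbreviation l_integrable :: "nat \<Rightarrow> (int \<Rightarrow> complex) \<Rightarrow> bool" where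
  "l_integrable p f \<equiv> integrable (count_space UNIV) (\<lambda>n. norm (f n) ^ p)"

abbreviation l_sum :: "nat \<Rightarrow> (int \<Rightarrow> complex) \<Rightarrow> real" where
  "l_sum p f \<equiv> (LINT n|count_space UNIV. norm (f n) ^ p)"

lemma sum_le_LINT_count:
  fixes f :: "'a \<Rightarrow> real"
  assumes "integrable (count_space UNIV) f" "\<And>n. 0 \<le> f n" "finite A"
  shows "sum f A \<le> (LINT n|count_space UNIV. f n)"
proof -
  have "sum f A = (LINT n|count_space UNIV. f n * indicator A n)"
  proof -
    have "(LINT n|count_space UNIV. f n * indicator A n) = (\<Sum>n | n \<in> UNIV \<and> f n * indicator A n \<noteq> 0. f n * indicator A n)"
      using assms(3) by (intro lebesgue_integral_count_space_finite_support) (auto intro: finite_subset simp: indicator_def)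
    also have "\<dots> = (\<Sum>n\<in>A. f n * indicator A n)"
      using assms(3) by (intro sum.mono_neutral_left) (auto simp: indicator_def)
    finally show ?thesis by simp
  qed
  also have "\<dots> \<le> (LINT n|count_space UNIV. f n)"
  proof (rule integral_mono)
    show "integrable (count_space UNIV) (\<lambda>n. f n * indicator A n)"
      by (rule integrable_count_bound[OF assms(1)]) (use assms(2) in \<open>auto simp: indicator_def\<close>)
  qed (use assms in \<open>auto simp: indicator_def\<close>)
  finally show ?thesis .
qed

lemma
  fixes f :: "'a \<Rightarrow> real"
  assumes f0: "\<And>n. 0 \<le> f n" and b: "\<And>A. finite A \<Longrightarrow> sum f A \<le> b"
  shows integrable_count_if_sums_bounded: "integrable (count_space UNIV) f"
    and LINT_count_le_if_sums_bounded: "(LINT n|count_space UNIV. f n) \<le> b"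
proof -
  have "f summable_on UNIV"
    using f0 b by (intro nonneg_bdd_above_summable_on) (auto intro!: bdd_aboveI)
  then have "(\<lambda>n. norm (f n)) summable_on UNIV" using f0 by simp
  then show i: "integrable (count_space UNIV) f"
    using abs_summable_equivalent[of f UNIV] by (simp add: abs_summable_on_def)
  have "(LINT n|count_space UNIV. f n) = infsum f UNIV"
    using infsetsum_infsum[of f UNIV] i by (simp add: infsetsum_def abs_summable_on_def)
  also have "\<dots> \<le> b"
    using \<open>f summable_on UNIV\<close> b by (intro infsum_le_finite_sums) auto
  finally show "(LINT n|count_space UNIV. f n) \<le> b" .
qed

lemma l_sum_nonneg: "0 \<le> l_sum p f"
  by simp

lemma norm_power_le_l_sum: "l_integrable p f \<Longrightarrow> norm (f n) ^ p \<le> l_sum p f"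
  using sum_le_LINT_count[of "\<lambda>n. norm (f n) ^ p" "{n}"] by simp

text \<open>With p-th powers in place of norms, the factor \<open>2 ^ p\<close> stands in for the
  Minkowski inequality; it enters the final constant only through \<open>r\<close>.\<close>

lemma l_add:
  assumes f: "l_integrable p f" and g: "l_integrable p g" and h: "\<And>n. norm (h n) \<le> norm (f n) + norm (g n)"
  shows "l_integrable p h" and "l_sum p h \<le> 2 ^ p * (l_sum p f + l_sum p g)"
proof -
  have le: "norm (h n) ^ p \<le> 2 ^ p * (norm (f n) ^ p + norm (g n) ^ p)" for n
    using power_mono[OF h, of n p] power_add_le_2[of "norm (f n)" "norm (g n)" p] by simp
  have i: "integrable (count_space UNIV) (\<lambda>n. 2 ^ p * (norm (f n) ^ p + norm (g n) ^ p))"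
    using f g by simp
  show *: "l_integrable p h"
    by (rule integrable_count_bound[OF i]) (use le in simp)
  have "l_sum p h \<le> (LINT n|count_space UNIV. 2 ^ p * (norm (f n) ^ p + norm (g n) ^ p))"
    by (rule integral_mono[OF * i le])
  also have "\<dots> = 2 ^ p * (l_sum p f + l_sum p g)" using f g by simp
  finally show "l_sum p h \<le> 2 ^ p * (l_sum p f + l_sum p g)" .
qed

lemma l_integrable_1_imp:
  assumes f: "l_integrable 1 f" and p: "p > 0"
  shows "l_integrable p f"
proof -
  have i: "integrable (count_space UNIV) (\<lambda>n. l_sum 1 f ^ (p - 1) * norm (f n) ^ 1)" using f by simp
  have "norm (f n) ^ p \<le> l_sum 1 f ^ (p - 1) * norm (f n) ^ 1" for n
  proof -
    have "norm (f n) \<le> l_sum 1 f" using norm_power_le_l_sum[OF f, of n] by simp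
    then have "norm (f n) ^ (p - 1) * norm (f n) \<le> l_sum 1 f ^ (p - 1) * norm (f n)"
      by (intro mult_right_mono power_mono) auto
    moreover have "norm (f n) ^ (p - 1) * norm (f n) = norm (f n) ^ p"
      using p by (simp flip: power_Suc2)
    ultimately show ?thesis by simp
  qed
  then show ?thesis by (intro integrable_count_bound[OF i]) simp
qed

lemma lp_space_1: "lp_space 1 = {f. l_integrable 1 f}"
  using Lp_space_nat[of 1 "count_space (UNIV :: int set)"] by auto

lemma Lp_tendsto_nat:
  fixes u :: "nat \<Rightarrow> int \<Rightarrow> complex"
  assumes p: "p > 0"
  shows "Lp_tendsto (count_space UNIV) (real p) u g \<longleftrightarrow>
    (\<forall>k. l_integrable p (\<lambda>n. u k n - g n)) \<and> (\<lambda>k. l_sum p (\<lambda>n. u k n - g n)) \<longlonglongrightarrow> 0"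
proof -
  have "(\<lambda>k. l_sum p (\<lambda>n. u k n - g n)) \<longlonglongrightarrow> 0"
    if "(\<lambda>k. Lp_norm (count_space UNIV) (real p) (\<lambda>n. u k n - g n)) \<longlonglongrightarrow> 0"
    using tendsto_power[OF that, of p] p by (simp add: Lp_norm_nat_power zero_power)
  moreover have "(\<lambda>k. Lp_norm (count_space UNIV) (real p) (\<lambda>n. u k n - g n)) \<longlonglongrightarrow> 0"
    if "(\<lambda>k. l_sum p (\<lambda>n. u k n - g n)) \<longlonglongrightarrow> 0"
  proof -
    have "(\<lambda>k. l_sum p (\<lambda>n. u k n - g n) powr (1 / real p)) \<longlonglongrightarrow> 0 powr (1 / real p)"
      using p by (intro tendsto_powr'[OF that tendsto_const]) auto
    then show ?thesis using p by (simp add: Lp_norm_nat)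
  qed
  ultimately show ?thesis using p by (auto simp: Lp_tendsto_def Lp_space_nat)
qed

text \<open>The canonical approximating sequence: each term is summable, and the difference of two
  truncations is dominated by the tail left by the shorter one.\<close>

definition truncate :: "nat \<Rightarrow> (int \<Rightarrow> complex) \<Rightarrow> int \<Rightarrow> complex" where
  "truncate k f n = (if \<bar>n\<bar> \<le> int k then f n else 0)"

lemma l_integrable_truncate:
  assumes "p > 0"
  shows "l_integrable p (truncate k f)"
proof (rule integrable_count_if_sums_bounded)
  fix A :: "int set" assume A: "finite A"
  let ?g = "\<lambda>n. norm (truncate k f n) ^ p"
  have "sum ?g A = sum ?g (A \<inter> {- int k..int k})"
    using A assms by (intro sum.mono_neutral_right) (auto simp: truncate_def)
  also have "\<dots> \<le> sum ?g {- int k..int k}" by (intro sum_mono2) auto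
  finally show "sum ?g A \<le> sum ?g {- int k..int k}" .
qed simp

lemma truncate_tendsto:
  assumes f: "l_integrable p f" and p: "p > 0"
  shows "l_integrable p (\<lambda>n. truncate k f n - f n)" and "(\<lambda>k. l_sum p (\<lambda>n. truncate k f n - f n)) \<longlonglongrightarrow> 0"
proof -
  have le: "norm (truncate k f n - f n) ^ p \<le> norm (f n) ^ p" for k n
    by (auto simp: truncate_def zero_power p)
  show "l_integrable p (\<lambda>n. truncate k f n - f n)"
    by (rule integrable_count_bound[OF f]) (use le in simp)
  have "(\<lambda>k. l_sum p (\<lambda>n. truncate k f n - f n)) \<longlonglongrightarrow> (LINT n|count_space (UNIV :: int set). 0)"
  proof (rule integral_dominated_convergence[where w = "\<lambda>n. norm (f n) ^ p"])
    show "AE n in count_space UNIV. (\<lambda>k. norm (truncate k f n - f n) ^ p) \<longlonglongrightarrow> 0"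
    proof (intro AE_I2)
      fix n :: int
      have "\<forall>\<^sub>F k in sequentially. norm (truncate k f n - f n) ^ p = 0"
        using eventually_ge_at_top[of "nat \<bar>n\<bar>"] by eventually_elim (auto simp: truncate_def p)
      then show "(\<lambda>k. norm (truncate k f n - f n) ^ p) \<longlonglongrightarrow> 0" by (rule tendsto_eventually)
    qed
  qed (use f le in auto)
  then show "(\<lambda>k. l_sum p (\<lambda>n. truncate k f n - f n)) \<longlonglongrightarrow> 0" by simp
qed

text \<open>The bound makes the images of the truncations Cauchy, and their pointwise limit
  \<open>g\<close> is the extension; completeness is replaced by bounds on finite partial sums that
  survive the limit. Uniqueness, tested on the truncations, is what lets the description operator
  select \<open>g\<close>.\<close>

lemma density_extension_count:
  fixes T :: "(int \<Rightarrow> complex) \<Rightarrow> int \<Rightarrow> complex"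
  assumes p: "p > 0" and A: "0 \<le> A"
    and lin: "\<And>u v n. l_integrable 1 u \<Longrightarrow> l_integrable 1 v \<Longrightarrow> T (\<lambda>n. u n - v n) n = T u n - T v n"
    and int: "\<And>u. l_integrable 1 u \<Longrightarrow> l_integrable p (T u)"
    and bound: "\<And>u. l_integrable 1 u \<Longrightarrow> l_sum p (T u) \<le> A * l_sum p u"
    and f: "l_integrable p f"
  shows "density_extension (count_space UNIV) (real p) (lp_space 1) T f
    (THE g. density_extension (count_space UNIV) (real p) (lp_space 1) T f g)"
proof -
  let ?ext = "density_extension (count_space UNIV) (real p) (lp_space 1) T f"
  let ?u = "\<lambda>k. truncate k f"
  let ?D = "\<lambda>k. l_sum p (\<lambda>n. ?u k n - f n)"
  have u1: "l_integrable 1 (?u k)" for k by (rule l_integrable_truncate) simp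
  have diff1: "l_integrable 1 (\<lambda>n. u n - v n)" if "l_integrable 1 u" "l_integrable 1 v" for u v
    by (rule l_add(1)[OF that norm_triangle_ineq4])
  define t where "t k = A * ?D k" for k
  have t: "t \<longlonglongrightarrow> 0"
    unfolding t_def using tendsto_mult[OF tendsto_const truncate_tendsto(2)[OF f p], of A] by simp
  have tail: "l_sum p (T (\<lambda>n. ?u j n - ?u k n)) \<le> t k" if "k \<le> j" for j k
  proof -
    have "l_sum p (T (\<lambda>n. ?u j n - ?u k n)) \<le> A * l_sum p (\<lambda>n. ?u j n - ?u k n)"
      by (intro bound diff1 u1)
    also have "\<dots> \<le> t k"
      unfolding t_def
    proof (intro mult_left_mono A integral_mono)
      show "l_integrable p (\<lambda>n. ?u j n - ?u k n)"
        by (rule l_integrable_1_imp[OF diff1[OF u1 u1] p])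
      show "l_integrable p (\<lambda>n. ?u k n - f n)" by (rule truncate_tendsto(1)[OF f p])
      show "norm (?u j n - ?u k n) ^ p \<le> norm (?u k n - f n) ^ p" for n
        using that by (intro power_mono) (auto simp: truncate_def)
    qed
    finally show ?thesis .
  qed
  have iT: "l_integrable p (\<lambda>n. T (?u j) n - T (?u k) n)" for j k
    using int[OF diff1[OF u1[of j] u1[of k]]] lin[OF u1[of j] u1[of k]] by simp
  have tailT: "(\<Sum>n\<in>N. norm (T (?u j) n - T (?u k) n) ^ p) \<le> t k" if "k \<le> j" "finite N" for j k N
  proof -
    have "(\<Sum>n\<in>N. norm (T (?u j) n - T (?u k) n) ^ p) \<le> l_sum p (\<lambda>n. T (?u j) n - T (?u k) n)"
      by (rule sum_le_LINT_count[OF iT _ that(2)]) simp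
    also have "\<dots> = l_sum p (T (\<lambda>n. ?u j n - ?u k n))" using lin[OF u1[of j] u1[of k]] by simp
    also have "\<dots> \<le> t k" by (rule tail[OF that(1)])
    finally show ?thesis .
  qed
  have "Cauchy (\<lambda>k. T (?u k) n)" for n
  proof (rule CauchyI')
    fix e :: real assume e: "0 < e"
    then have "0 < e ^ p" by simp
    then obtain k where k: "\<And>j. j \<ge> k \<Longrightarrow> t j < e ^ p"
      using t[THEN order_tendstoD(2)] unfolding eventually_sequentially by blast
    show "\<exists>M. \<forall>m\<ge>M. \<forall>n'>m. dist (T (?u m) n) (T (?u n') n) < e"
    proof (intro exI[of _ k] allI impI)
      fix i j :: nat assume "k \<le> i" "i < j"
      then have "norm (T (?u j) n - T (?u i) n) ^ p < e ^ p"
        using tailT[of i j "{n}"] k[of i] by simp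
      then have "norm (T (?u j) n - T (?u i) n) < e"
        by (rule power_less_imp_less_base) (use e in simp)
      then show "dist (T (?u i) n) (T (?u j) n) < e" by (simp add: dist_norm norm_minus_commute)
    qed
  qed
  then have "\<exists>g. \<forall>n. (\<lambda>k. T (?u k) n) \<longlonglongrightarrow> g n"
    by (intro choice allI) (simp add: Cauchy_convergent_iff convergent_def)
  then obtain g where g: "\<And>n. (\<lambda>k. T (?u k) n) \<longlonglongrightarrow> g n" by blast
  \<comment> \<open>Fatou in disguise: \<open>j\<close> tends to infinity on a finite set
    \<open>N\<close>, with a bound that does not depend on \<open>N\<close>.\<close>
  have gs: "(\<Sum>n\<in>N. norm (T (?u k) n - g n) ^ p) \<le> t k" if "finite N" for N k
  proof (rule tendsto_upperbound)
    show "(\<lambda>j. \<Sum>n\<in>N. norm (T (?u j) n - T (?u k) n) ^ p) \<longlonglongrightarrow> (\<Sum>n\<in>N. norm (T (?u k) n - g n) ^ p)"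
      unfolding norm_minus_commute[of "T (?u k) _"] by (intro tendsto_intros g)
    show "\<forall>\<^sub>F j in sequentially. (\<Sum>n\<in>N. norm (T (?u j) n - T (?u k) n) ^ p) \<le> t k"
      using eventually_ge_at_top[of k] by eventually_elim (rule tailT[OF _ that])
  qed simp
  have gi: "l_integrable p (\<lambda>n. T (?u k) n - g n)" for k
    by (rule integrable_count_if_sums_bounded[of _ "t k"]) (use gs in auto)
  have gb: "l_sum p (\<lambda>n. T (?u k) n - g n) \<le> t k" for k
    by (rule LINT_count_le_if_sums_bounded) (use gs in auto)
  have gL: "l_integrable p g"
  proof (rule l_add(1)[OF int[OF u1[of 0]] gi[of 0]])
    show "norm (g n) \<le> norm (T (?u 0) n) + norm (T (?u 0) n - g n)" for n
      using norm_triangle_ineq4[of "T (?u 0) n" "T (?u 0) n - g n"] by simp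
  qed
  have ex: "?ext g"
    unfolding density_extension_def
  proof (intro conjI allI impI)
    show "g \<in> lp_space (real p)" using gL p by (simp add: Lp_space_nat)
    fix v :: "nat \<Rightarrow> int \<Rightarrow> complex" assume "(\<forall>k. v k \<in> lp_space 1) \<and> Lp_tendsto (count_space UNIV) (real p) v f"
    then have v1: "\<And>k. l_integrable 1 (v k)" and vi: "\<And>k. l_integrable p (\<lambda>n. v k n - f n)"
      and vl: "(\<lambda>k. l_sum p (\<lambda>n. v k n - f n)) \<longlonglongrightarrow> 0"
      using p by (auto simp: lp_space_1 Lp_tendsto_nat)
    \<comment> \<open>An arbitrary approximating sequence \<open>v\<close> is compared with the
      truncations, for which convergence is already known.\<close>
    have tri: "norm (T (v k) n - g n) \<le> norm (T (\<lambda>n. v k n - ?u k n) n) + norm (T (?u k) n - g n)" for k n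
      using norm_triangle_ineq[of "T (v k) n - T (?u k) n" "T (?u k) n - g n"] lin[OF v1 u1] by simp
    have vui: "l_integrable p (T (\<lambda>n. v k n - ?u k n))" for k by (intro int diff1 v1 u1)
    have 1: "l_integrable p (\<lambda>n. T (v k) n - g n)" for k by (rule l_add(1)[OF vui gi tri])
    have 2: "l_sum p (\<lambda>n. T (v k) n - g n) \<le>
       2 ^ p * (A * (2 ^ p * (l_sum p (\<lambda>n. v k n - f n) + ?D k)) + t k)" for k
    proof -
      have "l_sum p (T (\<lambda>n. v k n - ?u k n)) \<le> A * l_sum p (\<lambda>n. v k n - ?u k n)"
        by (intro bound diff1 v1 u1)
      also have "\<dots> \<le> A * (2 ^ p * (l_sum p (\<lambda>n. v k n - f n) + ?D k))"
      proof (intro mult_left_mono A l_add(2)[OF vi truncate_tendsto(1)[OF f p]])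
        show "norm (v k n - ?u k n) \<le> norm (v k n - f n) + norm (?u k n - f n)" for n
          using norm_triangle_ineq4[of "v k n - f n" "?u k n - f n"] by simp
      qed
      finally have "2 ^ p * (l_sum p (T (\<lambda>n. v k n - ?u k n)) + l_sum p (\<lambda>n. T (?u k) n - g n))
         \<le> 2 ^ p * (A * (2 ^ p * (l_sum p (\<lambda>n. v k n - f n) + ?D k)) + t k)"
        by (intro mult_left_mono add_mono gb) auto
      then show ?thesis using l_add(2)[OF vui gi tri, of k] by linarith
    qed
    have "(\<lambda>k. 2 ^ p * (A * (2 ^ p * (l_sum p (\<lambda>n. v k n - f n) + ?D k)) + t k))
        \<longlonglongrightarrow> 2 ^ p * (A * (2 ^ p * (0 + 0)) + 0)"
      by (intro tendsto_intros vl t truncate_tendsto(2)[OF f p])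
    then have "(\<lambda>k. 2 ^ p * (A * (2 ^ p * (l_sum p (\<lambda>n. v k n - f n) + ?D k)) + t k))
        \<longlonglongrightarrow> 0" by simp
    then have "(\<lambda>k. l_sum p (\<lambda>n. T (v k) n - g n)) \<longlonglongrightarrow> 0"
      by (rule Lim_null_comparison[rotated]) (use 2 in simp)
    with 1 show "Lp_tendsto (count_space UNIV) (real p) (\<lambda>k. T (v k)) g"
      using p by (simp add: Lp_tendsto_nat)
  qed
  have "h = g" if "?ext h" for h
  proof -
    have "Lp_tendsto (count_space UNIV) (real p) ?u f"
      using p truncate_tendsto[OF f p] by (simp add: Lp_tendsto_nat)
    with u1 that have "Lp_tendsto (count_space UNIV) (real p) (\<lambda>k. T (?u k)) h"
      unfolding density_extension_def by (auto simp: lp_space_1)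
    then have hi: "\<And>k. l_integrable p (\<lambda>n. T (?u k) n - h n)" and hl: "(\<lambda>k. l_sum p (\<lambda>n. T (?u k) n - h n)) \<longlonglongrightarrow> 0"
      using p by (auto simp: Lp_tendsto_nat)
    have "(\<lambda>k. T (?u k) n) \<longlonglongrightarrow> h n" for n
    proof -
      have "(\<lambda>k. norm (T (?u k) n - h n) ^ p) \<longlonglongrightarrow> 0"
        by (rule Lim_null_comparison[OF _ hl]) (use norm_power_le_l_sum[OF hi] in simp)
      then have "(\<lambda>k. root p (norm (T (?u k) n - h n) ^ p)) \<longlonglongrightarrow> root p 0"
        by (intro tendsto_intros)
      then have "(\<lambda>k. norm (T (?u k) n - h n)) \<longlonglongrightarrow> 0" using p by (simp add: real_root_power_cancel)
      then show ?thesis by (simp add: LIM_zero_iff tendsto_norm_zero_iff)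
    qed
    then show "h = g" using g LIMSEQ_unique by blast
  qed
  with ex show ?thesis by (rule theI)
qed


section \<open>The frequency pieces\<close>

lemma lebesgue_measurable_real_affine:
  "c \<noteq> 0 \<Longrightarrow> (\<lambda>x::real. t + c * x) \<in> lebesgue \<rightarrow>\<^sub>M lebesgue"
  using lebesgue_affine_measurable[where c = "\<lambda>x::real. c"] by simp

text \<open>Stated for \<open>lebesgue\<close> because it will be applied to integrands that contain
  \<open>m\<close>, which need not be Borel measurable.\<close>

lemma lebesgue_integral_real_affine:
  fixes f :: "real \<Rightarrow> complex"
  assumes [measurable]: "f \<in> borel_measurable lebesgue" and c: "c \<noteq> 0"
  shows "(LINT x|lebesgue. f x) = \<bar>c\<bar> *\<^sub>R (LINT x|lebesgue. f (t + c * x))"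
proof -
  note [measurable] = lebesgue_measurable_real_affine[OF c]
  have "(LINT x|lebesgue. f x) = (LINT x|density (distr lebesgue lebesgue (\<lambda>x. t + c * x)) (\<lambda>_. ennreal \<bar>c\<bar>). f x)"
    using lebesgue_real_affine[OF c, of t] by simp
  also have "\<dots> = (LINT x|distr lebesgue lebesgue (\<lambda>x. t + c * x). \<bar>c\<bar> *\<^sub>R f x)"
    by (rule integral_density) auto
  also have "\<dots> = \<bar>c\<bar> *\<^sub>R (LINT x|distr lebesgue lebesgue (\<lambda>x. t + c * x). f x)" by simp
  also have "\<dots> = \<bar>c\<bar> *\<^sub>R (LINT x|lebesgue. f (t + c * x))"
    by (subst integral_distr) auto
  finally show ?thesis .
qed

lemma infsum_eq_LINT:
  fixes f :: "'a \<Rightarrow> complex"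
  shows "integrable (count_space UNIV) f \<Longrightarrow> infsum f UNIV = (LINT n|count_space UNIV. f n)"
  using infsetsum_infsum[of f UNIV] by (simp add: infsetsum_def abs_summable_on_def)

lemma integrable_mult_cis:
  assumes "l_integrable 1 f"
  shows "integrable (count_space UNIV) (\<lambda>n. f n * cis (x n))"
  by (rule integrable_count_bound[OF assms]) (simp add: norm_mult)

lemma fourier_Z_LINT:
  assumes "l_integrable 1 f"
  shows "fourier_Z f \<xi> = (LINT n|count_space UNIV. f n * cis (- 2 * pi * of_int n * \<xi>))"
  unfolding fourier_Z_def by (rule infsum_eq_LINT[OF integrable_mult_cis[OF assms]])

lemma norm_fourier_Z_le: "l_integrable 1 f \<Longrightarrow> norm (fourier_Z f \<xi>) \<le> l_sum 1 f"
  unfolding fourier_Z_LINT by (rule order_trans[OF integral_norm_bound]) (simp add: norm_mult)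

lemma fourier_Z_diff:
  assumes "l_integrable 1 f" "l_integrable 1 g"
  shows "fourier_Z (\<lambda>n. f n - g n) \<xi> = fourier_Z f \<xi> - fourier_Z g \<xi>"
proof -
  have "l_integrable 1 (\<lambda>n. f n - g n)" by (rule l_add(1)[OF assms norm_triangle_ineq4])
  then show ?thesis
    using integrable_mult_cis assms by (simp add: fourier_Z_LINT left_diff_distrib)
qed

lemma borel_measurable_fourier_Z:
  assumes "l_integrable 1 f"
  shows "fourier_Z f \<in> borel_measurable borel"
proof -
  interpret sigma_finite_measure "count_space (UNIV :: int set)"
    by (rule sigma_finite_measure_count_space)
  have "(\<lambda>\<xi>. LINT n|count_space UNIV. f n * cis (- 2 * pi * of_int n * \<xi>)) \<in> borel_measurable borel"
    by measurable
  then show ?thesis by (simp add: fourier_Z_LINT[OF assms, abs_def])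
qed

lemma cis_int_add: "e_char n (\<xi> + of_int l) = e_char n \<xi>"
proof -
  have "e_char n (\<xi> + of_int l) = e_char n \<xi> * cis (2 * pi * of_int (n * l))"
    unfolding cis_mult by (simp add: algebra_simps)
  also have "cis (2 * pi * of_int (n * l)) = 1" by (rule cis_multiple_2pi) simp
  finally show ?thesis by simp
qed

lemma fourier_Z_periodic: "fourier_Z f (\<xi> + of_int l) = fourier_Z f \<xi>"
  unfolding fourier_Z_def
proof (rule infsum_cong)
  fix n
  show "f n * cis (- 2 * pi * of_int n * (\<xi> + of_int l)) = f n * cis (- 2 * pi * of_int n * \<xi>)"
    using cis_int_add[of "- n" \<xi> l] by simp
qed

lemma integrable_lebesgue_bounded_support:
  fixes h :: "real \<Rightarrow> complex"
  assumes "h \<in> borel_measurable lebesgue" "\<And>x. norm (h x) \<le> K" "\<And>x. h x \<noteq> 0 \<Longrightarrow> x \<in> {a..b}"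
  shows "integrable lebesgue h"
proof (rule Bochner_Integration.integrable_bound)
  show "integrable lebesgue (\<lambda>x. K * indicator {a..b} x :: real)"
    by (intro integrable_mult_right integrable_real_indicator) (auto simp: emeasure_lborel_Icc_eq)
  show "AE x in lebesgue. norm (h x) \<le> norm (K * indicator {a..b} x :: real)"
  proof (intro AE_I2)
    fix x
    show "norm (h x) \<le> norm (K * indicator {a..b} x :: real)"
      using assms(2)[of x] assms(3)[of x] by (cases "h x = 0") (auto simp: indicator_def)
  qed
qed (rule assms(1))

text \<open>Unfolding the periodisation: since \<open>fourier_Z f\<close> and
  \<open>e_char n\<close> are 1-periodic, the sum over integer translates integrated over one period
  is the integral of a single bump over the line. The substitution \<alpha> + \<epsilon> \<xi> then
  puts \<open>m\<close> at unit scale, the form that transference needs.\<close>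

lemma freq_piece_l1_eq:
  assumes m: "m \<in> borel_measurable lebesgue" "\<And>x. norm (m x) \<le> Mb" and supp: "{x. m x \<noteq> 0} \<subseteq> {-1/2<..1/2}"
    and \<epsilon>: "0 < \<epsilon>" "\<epsilon> \<le> 1" and f: "l_integrable 1 f"
  shows "freq_piece_l1 m \<epsilon> \<alpha> f n = of_real \<epsilon> * e_char n \<alpha> *
    (LINT \<xi>|lebesgue. m \<xi> * fourier_Z f (\<alpha> + \<epsilon> * \<xi>) * cis (2 * pi * (\<epsilon> * of_int n) * \<xi>))"
proof -
  note [measurable] = m(1) borel_measurable_fourier_Z[OF f]
  have [measurable]: "(\<lambda>x. x) \<in> borel_measurable (lebesgue :: real measure)" by (auto intro: measurable_completion)
  let ?m = "\<lambda>\<xi> (l::int). m (inverse \<epsilon> * (\<xi> - of_int l - \<alpha>))"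
  define h where "h \<xi> = m (inverse \<epsilon> * (\<xi> - \<alpha>)) * fourier_Z f \<xi> * e_char n \<xi>" for \<xi>
  have "(\<lambda>\<xi>. - inverse \<epsilon> * \<alpha> + inverse \<epsilon> * \<xi>) \<in> lebesgue \<rightarrow>\<^sub>M lebesgue"
    using \<epsilon> by (intro lebesgue_measurable_real_affine) simp
  then have [measurable]: "(\<lambda>\<xi>. inverse \<epsilon> * (\<xi> - \<alpha>)) \<in> lebesgue \<rightarrow>\<^sub>M lebesgue"
    by (simp add: algebra_simps)
  have hm [measurable]: "h \<in> borel_measurable lebesgue"
    unfolding h_def by measurable
  have msupp: "\<bar>y\<bar> \<le> \<epsilon> / 2" if "m (inverse \<epsilon> * y) \<noteq> 0" for y
  proof -
    have "\<bar>inverse \<epsilon> * y\<bar> \<le> 1 / 2" using subsetD[OF supp, of "inverse \<epsilon> * y"] that by (auto simp: abs_le_iff)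
    then show ?thesis using \<epsilon> by (simp add: abs_mult field_simps)
  qed
  have hb: "norm (h \<xi>) \<le> Mb * l_sum 1 f" for \<xi>
    unfolding h_def norm_mult norm_cis mult_1_right
    using m(2) norm_fourier_Z_le[OF f] order_trans[OF norm_ge_zero m(2)] by (intro mult_mono) auto
  \<comment> \<open>Only finitely many translates meet the period: 0 <= \<xi> < 1 and |\<xi> - l -
    \<alpha>| <= 1/2 force |l| <= |\<alpha>| + 2.\<close>
  define k where "k = \<lceil>\<bar>\<alpha>\<bar>\<rceil> + 2"
  define K where "K = {- k..k}"
  have finK: "finite K" by (simp add: K_def)
  have inK: "l \<in> K" if "\<bar>\<xi> - of_int l - \<alpha>\<bar> \<le> \<epsilon> / 2" "0 \<le> \<xi>" "\<xi> < 1" for \<xi> l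
  proof -
    have "\<bar>of_int l\<bar> \<le> \<bar>\<alpha>\<bar> + 2" using that \<epsilon> by linarith
    also have "\<bar>\<alpha>\<bar> \<le> of_int \<lceil>\<bar>\<alpha>\<bar>\<rceil>" by (rule le_of_int_ceiling)
    finally have "\<bar>real_of_int l\<bar> \<le> of_int k" by (simp add: k_def)
    then show ?thesis by (auto simp: K_def abs_le_iff)
  qed
  have hi: "integrable lebesgue (\<lambda>\<xi>. indicator {0..<1} (\<xi> + of_int l) *\<^sub>R h \<xi>)" for l :: int
  proof (rule integrable_lebesgue_bounded_support)
    show "(\<lambda>\<xi>. indicator {0..<1} (\<xi> + of_int l) *\<^sub>R h \<xi>) \<in> borel_measurable lebesgue" by measurable
    show "norm (indicator {0..<1} (\<xi> + of_int l) *\<^sub>R h \<xi>) \<le> Mb * l_sum 1 f" for \<xi>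
      using hb[of \<xi>] order_trans[OF norm_ge_zero hb[of \<xi>]] by (auto simp: indicator_def)
    show "\<xi> \<in> {- of_int l..1 - of_int l}" if "indicator {0..<1} (\<xi> + of_int l) *\<^sub>R h \<xi> \<noteq> 0" for \<xi>
      using that by (auto simp: indicator_def split: if_splits)
  qed
  have "freq_piece_l1 m \<epsilon> \<alpha> f n = (LINT \<xi>|lebesgue. (\<Sum>l\<in>K. indicator {0..<1} \<xi> *\<^sub>R h (- of_int l + 1 * \<xi>)))"
    unfolding freq_piece_l1_def set_lebesgue_integral_def
  proof (rule Bochner_Integration.integral_cong)
    fix \<xi> :: real
    have "(\<Sum>\<^sub>\<infinity>l::int. ?m \<xi> l) = (\<Sum>l\<in>K. ?m \<xi> l)"
      if "0 \<le> \<xi>" "\<xi> < 1"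
    proof -
      have "(\<Sum>\<^sub>\<infinity>l::int. ?m \<xi> l) = (\<Sum>\<^sub>\<infinity>l\<in>K. ?m \<xi> l)"
        using msupp inK that by (intro infsum_cong_neutral) blast+
      then show ?thesis using finK by simp
    qed
    moreover have "h (- of_int l + 1 * \<xi>) = ?m \<xi> l * (fourier_Z f \<xi> * e_char n \<xi>)" for l
      using fourier_Z_periodic[of f \<xi> "- l"] cis_int_add[of n \<xi> "- l"]
      by (simp add: h_def mult.assoc add.commute)
    ultimately show "indicator {0..<1} \<xi> *\<^sub>R ((\<Sum>\<^sub>\<infinity>l::int. ?m \<xi> l) * fourier_Z f \<xi> * e_char n \<xi>)
        = (\<Sum>l\<in>K. indicator {0..<1} \<xi> *\<^sub>R h (- of_int l + 1 * \<xi>))"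
      by (auto simp: indicator_def mult.assoc sum_distrib_right)
  qed simp
  also have "\<dots> = (\<Sum>l\<in>K. LINT \<xi>|lebesgue. indicator {0..<1} \<xi> *\<^sub>R h (- of_int l + 1 * \<xi>))"
  proof (rule Bochner_Integration.integral_sum)
    fix l :: int
    have [measurable]: "(\<lambda>\<xi>. - of_int l + 1 * \<xi>) \<in> lebesgue \<rightarrow>\<^sub>M (lebesgue :: real measure)"
      by (intro lebesgue_measurable_real_affine) simp
    show "integrable lebesgue (\<lambda>\<xi>. indicator {0..<1} \<xi> *\<^sub>R h (- of_int l + 1 * \<xi>))"
    proof (rule integrable_lebesgue_bounded_support)
      show "(\<lambda>\<xi>. indicator {0..<1} \<xi> *\<^sub>R h (- of_int l + 1 * \<xi>)) \<in> borel_measurable lebesgue" by measurable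
      show "norm (indicator {0..<1} \<xi> *\<^sub>R h (- of_int l + 1 * \<xi>)) \<le> Mb * l_sum 1 f" for \<xi>
        using hb[of "- of_int l + 1 * \<xi>"] order_trans[OF norm_ge_zero hb] by (auto simp: indicator_def)
      show "\<xi> \<in> {0..1}" if "indicator {0..<1} \<xi> *\<^sub>R h (- of_int l + 1 * \<xi>) \<noteq> 0" for \<xi>
        using that by (auto simp: indicator_def split: if_splits)
    qed
  qed
  also have "\<dots> = (\<Sum>l\<in>K. LINT \<xi>|lebesgue. indicator {0..<1} (\<xi> + of_int l) *\<^sub>R h \<xi>)"
  proof (rule sum.cong)
    fix l
    show "(LINT \<xi>|lebesgue. indicator {0..<1} \<xi> *\<^sub>R h (- of_int l + 1 * \<xi>)) = (LINT \<xi>|lebesgue. indicator {0..<1} (\<xi> + of_int l) *\<^sub>R h \<xi>)"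
      using lebesgue_integral_real_affine[OF borel_measurable_integrable[OF hi[of l]], of 1 "- of_int l"] by simp
  qed simp
  also have "\<dots> = (LINT \<xi>|lebesgue. (\<Sum>l\<in>K. indicator {0..<1} (\<xi> + of_int l) *\<^sub>R h \<xi>))"
    by (rule Bochner_Integration.integral_sum[symmetric]) (rule hi)
  also have "\<dots> = (LINT \<xi>|lebesgue. h \<xi>)"
  proof (rule Bochner_Integration.integral_cong)
    fix \<xi>
    show "(\<Sum>l\<in>K. indicator {0..<1} (\<xi> + of_int l) *\<^sub>R h \<xi>) = h \<xi>"
    proof (cases "h \<xi> = 0")
      case False
      then have nz: "m (inverse \<epsilon> * (\<xi> - \<alpha>)) \<noteq> 0" by (auto simp: h_def)
      \<comment> \<open>The translates of [0, 1) tile the line, so exactly one \<open>l\<close>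
        contributes, and it lies in \<open>K\<close> because \<open>h \<xi>\<close> is
        nonzero.\<close>
      let ?l = "- \<lfloor>\<xi>\<rfloor>"
      have f: "0 \<le> \<xi> + of_int ?l" "\<xi> + of_int ?l < 1" by simp_all linarith+
      have "?l \<in> K" using inK[of "\<xi> + of_int ?l" ?l] msupp[OF nz] f by simp
      moreover have "indicator {0..<1} (\<xi> + of_int l) = (if l = ?l then 1 else 0 :: real)" for l
        by (auto simp: indicator_def) linarith+
      ultimately show ?thesis using finK by (simp add: if_distrib[of "\<lambda>x. x *\<^sub>R _"] cong: if_cong)
    qed simp
  qed simp
  also have "\<dots> = \<bar>\<epsilon>\<bar> *\<^sub>R (LINT \<xi>|lebesgue. h (\<alpha> + \<epsilon> * \<xi>))"
    by (rule lebesgue_integral_real_affine[OF hm]) (use \<epsilon> in simp)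
  also have "(LINT \<xi>|lebesgue. h (\<alpha> + \<epsilon> * \<xi>)) = (LINT \<xi>|lebesgue. e_char n \<alpha> *
      (m \<xi> * fourier_Z f (\<alpha> + \<epsilon> * \<xi>) * cis (2 * pi * (\<epsilon> * of_int n) * \<xi>)))"
  proof (rule Bochner_Integration.integral_cong)
    fix \<xi>
    have e: "e_char n (\<alpha> + \<epsilon> * \<xi>) = e_char n \<alpha> * cis (2 * pi * (\<epsilon> * of_int n) * \<xi>)"
      unfolding cis_mult by (simp add: algebra_simps)
    have "inverse \<epsilon> * (\<alpha> + \<epsilon> * \<xi> - \<alpha>) = \<xi>" using \<epsilon> by simp
    then show "h (\<alpha> + \<epsilon> * \<xi>) = e_char n \<alpha> *
      (m \<xi> * fourier_Z f (\<alpha> + \<epsilon> * \<xi>) * cis (2 * pi * (\<epsilon> * of_int n) * \<xi>))"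
      unfolding h_def e by (simp only: mult_ac)
  qed simp
  also have "\<dots> = e_char n \<alpha> * (LINT \<xi>|lebesgue.
      m \<xi> * fourier_Z f (\<alpha> + \<epsilon> * \<xi>) * cis (2 * pi * (\<epsilon> * of_int n) * \<xi>))"
    by (rule integral_mult_right_zero)
  finally show ?thesis using \<epsilon> by (simp add: scaleR_conv_of_real mult.assoc)
qed


lemma integrable_piece:
  assumes m: "m \<in> borel_measurable lebesgue" "\<And>x. norm (m x) \<le> Mb" and supp: "{x. m x \<noteq> 0} \<subseteq> {-1/2<..1/2}"
    and f: "l_integrable 1 f"
  shows "integrable lebesgue (\<lambda>\<xi>. m \<xi> * fourier_Z f (\<alpha> + \<epsilon> * \<xi>) * cis (x * \<xi>))"
proof -
  note [measurable] = m(1) borel_measurable_fourier_Z[OF f]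
  have [measurable]: "(\<lambda>x. x) \<in> borel_measurable (lebesgue :: real measure)" by (auto intro: measurable_completion)
  show ?thesis
  proof (rule integrable_lebesgue_bounded_support)
    show "norm (m \<xi> * fourier_Z f (\<alpha> + \<epsilon> * \<xi>) * cis (x * \<xi>)) \<le> Mb * l_sum 1 f" for \<xi>
      unfolding norm_mult norm_cis mult_1_right
      using m(2) norm_fourier_Z_le[OF f] order_trans[OF norm_ge_zero m(2)] by (intro mult_mono) auto
    show "\<xi> \<in> {-1/2..1/2}" if "m \<xi> * fourier_Z f (\<alpha> + \<epsilon> * \<xi>) * cis (x * \<xi>) \<noteq> 0" for \<xi>
      using subsetD[OF supp, of \<xi>] that by auto
  qed measurable
qed

lemma freq_piece_l1_diff:
  assumes m: "m \<in> borel_measurable lebesgue" "\<And>x. norm (m x) \<le> Mb" and supp: "{x. m x \<noteq> 0} \<subseteq> {-1/2<..1/2}"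
    and \<epsilon>: "0 < \<epsilon>" "\<epsilon> \<le> 1" and f: "l_integrable 1 f" and g: "l_integrable 1 g"
  shows "freq_piece_l1 m \<epsilon> \<alpha> (\<lambda>n. f n - g n) n = freq_piece_l1 m \<epsilon> \<alpha> f n - freq_piece_l1 m \<epsilon> \<alpha> g n"
proof -
  have fg: "l_integrable 1 (\<lambda>n. f n - g n)" by (rule l_add(1)[OF f g norm_triangle_ineq4])
  note eq = freq_piece_l1_eq[OF m supp \<epsilon>]
  note int = integrable_piece[OF m supp]
  show ?thesis
    unfolding eq[OF f] eq[OF g] eq[OF fg] fourier_Z_diff[OF f g]
    using Bochner_Integration.integral_diff[OF int[OF f] int[OF g], of \<alpha> \<epsilon> "2 * pi * (\<epsilon> * of_int n)" \<alpha> \<epsilon> "2 * pi * (\<epsilon> * of_int n)"]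
    by (simp add: left_diff_distrib right_diff_distrib)
qed

text \<open>Exchanging sum and integral leaves the trigonometric polynomial integrated against
  \<open>m\<close> and \<open>fourier_Z f\<close> over an interval of length 1. This yields the
  spectral support of a piece and, with a single coefficient, its uniform bound by the l^1 norm of
  \<open>f\<close>.\<close>

lemma norm_freq_piece_l1_le:
  assumes m: "m \<in> borel_measurable lebesgue" "\<And>x. norm (m x) \<le> Mb" and supp: "{x. m x \<noteq> 0} \<subseteq> {-1/2<..1/2}"
    and \<epsilon>: "0 < \<epsilon>" "\<epsilon> \<le> 1" and f: "l_integrable 1 f"
    and b: "\<And>\<xi>. \<bar>\<xi>\<bar> \<le> 1 / 2 \<Longrightarrow> norm (\<Sum>n\<in>A. w n * e_char n (\<alpha> + \<epsilon> * \<xi>)) \<le> M" and M: "0 \<le> M"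
  shows "norm (\<Sum>n\<in>A. w n * freq_piece_l1 m \<epsilon> \<alpha> f n) \<le> (Mb * l_sum 1 f) * M"
proof -
  note eq = freq_piece_l1_eq[OF m supp \<epsilon> f]
  let ?I = "\<lambda>n \<xi>. m \<xi> * fourier_Z f (\<alpha> + \<epsilon> * \<xi>) * cis (2 * pi * (\<epsilon> * of_int n) * \<xi>)"
  have int: "integrable lebesgue (?I n)" for n by (rule integrable_piece[OF m supp f])
  let ?w = "\<lambda>n \<xi>. (w n * e_char n \<alpha>) * ?I n \<xi>"
  have Mb0: "0 \<le> Mb" using order_trans[OF norm_ge_zero m(2)] .
  let ?S = "\<lambda>\<xi>. \<Sum>n\<in>A. ?w n \<xi>"
  have "(\<Sum>n\<in>A. w n * freq_piece_l1 m \<epsilon> \<alpha> f n)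
      = of_real \<epsilon> * (\<Sum>n\<in>A. LINT \<xi>|lebesgue. ?w n \<xi>)"
    unfolding eq integral_mult_right_zero sum_distrib_left by (simp only: mult_ac)
  moreover have "(\<Sum>n\<in>A. LINT \<xi>|lebesgue. ?w n \<xi>) = (LINT \<xi>|lebesgue. ?S \<xi>)"
    by (rule Bochner_Integration.integral_sum[symmetric]) (rule integrable_mult_right[OF int])
  ultimately have "norm (\<Sum>n\<in>A. w n * freq_piece_l1 m \<epsilon> \<alpha> f n) = \<epsilon> * norm (LINT \<xi>|lebesgue. ?S \<xi>)"
    using \<epsilon> by (simp only: norm_mult) simp
  also have "\<dots> \<le> norm (LINT \<xi>|lebesgue. ?S \<xi>)"
    using \<epsilon> by (intro mult_left_le_one_le) auto
  also have "\<dots> \<le> (LINT \<xi>|lebesgue. norm (?S \<xi>))" by (rule integral_norm_bound)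
  also have "\<dots> \<le> (LINT \<xi>::real|lebesgue. Mb * l_sum 1 f * M * indicator {-1/2..1/2} \<xi>)"
  proof (rule integral_mono)
    show "integrable lebesgue (\<lambda>\<xi>. norm (\<Sum>n\<in>A. ?w n \<xi>))"
      by (intro integrable_norm Bochner_Integration.integrable_sum integrable_mult_right int)
    show "integrable lebesgue (\<lambda>\<xi>::real. Mb * l_sum 1 f * M * indicator {-1/2..1/2} \<xi>)"
      by (intro integrable_mult_right integrable_real_indicator) auto
    fix \<xi> :: real
    have "(\<Sum>n\<in>A. ?w n \<xi>)
        = (m \<xi> * fourier_Z f (\<alpha> + \<epsilon> * \<xi>)) * (\<Sum>n\<in>A. w n * e_char n (\<alpha> + \<epsilon> * \<xi>))"
      unfolding sum_distrib_left
    proof (rule sum.cong)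
      fix n
      have e: "e_char n (\<alpha> + \<epsilon> * \<xi>) = e_char n \<alpha> * cis (2 * pi * (\<epsilon> * of_int n) * \<xi>)"
        unfolding cis_mult by (simp add: algebra_simps)
      show "?w n \<xi> = m \<xi> * fourier_Z f (\<alpha> + \<epsilon> * \<xi>) * (w n * e_char n (\<alpha> + \<epsilon> * \<xi>))"
        unfolding e by (simp only: mult_ac)
    qed simp
    also have "norm \<dots> \<le> Mb * l_sum 1 f * M * indicator {-1/2..1/2} \<xi>"
    proof (cases "m \<xi> = 0")
      case True
      then show ?thesis using Mb0 M by simp
    next
      case False
      then have x: "\<xi> \<in> {-1/2<..1/2}" using supp by blast
      then have "norm (\<Sum>n\<in>A. w n * e_char n (\<alpha> + \<epsilon> * \<xi>)) \<le> M" by (intro b) auto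
      then have "norm (m \<xi> * fourier_Z f (\<alpha> + \<epsilon> * \<xi>) * (\<Sum>n\<in>A. w n * e_char n (\<alpha> + \<epsilon> * \<xi>))) \<le> Mb * l_sum 1 f * M"
        unfolding norm_mult using m(2) norm_fourier_Z_le[OF f] Mb0 M by (intro mult_mono mult_nonneg_nonneg) auto
      then show ?thesis using x by (auto simp: indicator_def)
    qed
    finally show "norm (\<Sum>n\<in>A. ?w n \<xi>) \<le> Mb * l_sum 1 f * M * indicator {-1/2..1/2} \<xi>" .
  qed
  also have "\<dots> = (Mb * l_sum 1 f) * M" by simp
  finally show ?thesis .
qed

lemma spectrum_in_freq_piece_l1:
  assumes m: "m \<in> borel_measurable lebesgue" "\<And>x. norm (m x) \<le> Mb" and supp: "{x. m x \<noteq> 0} \<subseteq> {-1/2<..1/2}"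
    and \<epsilon>: "0 < \<epsilon>" "\<epsilon> \<le> 1" and f: "l_integrable 1 f"
  shows "spectrum_in {\<xi>. \<bar>\<xi> - \<alpha>\<bar> \<le> \<epsilon> / 2} (freq_piece_l1 m \<epsilon> \<alpha> f)"
proof (rule spectrum_inI)
  show "0 \<le> Mb * l_sum 1 f" using order_trans[OF norm_ge_zero m(2)] by simp
  fix A :: "int set" and w and M :: real
  assume M: "0 \<le> M" and w: "\<And>\<xi>. \<xi> \<in> {\<xi>. \<bar>\<xi> - \<alpha>\<bar> \<le> \<epsilon> / 2} \<Longrightarrow> norm (\<Sum>n\<in>A. w n * e_char n \<xi>) \<le> M"
  show "norm (\<Sum>n\<in>A. w n * freq_piece_l1 m \<epsilon> \<alpha> f n) \<le> (Mb * l_sum 1 f) * M"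
  proof (rule norm_freq_piece_l1_le[OF m supp \<epsilon> f w M])
    fix \<xi> :: real assume "\<bar>\<xi>\<bar> \<le> 1 / 2"
    then have "\<epsilon> * \<bar>\<xi>\<bar> \<le> \<epsilon> * (1 / 2)" using \<epsilon> by (intro mult_left_mono) auto
    then show "\<alpha> + \<epsilon> * \<xi> \<in> {\<xi>. \<bar>\<xi> - \<alpha>\<bar> \<le> \<epsilon> / 2}" using \<epsilon> by (simp add: abs_mult)
  qed
qed

text \<open>For finitely supported \<open>u\<close> the piece is, up to a factor of modulus at most
  1, the sampled operator of \<open>transference_finite\<close>; truncation extends the bound to all
  summable \<open>u\<close>. It may depend on \<epsilon>, but one \<open>A\<close> serves every
  \<alpha>.\<close>

lemma freq_piece_l1_bounded:
  fixes p :: nat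
  assumes mult: "Lp_multiplier (real p) m" and p: "p > 0" and supp: "{x. m x \<noteq> 0} \<subseteq> {-1/2<..1/2}"
    and \<epsilon>: "0 < \<epsilon>" "\<epsilon> \<le> 1"
  obtains A where "0 \<le> A" "\<And>\<alpha> u. l_integrable 1 u \<Longrightarrow> l_integrable p (freq_piece_l1 m \<epsilon> \<alpha> u)"
    "\<And>\<alpha> u. l_integrable 1 u \<Longrightarrow> l_sum p (freq_piece_l1 m \<epsilon> \<alpha> u) \<le> A * l_sum p u"
proof -
  obtain B where B: "Lp_multiplier_of_norm (real p) m B" using mult by (auto simp: Lp_multiplier_def)
  have m1: "m \<in> borel_measurable lebesgue" using B by (simp add: Lp_multiplier_of_norm_def)
  obtain Mb where m2: "\<And>\<xi>. norm (m \<xi>) \<le> Mb"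
    using B by (auto simp: Lp_multiplier_of_norm_def bounded_iff)
  note m = m1 m2
  let ?T = "freq_piece_l1 m \<epsilon>"
  obtain A where A: "0 \<le> A" "\<And>K c N. finite K \<Longrightarrow> finite N \<Longrightarrow>
    (\<Sum>n\<in>N. norm (LINT \<xi>|lebesgue. m \<xi> * (\<Sum>k\<in>K. c k * cis (- 2 * pi * (\<epsilon> * real_of_int k) * \<xi>))
        * cis (2 * pi * (\<epsilon> * real_of_int n) * \<xi>)) ^ p)
      \<le> A * (\<Sum>k\<in>K. norm (c k) ^ p)"
    using transference_finite[OF mult p supp \<epsilon>] by blast
  have fin: "(\<Sum>n\<in>N. norm (?T \<alpha> u n) ^ p) \<le> A * l_sum p u"
    if u: "l_integrable 1 u" and N: "finite N" for u \<alpha> N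
  proof (rule tendsto_upperbound)
    let ?u = "\<lambda>k. truncate k u"
    have u1: "l_integrable 1 (?u k)" for k by (rule l_integrable_truncate) simp
    have up: "l_integrable p u" by (rule l_integrable_1_imp[OF u p])
    have "(\<lambda>k. ?T \<alpha> (?u k) n) \<longlonglongrightarrow> ?T \<alpha> u n" for n
    proof -
      have 1: "norm (?T \<alpha> (?u k) n - ?T \<alpha> u n) \<le> Mb * l_sum 1 (\<lambda>n. ?u k n - u n)" for k
        using norm_freq_piece_l1_le[OF m supp \<epsilon> truncate_tendsto(1)[OF u], where A = "{n}" and w = "\<lambda>_. 1" and M = 1]
        unfolding freq_piece_l1_diff[OF m supp \<epsilon> u1 u, symmetric] by simp
      have "(\<lambda>k. Mb * l_sum 1 (\<lambda>n. ?u k n - u n)) \<longlonglongrightarrow> Mb * 0"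
        by (intro tendsto_intros truncate_tendsto(2)[OF u]) simp
      then have 2: "(\<lambda>k. Mb * l_sum 1 (\<lambda>n. ?u k n - u n)) \<longlonglongrightarrow> 0" by (simp only: mult_zero_right)
      have "(\<lambda>k. ?T \<alpha> (?u k) n - ?T \<alpha> u n) \<longlonglongrightarrow> 0"
        by (rule Lim_null_comparison[OF always_eventually[OF allI[OF 1]] 2])
      then show ?thesis by (simp add: LIM_zero_iff)
    qed
    then show "(\<lambda>k. \<Sum>n\<in>N. norm (?T \<alpha> (?u k) n) ^ p) \<longlonglongrightarrow> (\<Sum>n\<in>N. norm (?T \<alpha> u n) ^ p)"
      by (intro tendsto_intros)
    have "(\<Sum>n\<in>N. norm (?T \<alpha> (?u k) n) ^ p) \<le> A * l_sum p u" for k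
    proof -
      let ?K = "{- int k..int k}"
      \<comment> \<open>The modulation by \<alpha> is hidden in the coefficients without changing
        their moduli, hence the uniformity in \<alpha>.\<close>
      let ?c = "\<lambda>j. u j * cis (- 2 * pi * of_int j * \<alpha>)"
      have FZ: "fourier_Z (?u k) (\<alpha> + \<epsilon> * \<xi>) = (\<Sum>j\<in>?K. ?c j * cis (- 2 * pi * (\<epsilon> * real_of_int j) * \<xi>))" for \<xi>
      proof -
        have "fourier_Z (?u k) (\<alpha> + \<epsilon> * \<xi>) = (\<Sum>\<^sub>\<infinity>j\<in>?K. u j * cis (- 2 * pi * of_int j * (\<alpha> + \<epsilon> * \<xi>)))"
          unfolding fourier_Z_def by (rule infsum_cong_neutral) (auto simp: truncate_def)
        also have "\<dots> = (\<Sum>j\<in>?K. u j * cis (- 2 * pi * of_int j * (\<alpha> + \<epsilon> * \<xi>)))" by simp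
        also have "\<dots> = (\<Sum>j\<in>?K. ?c j * cis (- 2 * pi * (\<epsilon> * real_of_int j) * \<xi>))"
        proof (rule sum.cong)
          fix j
          have "cis (- 2 * pi * of_int j * (\<alpha> + \<epsilon> * \<xi>)) = cis (- 2 * pi * of_int j * \<alpha>) * cis (- 2 * pi * (\<epsilon> * real_of_int j) * \<xi>)"
            unfolding cis_mult by (simp add: algebra_simps)
          then show "u j * cis (- 2 * pi * of_int j * (\<alpha> + \<epsilon> * \<xi>)) = ?c j * cis (- 2 * pi * (\<epsilon> * real_of_int j) * \<xi>)"
            by (simp only: mult.assoc)
        qed simp
        finally show ?thesis .
      qed
      have "(\<Sum>n\<in>N. norm (?T \<alpha> (?u k) n) ^ p)
          \<le> (\<Sum>n\<in>N. norm (LINT \<xi>|lebesgue. m \<xi> * fourier_Z (?u k) (\<alpha> + \<epsilon> * \<xi>) * cis (2 * pi * (\<epsilon> * real_of_int n) * \<xi>)) ^ p)"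
      proof (intro sum_mono power_mono norm_ge_zero)
        fix n
        show "norm (?T \<alpha> (?u k) n)
          \<le> norm (LINT \<xi>|lebesgue. m \<xi> * fourier_Z (?u k) (\<alpha> + \<epsilon> * \<xi>) * cis (2 * pi * (\<epsilon> * real_of_int n) * \<xi>))"
          unfolding freq_piece_l1_eq[OF m supp \<epsilon> u1] norm_mult norm_cis mult_1_right
          using \<epsilon> by (intro mult_left_le_one_le) auto
      qed
      also have "\<dots> \<le> A * (\<Sum>j\<in>?K. norm (?c j) ^ p)"
        unfolding FZ by (rule A(2)) (use N in auto)
      also have "\<dots> \<le> A * l_sum p u"
        using sum_le_LINT_count[OF up, of ?K] by (intro mult_left_mono A(1)) (simp add: norm_mult)
      finally show ?thesis .
    qed
    then show "\<forall>\<^sub>F k in sequentially. (\<Sum>n\<in>N. norm (?T \<alpha> (?u k) n) ^ p) \<le> A * l_sum p u"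
      by simp
  qed simp
  show thesis
  proof (rule that[OF A(1)])
    fix \<alpha> u assume u: "l_integrable 1 u"
    show "l_integrable p (?T \<alpha> u)"
      by (rule integrable_count_if_sums_bounded[of _ "A * l_sum p u"]) (use fin[OF u] in auto)
    show "l_sum p (?T \<alpha> u) \<le> A * l_sum p u"
      by (rule LINT_count_le_if_sums_bounded) (use fin[OF u] in auto)
  qed
qed

text \<open>The extension exists and is unique, so the description operator in
  \<open>freq_piece\<close> is meaningful; the truncations give a concrete approximation by pieces
  whose spectra are known.\<close>

lemma freq_piece_tendsto:
  fixes p :: nat
  assumes mult: "Lp_multiplier (real p) m" and p: "p > 0" and supp: "{x. m x \<noteq> 0} \<subseteq> {-1/2<..1/2}"
    and \<epsilon>: "0 < \<epsilon>" "\<epsilon> \<le> 1" and f: "l_integrable p f"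
  shows "l_integrable p (freq_piece (real p) m \<epsilon> \<alpha> f)"
    and "l_integrable p (\<lambda>n. freq_piece_l1 m \<epsilon> \<alpha> (truncate k f) n - freq_piece (real p) m \<epsilon> \<alpha> f n)"
    and "(\<lambda>k. l_sum p (\<lambda>n. freq_piece_l1 m \<epsilon> \<alpha> (truncate k f) n - freq_piece (real p) m \<epsilon> \<alpha> f n)) \<longlonglongrightarrow> 0"
proof -
  obtain B where B: "Lp_multiplier_of_norm (real p) m B" using mult by (auto simp: Lp_multiplier_def)
  have m1: "m \<in> borel_measurable lebesgue" using B by (simp add: Lp_multiplier_of_norm_def)
  obtain Mb where m2: "\<And>\<xi>. norm (m \<xi>) \<le> Mb"
    using B by (auto simp: Lp_multiplier_of_norm_def bounded_iff)
  obtain A where A: "0 \<le> A" "\<And>\<alpha> u. l_integrable 1 u \<Longrightarrow> l_integrable p (freq_piece_l1 m \<epsilon> \<alpha> u)"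
    "\<And>\<alpha> u. l_integrable 1 u \<Longrightarrow> l_sum p (freq_piece_l1 m \<epsilon> \<alpha> u) \<le> A * l_sum p u"
    using freq_piece_l1_bounded[OF mult p supp \<epsilon>] by blast
  have ext: "density_extension (count_space UNIV) (real p) (lp_space 1) (freq_piece_l1 m \<epsilon> \<alpha>) f (freq_piece (real p) m \<epsilon> \<alpha> f)"
    unfolding freq_piece_def
    by (rule density_extension_count[OF p A(1) freq_piece_l1_diff[OF m1 m2 supp \<epsilon>] A(2) A(3) f])
  then show "l_integrable p (freq_piece (real p) m \<epsilon> \<alpha> f)"
    using p by (simp add: density_extension_def Lp_space_nat)
  have "Lp_tendsto (count_space UNIV) (real p) (\<lambda>k. truncate k f) f"
    using p truncate_tendsto[OF f p] by (simp add: Lp_tendsto_nat)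
  moreover have "l_integrable 1 (truncate k f)" for k by (rule l_integrable_truncate) simp
  ultimately have "Lp_tendsto (count_space UNIV) (real p) (\<lambda>k. freq_piece_l1 m \<epsilon> \<alpha> (truncate k f)) (freq_piece (real p) m \<epsilon> \<alpha> f)"
    using ext unfolding density_extension_def by (auto simp: lp_space_1)
  then show "l_integrable p (\<lambda>n. freq_piece_l1 m \<epsilon> \<alpha> (truncate k f) n - freq_piece (real p) m \<epsilon> \<alpha> f n)"
    and "(\<lambda>k. l_sum p (\<lambda>n. freq_piece_l1 m \<epsilon> \<alpha> (truncate k f) n - freq_piece (real p) m \<epsilon> \<alpha> f n)) \<longlonglongrightarrow> 0"
    using p by (auto simp: Lp_tendsto_nat)
qed


section \<open>Superorthogonality\<close>

lemma reduced_fractions_UN: "reduced_fractions Z = (\<Union>q\<in>Z. reduced_fractions {q})"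
  by (auto simp: reduced_fractions_def)

lemma finite_reduced_fractions_singleton: "finite (reduced_fractions {q})"
proof (rule finite_subset)
  show "reduced_fractions {q} \<subseteq> (\<lambda>a. real a / real q) ` {1..q}" by (auto simp: reduced_fractions_def)
qed simp

lemma finite_reduced_fractions: "finite Z \<Longrightarrow> finite (reduced_fractions Z)"
  by (subst reduced_fractions_UN) (simp add: finite_reduced_fractions_singleton)

lemma reduced_fractions_disjoint:
  assumes "q \<noteq> q'" "q > 0" "q' > 0"
  shows "reduced_fractions {q} \<inter> reduced_fractions {q'} = {}"
proof (rule ccontr)
  assume "reduced_fractions {q} \<inter> reduced_fractions {q'} \<noteq> {}"
  then obtain a a' where a: "coprime a q" "coprime a' q'" "real a / real q = real a' / real q'"
    by (auto simp: reduced_fractions_def)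
  then have "real (a * q') = real (a' * q)" using assms by (simp add: field_simps)
  then have e: "a * q' = a' * q" by (simp only: of_nat_eq_iff)
  then have "q dvd a * q'" "q' dvd a' * q" by simp_all (metis dvd_triv_right e)
  then have "q dvd q'" "q' dvd q"
    using a by (simp_all add: coprime_commute coprime_dvd_mult_right_iff)
  then show False using assms(1) by (simp add: dvd_antisym)
qed

lemma sum_reduced_fractions:
  fixes f :: "real \<Rightarrow> 'b::comm_monoid_add"
  assumes "finite Z" "\<And>q. q \<in> Z \<Longrightarrow> 0 < q"
  shows "(\<Sum>\<alpha>\<in>reduced_fractions Z. f \<alpha>) = (\<Sum>q\<in>Z. \<Sum>\<alpha>\<in>reduced_fractions {q}. f \<alpha>)"
  unfolding reduced_fractions_UN[of Z]
  using assms reduced_fractions_disjoint finite_reduced_fractions_singleton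
  by (intro sum.UNION_disjoint) auto

text \<open>\<open>near_coprime Q \<epsilon> q j\<close> contains the spectrum of a product of \<open>j\<close> of the given functions with
  denominators coprime to \<open>q\<close>, and \<open>near_multiples \<epsilon> q i\<close> the spectrum of a product of \<open>i\<close> functions
  with denominator \<open>q\<close> whose frequencies do not cancel.\<close>

definition near_coprime :: "real \<Rightarrow> real \<Rightarrow> nat \<Rightarrow> nat \<Rightarrow> real set" where
  "near_coprime Q \<epsilon> q j = {\<xi>. \<exists>(b::int) (P::nat). 0 < P \<and> coprime P q \<and> real P \<le> Q ^ j \<and>
     \<bar>\<xi> - of_int b / real P\<bar> \<le> real j * (\<epsilon> / 2)}"

definition near_multiples :: "real \<Rightarrow> nat \<Rightarrow> nat \<Rightarrow> real set" where
  "near_multiples \<epsilon> q i = {\<xi>. \<exists>a::int. \<not> int q dvd a \<and> \<bar>\<xi> - of_int a / real q\<bar> \<le> real i * (\<epsilon> / 2)}"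

text \<open>Fractions are added over the product of the denominators, which stays coprime to
  \<open>q\<close>; the size bounds multiply and the radii add.\<close>

lemma near_coprime_add:
  assumes "x \<in> near_coprime Q \<epsilon> q i" "y \<in> near_coprime Q \<epsilon> q j"
  shows "x + y \<in> near_coprime Q \<epsilon> q (i + j)"
proof -
  obtain b P where x: "0 < P" "coprime P q" "real P \<le> Q ^ i" "\<bar>x - of_int b / real P\<bar> \<le> real i * (\<epsilon> / 2)"
    using assms(1) by (auto simp: near_coprime_def)
  obtain c R where y: "0 < R" "coprime R q" "real R \<le> Q ^ j" "\<bar>y - of_int c / real R\<bar> \<le> real j * (\<epsilon> / 2)"
    using assms(2) by (auto simp: near_coprime_def)
  show ?thesis
    unfolding near_coprime_def
  proof (intro CollectI exI conjI)
    show "0 < P * R" "coprime (P * R) q" using x y by auto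
    have "real P * real R \<le> Q ^ i * Q ^ j"
      using x y order_trans[OF of_nat_0_le_iff x(3)] by (intro mult_mono) auto
    then show "real (P * R) \<le> Q ^ (i + j)" by (simp add: power_add)
    have "of_int (b * int R + c * int P) / real (P * R) = of_int b / real P + of_int c / real R"
      using x(1) y(1) by (simp add: field_simps)
    then have "x + y - of_int (b * int R + c * int P) / real (P * R) = (x - of_int b / real P) + (y - of_int c / real R)"
      by simp
    also have "\<bar>\<dots>\<bar> \<le> real i * (\<epsilon> / 2) + real j * (\<epsilon> / 2)"
      using x(4) y(4) by linarith
    finally show "\<bar>x + y - of_int (b * int R + c * int P) / real (P * R)\<bar> \<le> real (i + j) * (\<epsilon> / 2)"
      by (simp add: algebra_simps)
  qed
qed

lemma near_coprime_uminus:
  assumes "x \<in> near_coprime Q \<epsilon> q i" shows "- x \<in> near_coprime Q \<epsilon> q i"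
proof -
  obtain b P where x: "0 < P" "coprime P q" "real P \<le> Q ^ i" "\<bar>x - of_int b / real P\<bar> \<le> real i * (\<epsilon> / 2)"
    using assms by (auto simp: near_coprime_def)
  have "- x - of_int (- b) / real P = - (x - of_int b / real P)" by simp
  then have "\<bar>- x - of_int (- b) / real P\<bar> \<le> real i * (\<epsilon> / 2)" using x(4) by (simp only: abs_minus_cancel)
  with x show ?thesis unfolding near_coprime_def by blast
qed

lemma zero_in_near_coprime: "0 \<in> near_coprime Q \<epsilon> q 0"
  unfolding near_coprime_def by (intro CollectI exI[of _ 0] exI[of _ 1]) simp

lemma spectrum_in_near_coprime_power:
  assumes "spectrum_in (near_coprime Q \<epsilon> q j) g"
  shows "spectrum_in (near_coprime Q \<epsilon> q (k * j)) (\<lambda>n. g n ^ k)"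
proof (induction k)
  case 0
  then show ?case using spectrum_in_1[OF zero_in_near_coprime] by simp
next
  case (Suc k)
  then show ?case using spectrum_in_mult[OF assms Suc near_coprime_add] by simp
qed

text \<open>The number a/q + b/P - k equals t/(q P) with an integer \<open>t\<close>. If
  \<open>t\<close> were 0, \<open>q\<close> would divide a P and, being coprime to \<open>P\<close>,
  also \<open>a\<close>. So the distance is at least 1/(q P), where \<open>j < 2 * r\<close> keeps q
  P at most \<open>Q ^ (2 * r)\<close>, and the radii add up to r \<epsilon>. The upper bound on
  \<epsilon> in the theorem is the positivity of the resulting gap.\<close>

lemma near_multiples_add_near_coprime:
  assumes x: "x \<in> near_multiples \<epsilon> q i" and y: "y \<in> near_coprime Q \<epsilon> q j"
    and q: "0 < q" "real q \<le> Q" "1 \<le> Q" and ij: "i + j = 2 * r" "j < 2 * r"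
  shows "1 / Q ^ (2 * r) - real r * \<epsilon> \<le> \<bar>x + y - of_int k\<bar>"
proof -
  obtain a where a: "\<not> int q dvd a" "\<bar>x - of_int a / real q\<bar> \<le> real i * (\<epsilon> / 2)"
    using x by (auto simp: near_multiples_def)
  obtain b P where b: "0 < P" "coprime P q" "real P \<le> Q ^ j" "\<bar>y - of_int b / real P\<bar> \<le> real j * (\<epsilon> / 2)"
    using y by (auto simp: near_coprime_def)
  define t where "t = a * int P + b * int q - k * int q * int P"
  have "t \<noteq> 0"
  proof
    assume "t = 0"
    then have "a * int P = int q * (k * int P - b)" by (simp add: t_def algebra_simps)
    then have "int q dvd a * int P" by simp
    moreover have "coprime (int q) (int P)" using b(2) by (simp add: coprime_commute)
    ultimately show False using a(1) by (simp add: coprime_dvd_mult_left_iff)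
  qed
  then have "1 \<le> \<bar>t\<bar>" by simp
  then have t1: "1 \<le> \<bar>real_of_int t\<bar>" by (simp flip: of_int_abs)
  have qP: "real q * real P \<le> Q ^ (2 * r)"
  proof -
    have "real q * real P \<le> Q * Q ^ j" using q b by (intro mult_mono) auto
    also have "\<dots> = Q ^ Suc j" by simp
    also have "\<dots> \<le> Q ^ (2 * r)" using q ij by (intro power_increasing) auto
    finally show ?thesis .
  qed
  have qP0: "0 < real q * real P" using q b by simp
  have e: "of_int a / real q + of_int b / real P - of_int k = of_int t / (real q * real P)"
    using q b by (simp add: t_def field_simps)
  have "1 / Q ^ (2 * r) \<le> 1 / (real q * real P)"
    by (rule frac_le) (use qP qP0 in simp_all)
  also have "\<dots> \<le> \<bar>of_int t\<bar> / (real q * real P)" using t1 qP0 by (intro divide_right_mono) auto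
  also have "\<dots> = \<bar>of_int a / real q + of_int b / real P - of_int k\<bar>"
    unfolding e using qP0 by simp
  finally have "1 / Q ^ (2 * r) \<le> \<bar>of_int a / real q + of_int b / real P - of_int k\<bar>" .
  moreover have "real i * (\<epsilon> / 2) + real j * (\<epsilon> / 2) = real r * \<epsilon>"
  proof -
    have "real i + real j = 2 * real r" using ij(1) by (metis of_nat_add of_nat_mult of_nat_numeral)
    then have "(real i + real j) * (\<epsilon> / 2) = real r * \<epsilon>" by simp
    then show ?thesis by (simp only: distrib_right)
  qed
  ultimately show ?thesis using a(2) b(4) by linarith
qed

lemma power_sum_le:
  fixes x :: "'i \<Rightarrow> real"
  assumes "finite R" "\<And>i. 0 \<le> x i" "p \<ge> 1"
  shows "(\<Sum>i\<in>R. x i) ^ p \<le> real (card R) ^ (p - 1) * (\<Sum>i\<in>R. x i ^ p)"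
  using weighted_power_mean_sum[OF assms(1) _ assms(2,3), of "\<lambda>_. 1"] by simp

lemma l_sum_norms:
  assumes R: "finite R" and p: "p \<ge> 1" and i: "\<And>\<alpha>. \<alpha> \<in> R \<Longrightarrow> l_integrable p (g \<alpha>)"
  shows "integrable (count_space UNIV) (\<lambda>n. (\<Sum>\<alpha>\<in>R. norm (g \<alpha> n)) ^ p)"
    and "(LINT n|count_space UNIV. (\<Sum>\<alpha>\<in>R. norm (g \<alpha> n)) ^ p) \<le> real (card R) ^ (p - 1) * (\<Sum>\<alpha>\<in>R. l_sum p (g \<alpha>))"
proof -
  have le: "(\<Sum>\<alpha>\<in>R. norm (g \<alpha> n)) ^ p \<le> real (card R) ^ (p - 1) * (\<Sum>\<alpha>\<in>R. norm (g \<alpha> n) ^ p)" for n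
    by (rule power_sum_le[OF R _ p]) simp
  have i2: "integrable (count_space UNIV) (\<lambda>n. real (card R) ^ (p - 1) * (\<Sum>\<alpha>\<in>R. norm (g \<alpha> n) ^ p))"
    using i by (intro integrable_mult_right Bochner_Integration.integrable_sum)
  show i1: "integrable (count_space UNIV) (\<lambda>n. (\<Sum>\<alpha>\<in>R. norm (g \<alpha> n)) ^ p)"
    by (rule integrable_count_bound[OF i2]) (use le in \<open>simp add: sum_nonneg\<close>)
  have "(LINT n|count_space UNIV. (\<Sum>\<alpha>\<in>R. norm (g \<alpha> n)) ^ p)
      \<le> (LINT n|count_space UNIV. real (card R) ^ (p - 1) * (\<Sum>\<alpha>\<in>R. norm (g \<alpha> n) ^ p))"
    by (rule integral_mono[OF i1 i2 le])
  also have "\<dots> = real (card R) ^ (p - 1) * (\<Sum>\<alpha>\<in>R. l_sum p (g \<alpha>))"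
    using i by simp
  finally show "(LINT n|count_space UNIV. (\<Sum>\<alpha>\<in>R. norm (g \<alpha> n)) ^ p) \<le> real (card R) ^ (p - 1) * (\<Sum>\<alpha>\<in>R. l_sum p (g \<alpha>))" .
qed

lemma sum_squares_le_square_sum:
  fixes x :: "'i \<Rightarrow> real"
  assumes "finite R" "\<And>i. i \<in> R \<Longrightarrow> 0 \<le> x i"
  shows "(\<Sum>i\<in>R. (x i)\<^sup>2) \<le> (\<Sum>i\<in>R. x i)\<^sup>2"
proof -
  have "(\<Sum>i\<in>R. (x i)\<^sup>2) \<le> (\<Sum>i\<in>R. x i * (\<Sum>i\<in>R. x i))"
    unfolding power2_eq_square using assms by (intro sum_mono mult_left_mono member_le_sum) auto
  then show ?thesis by (simp add: power2_eq_square sum_distrib_right)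
qed

text \<open>Arithmetic enters through two vanishing statements: \<open>F q\<close> against
  \<open>2 * r - 1\<close> factors of other denominators, and an off-diagonal product from
  \<open>F q\<close> against \<open>2 * r - 2\<close> such factors. They feed the two absorption
  inequalities, which are then chained.\<close>

lemma superorthogonality:
  fixes g :: "real \<Rightarrow> int \<Rightarrow> complex"
  defines "F \<equiv> \<lambda>q n. \<Sum>\<alpha>\<in>reduced_fractions {q}. g \<alpha> n"
  assumes r: "r \<ge> 1" and Z: "finite Z" "pairwise coprime Z" and q: "\<And>q. q \<in> Z \<Longrightarrow> 1 < q \<and> real q \<le> Q"
    and \<epsilon>: "0 < \<epsilon>" "real r * \<epsilon> * Q ^ (2 * r) < 1"
    and sp: "\<And>\<alpha>. \<alpha> \<in> reduced_fractions Z \<Longrightarrow> spectrum_in {\<xi>. \<bar>\<xi> - \<alpha>\<bar> \<le> \<epsilon> / 2} (g \<alpha>)"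
    and int: "\<And>\<alpha>. \<alpha> \<in> reduced_fractions Z \<Longrightarrow> l_integrable (2 * r) (g \<alpha>)"
    and Ca: "0 \<le> Ca" "\<And>x y. 0 \<le> x \<Longrightarrow> 0 \<le> y \<Longrightarrow>
      (2 * real r - 1) * 2 ^ (r - 1) * y * (x + y) ^ (r - 1) \<le> x ^ r / 2 + Ca * y ^ r"
    and Cb: "0 \<le> Cb" "\<And>x y. 0 \<le> x \<Longrightarrow> 0 \<le> y \<Longrightarrow>
      real r * y * (x + y) ^ (r - 1) \<le> x ^ r / 2 + Cb * y ^ r"
  shows "l_sum (2 * r) (\<lambda>n. \<Sum>\<alpha>\<in>reduced_fractions Z. g \<alpha> n)
    \<le> 2 * Ca * (2 * Cb * 2 ^ r * ((LINT n|count_space UNIV. (\<Sum>\<alpha>\<in>reduced_fractions Z. (norm (g \<alpha> n))\<^sup>2) ^ r)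
        + (LINT n|count_space UNIV. (\<Sum>q\<in>Z. norm (F q n) ^ (2 * r)))))"
proof -
  let ?M = "count_space (UNIV :: int set)"
  let ?R = "reduced_fractions"
  have qpos: "0 < q" if "q \<in> Z" for q using q[OF that] by simp
  have split_real: "(\<Sum>\<alpha>\<in>?R Z. f \<alpha>) = (\<Sum>q\<in>Z. \<Sum>\<alpha>\<in>?R {q}. f \<alpha>)" for f :: "real \<Rightarrow> real"
    by (rule sum_reduced_fractions[OF Z(1) qpos])
  have split_complex: "(\<Sum>\<alpha>\<in>?R Z. f \<alpha>) = (\<Sum>q\<in>Z. \<Sum>\<alpha>\<in>?R {q}. f \<alpha>)" for f :: "real \<Rightarrow> complex"
    by (rule sum_reduced_fractions[OF Z(1) qpos])
  have finR: "finite (?R Z)" by (rule finite_reduced_fractions[OF Z(1)])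
  have RZ: "\<alpha> \<in> ?R Z" if "\<alpha> \<in> ?R {q}" "q \<in> Z" for \<alpha> q
    using that by (auto simp: reduced_fractions_def)
  define H where "H n = (\<Sum>q\<in>Z. F q n)" for n
  \<comment> \<open>Common majorant for the integrability of all products below; it does not enter
    the constant.\<close>
  define V where "V n = (\<Sum>\<alpha>\<in>?R Z. norm (g \<alpha> n))" for n
  define A where "A n = (\<Sum>q\<in>Z. (norm (F q n))\<^sup>2)" for n
  define s where "s q n = (\<Sum>\<alpha>\<in>?R {q}. (norm (g \<alpha> n))\<^sup>2)" for q n
  have V0: "0 \<le> V n" for n by (simp add: V_def sum_nonneg)
  have iV: "integrable ?M (\<lambda>n. V n ^ (2 * r))"
    unfolding V_def using r by (intro l_sum_norms(1)[OF finR _ int]) auto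
  have VF: "(\<Sum>q\<in>Z. norm (F q n)) \<le> V n" for n
    unfolding V_def split_real F_def by (intro sum_mono norm_sum)
  have FV: "norm (F q n) \<le> V n" if "q \<in> Z" for q n
    by (rule order_trans[OF _ VF]) (use that Z in \<open>auto intro: member_le_sum\<close>)
  have KF: "H n - F q n = (\<Sum>q'\<in>Z - {q}. F q' n)" if "q \<in> Z" for q n
    unfolding H_def using Z that by (simp add: sum_diff1)
  have KV: "norm (H n - F q n) \<le> V n" if "q \<in> Z" for q n
  proof -
    have "norm (H n - F q n) \<le> (\<Sum>q'\<in>Z - {q}. norm (F q' n))" unfolding KF[OF that] by (rule norm_sum)
    also have "\<dots> \<le> (\<Sum>q\<in>Z. norm (F q n))" using Z by (intro sum_mono2) auto
    also have "\<dots> \<le> V n" by (rule VF)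
    finally show ?thesis .
  qed
  have AV: "A n \<le> (V n)\<^sup>2" for n
  proof -
    have "A n \<le> (\<Sum>q\<in>Z. norm (F q n))\<^sup>2"
      unfolding A_def by (rule sum_squares_le_square_sum[OF Z(1)]) simp
    also have "\<dots> \<le> (V n)\<^sup>2" by (intro power_mono VF sum_nonneg) simp
    finally show ?thesis .
  qed
  have SV: "(\<Sum>q\<in>Z. s q n) \<le> (V n)\<^sup>2" for n
    unfolding s_def split_real[symmetric] V_def by (rule sum_squares_le_square_sum[OF finR]) simp
  have s0: "0 \<le> s q n" for q n by (simp add: s_def sum_nonneg)
  have A0: "0 \<le> A n" for n by (simp add: A_def sum_nonneg)
  have iA: "integrable ?M (\<lambda>n. A n ^ r)"
    by (rule integrable_count_bound[OF iV]) (auto simp: A0 power_mult intro!: power_mono AV)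
  have iS: "integrable ?M (\<lambda>n. (\<Sum>q\<in>Z. s q n) ^ r)"
    by (rule integrable_count_bound[OF iV]) (auto simp: s0 sum_nonneg power_mult intro!: power_mono SV)
  have sp_other: "spectrum_in (near_coprime Q \<epsilon> q 1) (F q')" if "q \<in> Z" "q' \<in> Z" "q' \<noteq> q" for q q'
    unfolding F_def
  proof (rule spectrum_in_sum, rule spectrum_in_mono)
    fix \<alpha> assume \<alpha>: "\<alpha> \<in> ?R {q'}"
    show "spectrum_in {\<xi>. \<bar>\<xi> - \<alpha>\<bar> \<le> \<epsilon> / 2} (g \<alpha>)" by (rule sp[OF RZ[OF \<alpha> that(2)]])
    obtain a where a: "\<alpha> = real a / real q'" using \<alpha> by (auto simp: reduced_fractions_def)
    have "coprime q' q" using Z(2) that by (auto simp: pairwise_def)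
    then show "{\<xi>. \<bar>\<xi> - \<alpha>\<bar> \<le> \<epsilon> / 2} \<subseteq> near_coprime Q \<epsilon> q 1"
      unfolding near_coprime_def a using q[OF that(2)]
      by (auto intro!: exI[of _ "int a"] exI[of _ q'])
  qed
  have sp_same: "spectrum_in (near_multiples \<epsilon> q 1) (F q)" if "q \<in> Z" for q
    unfolding F_def
  proof (rule spectrum_in_sum, rule spectrum_in_mono)
    fix \<alpha> assume \<alpha>: "\<alpha> \<in> ?R {q}"
    show "spectrum_in {\<xi>. \<bar>\<xi> - \<alpha>\<bar> \<le> \<epsilon> / 2} (g \<alpha>)" by (rule sp[OF RZ[OF \<alpha> that]])
    obtain a where a: "\<alpha> = real a / real q" "coprime a q" using \<alpha> by (auto simp: reduced_fractions_def)
    have "\<not> q dvd a" using a(2) q[OF that] by (auto simp: coprime_absorb_right)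
    then have "\<not> int q dvd int a" by simp
    then show "{\<xi>. \<bar>\<xi> - \<alpha>\<bar> \<le> \<epsilon> / 2} \<subseteq> near_multiples \<epsilon> q 1"
      unfolding near_multiples_def a(1) by (auto intro!: exI[of _ "int a"])
  qed
  define \<delta> where "\<delta> = 1 / Q ^ (2 * r) - real r * \<epsilon>"
  \<comment> \<open>\<open>i\<close> counts the factors with denominator \<open>q\<close> and
    \<open>j\<close> the others; the total \<open>2 * r\<close> makes the error radius r \<epsilon>,
    and \<open>\<delta>\<close> is positive by the hypothesis on \<epsilon>.\<close>
  have away: "(LINT n|?M. f n * h n) = 0"
    if "q \<in> Z" "spectrum_in (near_multiples \<epsilon> q i) f" "spectrum_in (near_coprime Q \<epsilon> q j) h"
      "integrable ?M (\<lambda>n. f n * h n)" "i + j = 2 * r" "j < 2 * r" for q i j f h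
  proof (rule sum_eq_0_if_spectrum_away_from_int)
    have Q: "1 \<le> Q" "0 < q" "real q \<le> Q" using q[OF that(1)] by auto
    show "spectrum_in {\<xi>. \<forall>k::int. \<delta> \<le> \<bar>\<xi> - of_int k\<bar>} (\<lambda>n. f n * h n)"
      using near_multiples_add_near_coprime[OF _ _ Q(2,3,1) that(5,6)]
      by (intro spectrum_in_mult[OF that(2,3)]) (auto simp: \<delta>_def)
    show "0 < \<delta>" using \<epsilon>(2) Q by (simp add: \<delta>_def field_simps)
  qed (use that(4) in auto)
  have van1: "(LINT n|?M. F q n * ((H n - F q n) ^ (r - 1) * cnj ((H n - F q n) ^ r))) = 0" if qZ: "q \<in> Z" for q
  proof (rule away[OF qZ sp_same[OF qZ]])
    \<comment> \<open>After the removal of \<open>F q\<close>, pairwise coprimality leaves only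
      denominators coprime to \<open>q\<close>.\<close>
    have K: "spectrum_in (near_coprime Q \<epsilon> q 1) (\<lambda>n. H n - F q n)"
      unfolding KF[OF qZ] by (rule spectrum_in_sum) (use sp_other qZ in auto)
    have 1: "spectrum_in (near_coprime Q \<epsilon> q (r - 1)) (\<lambda>n. (H n - F q n) ^ (r - 1))"
      using spectrum_in_near_coprime_power[OF K, of "r - 1"] by simp
    have 2: "spectrum_in (near_coprime Q \<epsilon> q r) (\<lambda>n. cnj ((H n - F q n) ^ r))"
      using spectrum_in_near_coprime_power[OF K, of r]
      by (intro spectrum_in_cnj[OF _ near_coprime_uminus]) simp
    show "spectrum_in (near_coprime Q \<epsilon> q (r - 1 + r)) (\<lambda>n. (H n - F q n) ^ (r - 1) * cnj ((H n - F q n) ^ r))"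
      by (rule spectrum_in_mult[OF 1 2 near_coprime_add])
    show "1 + (r - 1 + r) = 2 * r" "r - 1 + r < 2 * r" using r by auto
    show "integrable ?M (\<lambda>n. F q n * ((H n - F q n) ^ (r - 1) * cnj ((H n - F q n) ^ r)))"
    proof (rule integrable_count_bound[OF iV])
      fix n
      have e: "V n * (V n ^ (r - 1) * V n ^ r) = V n ^ (2 * r)"
        using r by (simp add: mult_2 power_add flip: power_Suc mult.assoc)
      show "norm (F q n * ((H n - F q n) ^ (r - 1) * cnj ((H n - F q n) ^ r))) \<le> V n ^ (2 * r)"
        unfolding e[symmetric] norm_mult complex_mod_cnj norm_power
        by (intro mult_mono power_mono FV KV qZ norm_ge_zero V0 zero_le_power mult_nonneg_nonneg)
    qed
  qed
  have van2: "(LINT n|?M. ((norm (F q n))\<^sup>2 - s q n) * (A n - (norm (F q n))\<^sup>2) ^ (r - 1)) = 0" if qZ: "q \<in> Z" for q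
  proof -
    \<comment> \<open>Off-diagonal part of |F_q|^2. Its frequencies (a - b)/q need not be reduced,
      which is why \<open>near_multiples\<close> asks only that \<open>q\<close> not divide the
      numerator.\<close>
    define X where "X n = (\<Sum>\<alpha>\<in>?R {q}. \<Sum>\<beta>\<in>?R {q} - {\<alpha>}. g \<alpha> n * cnj (g \<beta> n))" for n
    define Y where "Y n = (\<Sum>q'\<in>Z - {q}. F q' n * cnj (F q' n))" for n
    have X: "X n = complex_of_real ((norm (F q n))\<^sup>2 - s q n)" for n
    proof -
      have "complex_of_real ((norm (F q n))\<^sup>2) = (\<Sum>\<alpha>\<in>?R {q}. \<Sum>\<beta>\<in>?R {q}. g \<alpha> n * cnj (g \<beta> n))"
        unfolding complex_norm_square F_def by (simp add: sum_product)
      also have "\<dots> = (\<Sum>\<alpha>\<in>?R {q}. g \<alpha> n * cnj (g \<alpha> n) + (\<Sum>\<beta>\<in>?R {q} - {\<alpha>}. g \<alpha> n * cnj (g \<beta> n)))"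
        by (intro sum.cong refl sum.remove finite_reduced_fractions_singleton)
      also have "\<dots> = complex_of_real (s q n) + X n"
        unfolding X_def s_def sum.distrib of_real_sum complex_norm_square ..
      finally show ?thesis by simp
    qed
    have Y: "Y n = complex_of_real (A n - (norm (F q n))\<^sup>2)" for n
    proof -
      have "A n - (norm (F q n))\<^sup>2 = (\<Sum>q'\<in>Z - {q}. (norm (F q' n))\<^sup>2)"
        unfolding A_def using Z qZ by (simp add: sum_diff1)
      then show ?thesis unfolding Y_def complex_norm_square[symmetric] by simp
    qed
    have "(LINT n|?M. X n * Y n ^ (r - 1)) = 0"
    proof (rule away[OF qZ])
      show "spectrum_in (near_multiples \<epsilon> q 2) X"
        unfolding X_def
      proof (intro spectrum_in_sum)
        fix \<alpha> \<beta> assume \<alpha>: "\<alpha> \<in> ?R {q}" and \<beta>: "\<beta> \<in> ?R {q} - {\<alpha>}"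
        have \<beta>': "\<beta> \<in> ?R {q}" using \<beta> by simp
        obtain a where a: "\<alpha> = real a / real q" "1 \<le> a" "a \<le> q" using \<alpha> by (auto simp: reduced_fractions_def)
        obtain b where b: "\<beta> = real b / real q" "1 \<le> b" "b \<le> q" using \<beta> by (auto simp: reduced_fractions_def)
        have "a \<noteq> b" using a b \<beta> by auto
        \<comment> \<open>Both numerators lie between 1 and \<open>q\<close>, so their nonzero
          difference is smaller than \<open>q\<close> in modulus.\<close>
        then have nd: "\<not> int q dvd int a - int b"
          using a b zdvd_imp_le[of "int q" "int a - int b"] zdvd_imp_le[of "int q" "int b - int a"]
          by (auto simp: dvd_diff_commute[of _ "int a" "int b"] not_less dest: linorder_neqE)
        have ab: "of_int (int a - int b) / real q = \<alpha> - \<beta>" by (simp add: a b diff_divide_distrib)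
        have c: "spectrum_in {\<xi>. \<bar>\<xi> + \<beta>\<bar> \<le> \<epsilon> / 2} (\<lambda>n. cnj (g \<beta> n))"
          by (rule spectrum_in_cnj[OF sp[OF RZ[OF \<beta>' qZ]]]) (simp add: abs_minus_commute)
        show "spectrum_in (near_multiples \<epsilon> q 2) (\<lambda>n. g \<alpha> n * cnj (g \<beta> n))"
        proof (rule spectrum_in_mult[OF sp[OF RZ[OF \<alpha> qZ]] c])
          fix x y assume "x \<in> {\<xi>. \<bar>\<xi> - \<alpha>\<bar> \<le> \<epsilon> / 2}" "y \<in> {\<xi>. \<bar>\<xi> + \<beta>\<bar> \<le> \<epsilon> / 2}"
          then have "\<bar>x - \<alpha>\<bar> \<le> \<epsilon> / 2" "\<bar>y + \<beta>\<bar> \<le> \<epsilon> / 2" by simp_all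
          then have "\<bar>x + y - (\<alpha> - \<beta>)\<bar> \<le> \<epsilon>" by linarith
          then have "\<bar>x + y - (\<alpha> - \<beta>)\<bar> \<le> real 2 * (\<epsilon> / 2)" by simp
          then show "x + y \<in> near_multiples \<epsilon> q 2"
            unfolding near_multiples_def using nd ab by (intro CollectI exI[of _ "int a - int b"]) simp
        qed
      qed
      have "spectrum_in (near_coprime Q \<epsilon> q (1 + 1)) Y"
        unfolding Y_def
      proof (rule spectrum_in_sum)
        fix q' assume "q' \<in> Z - {q}"
        then have o: "spectrum_in (near_coprime Q \<epsilon> q 1) (F q')" by (intro sp_other qZ) auto
        show "spectrum_in (near_coprime Q \<epsilon> q (1 + 1)) (\<lambda>n. F q' n * cnj (F q' n))"
          by (rule spectrum_in_mult[OF o spectrum_in_cnj[OF o near_coprime_uminus] near_coprime_add])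
      qed
      then show "spectrum_in (near_coprime Q \<epsilon> q ((r - 1) * (1 + 1))) (\<lambda>n. Y n ^ (r - 1))"
        by (rule spectrum_in_near_coprime_power)
      show "2 + (r - 1) * (1 + 1) = 2 * r" "(r - 1) * (1 + 1) < 2 * r" using r by auto
      show "integrable ?M (\<lambda>n. X n * Y n ^ (r - 1))"
      proof (rule integrable_count_bound[OF iV])
        fix n
        have e: "(V n)\<^sup>2 * ((V n)\<^sup>2) ^ (r - 1) = V n ^ (2 * r)"
          using r by (simp add: power_mult flip: power_Suc)
        have F2: "(norm (F q n))\<^sup>2 \<le> (V n)\<^sup>2" by (intro power_mono FV qZ) simp
        have s2: "s q n \<le> (V n)\<^sup>2"
          by (rule order_trans[OF _ SV]) (use qZ Z s0 in \<open>auto intro: member_le_sum\<close>)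
        have A2: "(norm (F q n))\<^sup>2 \<le> A n"
          unfolding A_def using qZ Z by (intro member_le_sum) auto
        have "norm (X n) \<le> (V n)\<^sup>2"
          unfolding X norm_of_real using F2 s2 s0[of q n] zero_le_power2[of "norm (F q n)"] by linarith
        moreover have "norm (Y n) \<le> (V n)\<^sup>2"
          unfolding Y norm_of_real using A2 AV[of n] zero_le_power2[of "norm (F q n)"] by linarith
        ultimately show "norm (X n * Y n ^ (r - 1)) \<le> V n ^ (2 * r)"
          unfolding e[symmetric] norm_mult norm_power by (intro mult_mono power_mono) auto
      qed
    qed
    then have "(LINT n|?M. complex_of_real (((norm (F q n))\<^sup>2 - s q n) * (A n - (norm (F q n))\<^sup>2) ^ (r - 1))) = 0"
      unfolding X Y by simp
    then show ?thesis unfolding integral_complex_of_real by (simp only: of_real_eq_0_iff)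
  qed
  have "l_sum (2 * r) H \<le> 2 * Ca * (LINT n|?M. A n ^ r)"
    unfolding H_def A_def
  proof (rule superorthogonal_square_function[OF Z(1) r])
    show "integrable ?M (\<lambda>n. (\<Sum>q\<in>Z. norm (F q n)) ^ (2 * r))"
      by (rule integrable_count_bound[OF iV]) (auto simp: sum_nonneg intro!: power_mono VF)
  qed (use van1 Ca in \<open>auto simp: H_def\<close>)
  also have "\<dots> \<le> 2 * Ca * (2 * Cb * 2 ^ r * ((LINT n|?M. (\<Sum>q\<in>Z. s q n) ^ r) + (LINT n|?M. (\<Sum>q\<in>Z. ((norm (F q n))\<^sup>2) ^ r))))"
  proof (intro mult_left_mono)
    show "(LINT n|?M. A n ^ r) \<le> 2 * Cb * 2 ^ r * ((LINT n|?M. (\<Sum>q\<in>Z. s q n) ^ r) + (LINT n|?M. (\<Sum>q\<in>Z. ((norm (F q n))\<^sup>2) ^ r)))"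
      unfolding A_def
      by (rule superorthogonal_squares[OF Z(1) r _ s0]) (use iA iS van2 Cb in \<open>auto simp: A_def\<close>)
  qed (use Ca in auto)
  finally show ?thesis
    by (simp add: H_def split_real split_complex F_def s_def power_mult)
qed

text \<open>Each of the finitely many pieces converges in l^(2r), so each of the three integrals
  changes by at most the factor \<open>2 ^ (2 * r)\<close> and an error. The errors carry
  cardinalities, but they tend to 0, so the constant stays independent of \<open>Z\<close>.\<close>

lemma superorthogonality_limit:
  fixes g :: "nat \<Rightarrow> real \<Rightarrow> int \<Rightarrow> complex" and F :: "real \<Rightarrow> int \<Rightarrow> complex"
  assumes r: "r \<ge> 1" and Z: "finite Z" and C: "0 \<le> C"
    and int: "\<And>\<alpha>. l_integrable (2 * r) (F \<alpha>)"
    and intd: "\<And>k \<alpha>. l_integrable (2 * r) (\<lambda>n. g k \<alpha> n - F \<alpha> n)"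
    and lim: "\<And>\<alpha>. (\<lambda>k. l_sum (2 * r) (\<lambda>n. g k \<alpha> n - F \<alpha> n)) \<longlonglongrightarrow> 0"
    and le: "\<And>k. l_sum (2 * r) (\<lambda>n. \<Sum>\<alpha>\<in>reduced_fractions Z. g k \<alpha> n)
      \<le> C * ((LINT n|count_space UNIV. (\<Sum>\<alpha>\<in>reduced_fractions Z. (norm (g k \<alpha> n))\<^sup>2) ^ r)
        + (LINT n|count_space UNIV. (\<Sum>q\<in>Z. norm (\<Sum>\<alpha>\<in>reduced_fractions {q}. g k \<alpha> n) ^ (2 * r))))"
  shows "l_sum (2 * r) (\<lambda>n. \<Sum>\<alpha>\<in>reduced_fractions Z. F \<alpha> n)
      \<le> 2 ^ (2 * r) * (C * 2 ^ (2 * r)) * ((LINT n|count_space UNIV. (\<Sum>\<alpha>\<in>reduced_fractions Z. (norm (F \<alpha> n))\<^sup>2) ^ r)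
        + (LINT n|count_space UNIV. (\<Sum>q\<in>Z. norm (\<Sum>\<alpha>\<in>reduced_fractions {q}. F \<alpha> n) ^ (2 * r))))"
proof -
  let ?M = "count_space (UNIV :: int set)"
  let ?R = "reduced_fractions"
  let ?FS = "\<lambda>n. \<Sum>\<alpha>\<in>?R Z. (norm (F \<alpha> n))\<^sup>2"
  let ?gS = "\<lambda>k n. \<Sum>\<alpha>\<in>?R Z. (norm (g k \<alpha> n))\<^sup>2"
  let ?Fq = "\<lambda>q n. \<Sum>\<alpha>\<in>?R {q}. F \<alpha> n"
  let ?gq = "\<lambda>k q n. \<Sum>\<alpha>\<in>?R {q}. g k \<alpha> n"
  let ?gn = "\<lambda>k n. \<Sum>\<alpha>\<in>?R Z. norm (g k \<alpha> n)"
  define c :: real where "c = 2 ^ (2 * r)"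
  have c0: "0 \<le> c" by (simp add: c_def)
  have p: "2 * r \<ge> 1" using r by simp
  have finR: "finite (?R Z)" by (rule finite_reduced_fractions[OF Z])
  have RZ: "?R {q} \<subseteq> ?R Z" if "q \<in> Z" for q using that by (auto simp: reduced_fractions_def)
  define d where "d k \<alpha> n = g k \<alpha> n - F \<alpha> n" for k \<alpha> n
  let ?dq = "\<lambda>k q n. \<Sum>\<alpha>\<in>?R {q}. d k \<alpha> n"
  \<comment> \<open>One majorant for all differences: it dominates the 2r-th power of the sum of
    \<open>d k \<alpha> n\<close> over any subset of the fractions.\<close>
  define W where "W k n = (\<Sum>\<alpha>\<in>?R Z. norm (d k \<alpha> n)) ^ (2 * r)" for k n
  define e where "e k = (LINT n|?M. W k n)" for k
  have iW: "integrable ?M (W k)" for k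
    unfolding W_def d_def by (rule l_sum_norms(1)[OF finR p intd])
  have W0: "0 \<le> W k n" for k n by (simp add: W_def sum_nonneg)
  have e: "e \<longlonglongrightarrow> 0"
  proof (rule tendsto_sandwich)
    show "\<forall>\<^sub>F k in sequentially. 0 \<le> e k" using W0 by (simp add: e_def)
    show "\<forall>\<^sub>F k in sequentially. e k \<le> real (card (?R Z)) ^ (2 * r - 1) * (\<Sum>\<alpha>\<in>?R Z. l_sum (2 * r) (\<lambda>n. g k \<alpha> n - F \<alpha> n))"
      unfolding e_def W_def d_def by (intro always_eventually allI l_sum_norms(2)[OF finR p intd])
    have "(\<lambda>k. real (card (?R Z)) ^ (2 * r - 1) * (\<Sum>\<alpha>\<in>?R Z. l_sum (2 * r) (\<lambda>n. g k \<alpha> n - F \<alpha> n)))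
        \<longlonglongrightarrow> real (card (?R Z)) ^ (2 * r - 1) * (\<Sum>\<alpha>\<in>?R Z. 0)"
      by (intro tendsto_intros lim)
    then show "(\<lambda>k. real (card (?R Z)) ^ (2 * r - 1) * (\<Sum>\<alpha>\<in>?R Z. l_sum (2 * r) (\<lambda>n. g k \<alpha> n - F \<alpha> n))) \<longlonglongrightarrow> 0"
      by simp
  qed simp
  have dW: "norm (\<Sum>\<alpha>\<in>R. d k \<alpha> n) ^ (2 * r) \<le> W k n" if "R \<subseteq> ?R Z" for R k n
    unfolding W_def
  proof (intro power_mono order_trans[OF norm_sum])
    show "(\<Sum>\<alpha>\<in>R. norm (d k \<alpha> n)) \<le> (\<Sum>\<alpha>\<in>?R Z. norm (d k \<alpha> n))"
      using that finR by (intro sum_mono2) auto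
  qed simp
  have iFs: "integrable ?M (\<lambda>n. (\<Sum>\<alpha>\<in>?R Z. norm (F \<alpha> n)) ^ (2 * r))"
    by (rule l_sum_norms(1)[OF finR p int])
  have ig: "l_integrable (2 * r) (g k \<alpha>)" for k \<alpha>
    by (rule l_add(1)[OF int[of \<alpha>] intd[of k \<alpha>]]) (metis add.commute diff_add_cancel norm_triangle_ineq)
  have igs: "integrable ?M (\<lambda>n. (?gn k n) ^ (2 * r))" for k
    by (rule l_sum_norms(1)[OF finR p ig])
  have sub: "l_integrable (2 * r) (\<lambda>n. \<Sum>\<alpha>\<in>R. h \<alpha> n)"
    if "integrable ?M (\<lambda>n. (\<Sum>\<alpha>\<in>?R Z. norm (h \<alpha> n)) ^ (2 * r))" "R \<subseteq> ?R Z" for R and h :: "real \<Rightarrow> int \<Rightarrow> complex"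
  proof (rule integrable_count_bound[OF that(1)])
    fix n
    have "norm (\<Sum>\<alpha>\<in>R. h \<alpha> n) \<le> (\<Sum>\<alpha>\<in>?R Z. norm (h \<alpha> n))"
      by (rule order_trans[OF norm_sum]) (use that finR in \<open>auto intro: sum_mono2\<close>)
    then show "norm (norm (\<Sum>\<alpha>\<in>R. h \<alpha> n) ^ (2 * r)) \<le> (\<Sum>\<alpha>\<in>?R Z. norm (h \<alpha> n)) ^ (2 * r)"
      by (simp add: power_mono)
  qed
  have sq: "integrable ?M (\<lambda>n. (\<Sum>\<alpha>\<in>?R Z. (norm (h \<alpha> n))\<^sup>2) ^ r)"
    if "integrable ?M (\<lambda>n. (\<Sum>\<alpha>\<in>?R Z. norm (h \<alpha> n)) ^ (2 * r))" for h :: "real \<Rightarrow> int \<Rightarrow> complex"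
  proof (rule integrable_count_bound[OF that])
    fix n
    have "(\<Sum>\<alpha>\<in>?R Z. (norm (h \<alpha> n))\<^sup>2) ^ r \<le> ((\<Sum>\<alpha>\<in>?R Z. norm (h \<alpha> n))\<^sup>2) ^ r"
      by (intro power_mono sum_squares_le_square_sum finR sum_nonneg) auto
    then show "norm ((\<Sum>\<alpha>\<in>?R Z. (norm (h \<alpha> n))\<^sup>2) ^ r) \<le> (\<Sum>\<alpha>\<in>?R Z. norm (h \<alpha> n)) ^ (2 * r)"
      by (simp add: power_mult sum_nonneg)
  qed
  define X where "X = (LINT n|?M. (?FS n) ^ r)"
  define Y where "Y = (LINT n|?M. (\<Sum>q\<in>Z. norm (?Fq q n) ^ (2 * r)))"
  have Xk: "(LINT n|?M. (?gS k n) ^ r) \<le> c * (X + e k)" for k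
  proof -
    have pt: "(?gS k n) ^ r \<le> c * ((?FS n) ^ r + W k n)" for n
    proof -
      let ?S = "\<Sum>\<alpha>\<in>?R Z. (norm (F \<alpha> n))\<^sup>2" and ?D = "\<Sum>\<alpha>\<in>?R Z. (norm (d k \<alpha> n))\<^sup>2"
      have "(norm (g k \<alpha> n))\<^sup>2 \<le> 2 * ((norm (F \<alpha> n))\<^sup>2 + (norm (d k \<alpha> n))\<^sup>2)" for \<alpha>
      proof -
        have "norm (g k \<alpha> n) \<le> norm (F \<alpha> n) + norm (d k \<alpha> n)"
          using norm_triangle_ineq[of "F \<alpha> n" "d k \<alpha> n"] by (simp add: d_def)
        then have "(norm (g k \<alpha> n))\<^sup>2 \<le> (norm (F \<alpha> n) + norm (d k \<alpha> n))\<^sup>2" by (rule power_mono) simp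
        also have "\<dots> \<le> 2 * ((norm (F \<alpha> n))\<^sup>2 + (norm (d k \<alpha> n))\<^sup>2)"
          using sum_squares_bound[of "norm (F \<alpha> n)" "norm (d k \<alpha> n)"] by (simp add: power2_sum)
        finally show ?thesis .
      qed
      then have "(?gS k n) \<le> 2 * (?S + ?D)"
        unfolding sum.distrib[symmetric] sum_distrib_left by (rule sum_mono)
      then have "(?gS k n) ^ r \<le> (2 * (?S + ?D)) ^ r"
        by (rule power_mono) (simp add: sum_nonneg)
      also have "\<dots> = 2 ^ r * (?S + ?D) ^ r" by (rule power_mult_distrib)
      also have "\<dots> \<le> 2 ^ r * (2 ^ r * (?S ^ r + ?D ^ r))"
        by (intro mult_left_mono power_add_le_2 sum_nonneg) auto
      \<comment> \<open>One \<open>2 ^ r\<close> comes from the square of a sum, the other from the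
        \<open>r\<close>-th power of a sum.\<close>
      also have "\<dots> = c * (?S ^ r + ?D ^ r)" by (simp add: c_def power_add mult_2)
      also have "\<dots> \<le> c * (?S ^ r + W k n)"
      proof (intro mult_left_mono add_left_mono c0)
        show "?D ^ r \<le> W k n"
          unfolding W_def power_mult by (intro power_mono sum_squares_le_square_sum finR sum_nonneg) auto
      qed
      finally show ?thesis .
    qed
    have i: "integrable ?M (\<lambda>n. c * ((?FS n) ^ r + W k n))"
      by (intro integrable_mult_right Bochner_Integration.integrable_add sq iFs iW)
    have "(LINT n|?M. (?gS k n) ^ r) \<le> (LINT n|?M. c * ((?FS n) ^ r + W k n))"
      by (rule integral_mono[OF sq[OF igs] i pt])
    also have "\<dots> = c * (X + e k)"
      unfolding X_def e_def integral_mult_right_zero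
      by (subst Bochner_Integration.integral_add[OF sq[OF iFs] iW]) simp
    finally show ?thesis .
  qed
  have Yk: "(LINT n|?M. (\<Sum>q\<in>Z. norm (?gq k q n) ^ (2 * r))) \<le> c * (Y + real (card Z) * e k)" for k
  proof -
    have pt: "(\<Sum>q\<in>Z. norm (?gq k q n) ^ (2 * r)) \<le> c * ((\<Sum>q\<in>Z. norm (?Fq q n) ^ (2 * r)) + real (card Z) * W k n)" for n
    proof -
      have "norm (?gq k q n) ^ (2 * r) \<le> c * (norm (?Fq q n) ^ (2 * r) + W k n)" if q: "q \<in> Z" for q
      proof -
        have "(?gq k q n) = (?Fq q n) + (?dq k q n)"
          by (simp add: d_def flip: sum.distrib)
        then have "norm (?gq k q n) \<le> norm (?Fq q n) + norm (?dq k q n)"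
          using norm_triangle_ineq by metis
        then have "norm (?gq k q n) ^ (2 * r) \<le> (norm (?Fq q n) + norm (?dq k q n)) ^ (2 * r)"
          by (rule power_mono) simp
        also have "\<dots> \<le> c * (norm (?Fq q n) ^ (2 * r) + norm (?dq k q n) ^ (2 * r))"
          unfolding c_def by (rule power_add_le_2) auto
        also have "\<dots> \<le> c * (norm (?Fq q n) ^ (2 * r) + W k n)"
          by (intro mult_left_mono add_left_mono dW RZ q c0)
        finally show ?thesis .
      qed
      then have "(\<Sum>q\<in>Z. norm (?gq k q n) ^ (2 * r)) \<le> (\<Sum>q\<in>Z. c * (norm (?Fq q n) ^ (2 * r) + W k n))"
        by (rule sum_mono)
      also have "\<dots> = c * ((\<Sum>q\<in>Z. norm (?Fq q n) ^ (2 * r)) + real (card Z) * W k n)"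
        unfolding sum_distrib_left[symmetric] sum.distrib by simp
      finally show ?thesis .
    qed
    have iY: "integrable ?M (\<lambda>n. \<Sum>q\<in>Z. norm (\<Sum>\<alpha>\<in>?R {q}. h \<alpha> n) ^ (2 * r))"
      if "integrable ?M (\<lambda>n. (\<Sum>\<alpha>\<in>?R Z. norm (h \<alpha> n)) ^ (2 * r))" for h :: "real \<Rightarrow> int \<Rightarrow> complex"
      by (intro Bochner_Integration.integrable_sum sub[OF that] RZ)
    have i: "integrable ?M (\<lambda>n. c * ((\<Sum>q\<in>Z. norm (?Fq q n) ^ (2 * r)) + real (card Z) * W k n))"
      by (intro integrable_mult_right Bochner_Integration.integrable_add iY iFs iW)
    have "(LINT n|?M. (\<Sum>q\<in>Z. norm (?gq k q n) ^ (2 * r)))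
        \<le> (LINT n|?M. c * ((\<Sum>q\<in>Z. norm (?Fq q n) ^ (2 * r)) + real (card Z) * W k n))"
      by (rule integral_mono[OF iY[OF igs] i pt])
    also have "\<dots> = c * (Y + real (card Z) * e k)"
      unfolding Y_def e_def integral_mult_right_zero
      by (subst Bochner_Integration.integral_add[OF iY[OF iFs] integrable_mult_right[OF iW]]) simp
    finally show ?thesis .
  qed
  have bound: "l_sum (2 * r) (\<lambda>n. \<Sum>\<alpha>\<in>?R Z. F \<alpha> n)
      \<le> c * (C * (c * (X + e k) + c * (Y + real (card Z) * e k)) + e k)" for k
  proof -
    have id: "integrable ?M (\<lambda>n. (\<Sum>\<alpha>\<in>?R Z. norm (d k \<alpha> n)) ^ (2 * r))"
      using iW[of k] by (simp add: W_def[abs_def])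
    have tri: "norm (\<Sum>\<alpha>\<in>?R Z. F \<alpha> n) \<le> norm (\<Sum>\<alpha>\<in>?R Z. g k \<alpha> n) + norm (\<Sum>\<alpha>\<in>?R Z. d k \<alpha> n)" for n
    proof -
      have "(\<Sum>\<alpha>\<in>?R Z. F \<alpha> n) = (\<Sum>\<alpha>\<in>?R Z. g k \<alpha> n) - (\<Sum>\<alpha>\<in>?R Z. d k \<alpha> n)"
        by (simp add: d_def flip: sum_subtractf)
      then show ?thesis using norm_triangle_ineq4 by metis
    qed
    have "l_sum (2 * r) (\<lambda>n. \<Sum>\<alpha>\<in>?R Z. F \<alpha> n)
        \<le> c * (l_sum (2 * r) (\<lambda>n. \<Sum>\<alpha>\<in>?R Z. g k \<alpha> n) + l_sum (2 * r) (\<lambda>n. \<Sum>\<alpha>\<in>?R Z. d k \<alpha> n))"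
      unfolding c_def by (rule l_add(2)[OF sub[OF igs] sub[OF id] tri]) auto
    also have "\<dots> \<le> c * (C * (c * (X + e k) + c * (Y + real (card Z) * e k)) + e k)"
    proof (intro mult_left_mono add_mono c0 order_trans[OF le] C Xk Yk)
      show "l_sum (2 * r) (\<lambda>n. \<Sum>\<alpha>\<in>?R Z. d k \<alpha> n) \<le> e k"
        unfolding e_def by (rule integral_mono[OF sub[OF id] iW dW]) auto
    qed
    finally show ?thesis .
  qed
  have "(\<lambda>k. c * (C * (c * (X + e k) + c * (Y + real (card Z) * e k)) + e k))
      \<longlonglongrightarrow> c * (C * (c * (X + 0) + c * (Y + real (card Z) * 0)) + 0)"
    by (intro tendsto_intros e)
  then have "l_sum (2 * r) (\<lambda>n. \<Sum>\<alpha>\<in>?R Z. F \<alpha> n) \<le> c * (C * (c * (X + 0) + c * (Y + real (card Z) * 0)) + 0)"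
    by (rule tendsto_lowerbound) (use bound in auto)
  also have "\<dots> = c * (C * c) * (X + Y)" by (simp add: algebra_simps)
  finally show ?thesis by (simp only: c_def X_def Y_def)
qed

text \<open>Bounding \<open>X + Y\<close> by twice the maximum lets the root distribute without its
  subadditivity; the price is the 2 in \<open>2 * K\<close>.\<close>

lemma powr_add_bound:
  fixes L X Y K p :: real
  assumes L: "0 \<le> L" "L \<le> K * (X + Y)" and X: "0 \<le> X" and Y: "0 \<le> Y" and K: "0 \<le> K" and p: "0 < p"
  shows "L powr (1 / p) \<le> (2 * K) powr (1 / p) * X powr (1 / p) + (2 * K) powr (1 / p) * Y powr (1 / p)"
proof -
  have "L \<le> (2 * K) * max X Y"
  proof -
    have "X + Y \<le> 2 * max X Y" by simp
    then have "K * (X + Y) \<le> K * (2 * max X Y)" by (rule mult_left_mono[OF _ K])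
    then show ?thesis using L(2) by simp
  qed
  then have "L powr (1 / p) \<le> ((2 * K) * max X Y) powr (1 / p)"
    using L(1) p by (intro powr_mono2) auto
  also have "\<dots> = (2 * K) powr (1 / p) * max X Y powr (1 / p)"
    by (rule powr_mult)
  also have "\<dots> \<le> (2 * K) powr (1 / p) * (X powr (1 / p) + Y powr (1 / p))"
    by (intro mult_left_mono) (auto simp: max_def)
  finally show ?thesis by (simp add: distrib_left)
qed

theorem proposition5p2:
  fixes r :: nat and m :: "real \<Rightarrow> complex"
  assumes "r \<ge> 1"
    and "Lp_multiplier (2 * real r) m"
    and "{x. m x \<noteq> 0} \<subseteq> {-1/2<..1/2}"
  shows "\<exists>C::real. \<forall>(Z::nat set) (qZ::real) (\<epsilon>::real) (f::int \<Rightarrow> complex).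
    finite Z \<longrightarrow> pairwise coprime Z \<longrightarrow> (\<forall>q\<in>Z. 1 < q \<and> real q \<le> qZ) \<longrightarrow>
    0 < \<epsilon> \<longrightarrow> \<epsilon> < 1 / (real r * qZ ^ (2 * r)) \<longrightarrow>
    f \<in> lp_space (2 * real r) \<longrightarrow>
      lp_norm (2 * real r)
        (\<lambda>n. \<Sum>\<alpha>\<in>reduced_fractions Z. freq_piece (2 * real r) m \<epsilon> \<alpha> f n)
      \<le> C * lp_norm (2 * real r)
            (\<lambda>n. sqrt (\<Sum>\<alpha>\<in>reduced_fractions Z.
                (norm (freq_piece (2 * real r) m \<epsilon> \<alpha> f n))^2))
        + C * lp_norm (2 * real r)
            (\<lambda>n. (\<Sum>q\<in>Z. (norm (\<Sum>\<alpha>\<in>reduced_fractions {q}.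
                freq_piece (2 * real r) m \<epsilon> \<alpha> f n)) ^ (2 * r)) powr (1 / (2 * real r)))"
proof -
  note r = assms(1) and supp = assms(3)
  have rr: "2 * real r = real (2 * r)" and p: "0 < 2 * r" using r by auto
  have mult: "Lp_multiplier (real (2 * r)) m" using assms(2) by simp
  obtain Mb where m: "m \<in> borel_measurable lebesgue" "\<And>x. norm (m x) \<le> Mb"
    using mult by (auto simp: Lp_multiplier_def Lp_multiplier_of_norm_def bounded_iff)
  obtain Ca where Ca: "0 \<le> Ca" "\<And>x y. 0 \<le> x \<Longrightarrow> 0 \<le> y \<Longrightarrow>
      (2 * real r - 1) * 2 ^ (r - 1) * y * (x + y) ^ (r - 1) \<le> x ^ r / 2 + Ca * y ^ r"
    using absorbing_constant[OF r, of "(2 * real r - 1) * 2 ^ (r - 1)"] r by auto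
  obtain Cb where Cb: "0 \<le> Cb" "\<And>x y. 0 \<le> x \<Longrightarrow> 0 \<le> y \<Longrightarrow>
      real r * y * (x + y) ^ (r - 1) \<le> x ^ r / 2 + Cb * y ^ r"
    using absorbing_constant[OF r, of "real r"] by auto
  \<comment> \<open>Product of the two absorption bounds. \<open>K\<close> adds the two factors
    \<open>2 ^ (2 * r)\<close> lost in the limit, and \<open>C\<close> the 2 from
    \<open>powr_add_bound\<close>; all of them are fixed by \<open>r\<close> before
    \<open>Z\<close>, \<epsilon> and \<open>f\<close> are chosen.\<close>
  define C0 where "C0 = 2 * Ca * (2 * Cb * 2 ^ r)"
  define K where "K = 2 ^ (2 * r) * (C0 * 2 ^ (2 * r))"
  have C0: "0 \<le> C0" using Ca Cb by (simp add: C0_def)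
  then have K: "0 \<le> K" by (simp add: K_def)
  define C where "C = (2 * K) powr (1 / (2 * real r))"
  show ?thesis
  proof (rule exI[of _ C], intro allI impI)
    fix Z :: "nat set" and qZ \<epsilon> :: real and f :: "int \<Rightarrow> complex"
    assume Z: "finite Z" "pairwise coprime Z" and q: "\<forall>q\<in>Z. 1 < q \<and> real q \<le> qZ"
      and \<epsilon>: "0 < \<epsilon>" "\<epsilon> < 1 / (real r * qZ ^ (2 * r))" and f: "f \<in> lp_space (2 * real r)"
    let ?R = "reduced_fractions"
    let ?P = "freq_piece (2 * real r) m \<epsilon>"
    define X where "X = (LINT n|count_space UNIV. (\<Sum>\<alpha>\<in>?R Z. (norm (?P \<alpha> f n))\<^sup>2) ^ r)"
    define Y where "Y = (LINT n|count_space UNIV. (\<Sum>q\<in>Z. norm (\<Sum>\<alpha>\<in>?R {q}. ?P \<alpha> f n) ^ (2 * r)))"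
    have fi: "l_integrable (2 * r) f" using f p unfolding rr by (simp only: Lp_space_nat mem_Collect_eq)
    have main: "l_sum (2 * r) (\<lambda>n. \<Sum>\<alpha>\<in>?R Z. ?P \<alpha> f n) \<le> K * (X + Y)"
    proof (cases "Z = {}")
      case True
      then have "?R Z = {}" by (simp add: reduced_fractions_def)
      then show ?thesis using True r by (simp add: X_def Y_def zero_power)
    next
      case False
      then have qZ: "1 \<le> qZ" using q by fastforce
      have rq: "1 \<le> real r * qZ ^ (2 * r)"
        using mult_mono[of 1 "real r" 1 "qZ ^ (2 * r)"] r one_le_power[OF qZ] by simp
      then have "1 / (real r * qZ ^ (2 * r)) \<le> 1" by simp
      then have \<epsilon>1: "\<epsilon> \<le> 1" using \<epsilon>(2) by linarith
      have \<epsilon>q: "real r * \<epsilon> * qZ ^ (2 * r) < 1"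
        using \<epsilon>(2) rq by (simp add: field_simps)
      let ?u = "\<lambda>k. truncate k f"
      have u1: "l_integrable 1 (?u k)" for k by (rule l_integrable_truncate) simp
      obtain A where A: "\<And>\<alpha> u. l_integrable 1 u \<Longrightarrow> l_integrable (2 * r) (freq_piece_l1 m \<epsilon> \<alpha> u)"
        using freq_piece_l1_bounded[OF mult p supp \<epsilon>(1) \<epsilon>1] by blast
      show ?thesis
        unfolding X_def Y_def K_def rr
      \<comment> \<open>The vanishing argument runs on the pieces of the truncations, whose spectra
        are known; the limit carries the estimate to \<open>f\<close>.\<close>
      proof (rule superorthogonality_limit[OF r Z(1) C0 freq_piece_tendsto[OF mult p supp \<epsilon>(1) \<epsilon>1 fi]])
        fix k
        show "l_sum (2 * r) (\<lambda>n. \<Sum>\<alpha>\<in>?R Z. freq_piece_l1 m \<epsilon> \<alpha> (?u k) n)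
          \<le> C0 * ((LINT n|count_space UNIV. (\<Sum>\<alpha>\<in>?R Z. (norm (freq_piece_l1 m \<epsilon> \<alpha> (?u k) n))\<^sup>2) ^ r)
            + (LINT n|count_space UNIV. (\<Sum>q\<in>Z. norm (\<Sum>\<alpha>\<in>?R {q}. freq_piece_l1 m \<epsilon> \<alpha> (?u k) n) ^ (2 * r))))"
          unfolding C0_def mult.assoc[of "2 * Ca"]
          by (rule superorthogonality[OF r Z _ \<epsilon>(1) \<epsilon>q spectrum_in_freq_piece_l1[OF m supp \<epsilon>(1) \<epsilon>1 u1] A[OF u1] Ca Cb])
            (use q in auto)
      qed
    qed
    have nX: "lp_norm (2 * real r) (\<lambda>n. sqrt (\<Sum>\<alpha>\<in>?R Z. (norm (?P \<alpha> f n))\<^sup>2)) = X powr (1 / (2 * real r))"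
    proof -
      have "norm (sqrt s) ^ (2 * r) = s ^ r" if "0 \<le> s" for s using that by (simp add: power_mult)
      then show ?thesis unfolding rr Lp_norm_nat[OF p] X_def by (simp add: sum_nonneg)
    qed
    have nY: "lp_norm (2 * real r) (\<lambda>n. (\<Sum>q\<in>Z. (norm (\<Sum>\<alpha>\<in>?R {q}. ?P \<alpha> f n)) ^ (2 * r)) powr (1 / (2 * real r)))
        = Y powr (1 / (2 * real r))"
    proof -
      have "norm (s powr (1 / real (2 * r))) powr real (2 * r) = s" if "0 \<le> s" for s
        using that p by (simp add: powr_powr)
      then show ?thesis unfolding rr Lp_norm_def Y_def by (simp add: sum_nonneg)
    qed
    have X0: "0 \<le> X" and Y0: "0 \<le> Y"
      by (auto simp: X_def Y_def intro!: Bochner_Integration.integral_nonneg sum_nonneg zero_le_power)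
    have "lp_norm (2 * real r) (\<lambda>n. \<Sum>\<alpha>\<in>?R Z. ?P \<alpha> f n) = l_sum (2 * r) (\<lambda>n. \<Sum>\<alpha>\<in>?R Z. ?P \<alpha> f n) powr (1 / (2 * real r))"
      unfolding rr by (rule Lp_norm_nat[OF p])
    also have "\<dots> \<le> C * X powr (1 / (2 * real r)) + C * Y powr (1 / (2 * real r))"
      unfolding C_def by (rule powr_add_bound[OF l_sum_nonneg main X0 Y0 K]) (use r in simp)
    finally show "lp_norm (2 * real r) (\<lambda>n. \<Sum>\<alpha>\<in>?R Z. ?P \<alpha> f n)
      \<le> C * lp_norm (2 * real r) (\<lambda>n. sqrt (\<Sum>\<alpha>\<in>?R Z. (norm (?P \<alpha> f n))^2))
        + C * lp_norm (2 * real r) (\<lambda>n. (\<Sum>q\<in>Z. (norm (\<Sum>\<alpha>\<in>?R {q}. ?P \<alpha> f n)) ^ (2 * r)) powr (1 / (2 * real r)))"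
      unfolding nX nY .
  qed
qed

end
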